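(* Let $\mathcal{M}$ be a Markov automaton, $\delta>0$ a digitization constant with digitization $\mathcal{M}_\delta$, and let $\mathbb{O}=(O_1,\dots,O_d)$ be objectives, each a timed or untimed reachability objective $\mathbb{P}(\Diamond^IG)$ with $I$ well-formed w.r.t. $\delta$ or an expected reward objective $\mathbb{E}(\rho_j,G)$, with threshold relations $\rhd\in\{<,\le,>,\ge\}^d$. Let $U=\{p'\in\mathbb{R}^d\mid\forall p\in\mathbb{R}^d\colon p'\in B(p)\Rightarrow\mathrm{achieve}^{\mathcal{M}_\delta}(\mathbb{O}\rhd p)\}$ and $V=\{p'\in\mathbb{R}^d\mid\exists p\in\mathbb{R}^d\colon p'\in B(p)\text{ and }\mathrm{achieve}^{\mathcal{M}_\delta}(\mathbb{O}\rhd p)\}$. Then $U\subseteq\{p\in\mathbb{R}^d\mid\mathrm{achieve}^{\mathcal{M}}(\mathbb{O}\rhd p)\}\subseteq V$.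
   Context: A Markov automaton $\mathcal{M}=(S,\mathit{Act},\to,s_0,\{\rho_1,\dots,\rho_\ell\})$ has finite states $S=PS\,\dot\cup\,MS$ (probabilistic states with action transitions, Markovian states with one rate-labelled transition; maximal progress), a finite action set with distinguished $\bot$, reward functions $\rho_i\colon S\,\dot\cup\,(S\times\mathit{Act})\to\mathbb{R}_{\ge0}$; it is action-deterministic, every state has an outgoing transition, and it is non-Zeno. $E(s)$ is the exit rate of $s\in MS$, $P(s,\alpha,s')$ the transition probabilities ($\alpha=\bot$ for Markovian transitions), $\lambda=\max\{E(s)\mid s\in MS\}$. Paths $s_0\xrightarrow{\kappa_0}s_1\cdots$ carry an action at $PS$ ($t(\kappa)=0,\alpha(\kappa)=\kappa$) and a sojourn time at $MS$ ($t(\kappa)=\kappa,\alpha(\kappa)=\bot$); $T(\pi[n])=\sum_{i<n}t(\kappa_i)$. Generic schedulers $\sigma$ map finite paths measurably to distributions over enabled actions, inducing $\Pr^{\mathcal{M}}_\sigma$ (probabilistic steps by $\sigma$ and $P$; sojourn at $s\in MS$ with density $E(s)e^{-E(s)t}$, successor by $P(s,\bot,\cdot)$). Objectives on $\mathcal{M}$: $\mathbb{P}(\Diamond^IG)$ has value $\Pr^{\mathcal{M}}_\sigma(\Diamond^IG)$ where $I=[a,b]$ or $[a,\infty)$, $0\le a<b$, and $\Diamond^IG$ is the set of paths with some $n$, $s_n\in G$, $I\cap[T(\pi[n]),T(\pi[n])+t(\kappa_n)]\ne\emptyset$; $\mathbb{E}(\rho_j,G)$ has value the expected reward ($\sum\rho_j(s_i)t(\kappa_i)+\rho_j(s_i,\alpha(\kappa_i))$)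 collected until the first visit of $G$ (or along the whole path if $G$ is never visited). $I$ is well-formed w.r.t. $\delta$ if $k_a=a/\delta\in\mathbb{N}$ and (if bounded) $k_b=b/\delta\in\mathbb{N}$. Digitization: the MDP $\mathcal{M}_\delta=(S,\mathit{Act},P_\delta,s_0,\{\rho^\delta_i\})$ with, for $s\in MS$, $P_\delta(s,\bot,s')=P(s,\bot,s')(1-e^{-E(s)\delta})$ for $s'\ne s$, $P_\delta(s,\bot,s)=P(s,\bot,s)(1-e^{-E(s)\delta})+e^{-E(s)\delta}$, $P_\delta=P$ otherwise, and action rewards $\rho^\delta_i(s,\alpha)=\rho_i(s,\alpha)$ for $s\in PS$, $\rho^\delta_i(s,\bot)=(\rho_i(s,\bot)+\rho_i(s)/E(s))(1-e^{-E(s)\delta})$ for $s\in MS$, $0$ otherwise. MDP schedulers are history-dependent randomized. For a path $\bar\pi$ of $\mathcal{M}_\delta$, $\#ds(\bar\pi)$ is the number of positions $i<|\bar\pi|$ whose state is in $MS$; $\Diamond^J_{ds}G$ is the set of infinite paths of $\mathcal{M}_\delta$ with some $n$ whose $n$-th state is in $G$ and $\#ds(\bar\pi[n])\in J$. Digitized bounds: $\mathrm{di}([0,\infty))=\mathbb{N}$, $\mathrm{di}([0,b])=\{0,\dots,k_b\}$, for $a>0$: $\mathrm{di}([a,\infty))=\{k_a+1,k_a+2,\dots\}$, $\mathrm{di}([a,b])=\{k_a+1,\dots,k_b\}$. On $\mathcal{M}_\delta$ under scheduler $\sigma'$, $\mathbb{P}(\Diamond^IG)$ has value $\Pr^{\mathcal{M}_\delta}_{\sigma'}(\Diamond^{\mathrm{di}(I)}_{ds}G)$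 and $\mathbb{E}(\rho_j,G)$ has value the expected sum of $\rho^\delta_j(s_i,\alpha_i)$ until the first visit of $G$. For a model $\mathcal{N}$, $\mathrm{achieve}^{\mathcal{N}}(\mathbb{O}\rhd p)$ holds iff some scheduler of $\mathcal{N}$ makes the value of each $O_i$ satisfy $\rhd_ip_i$. Error bounds: for $a\ne0$, $\varepsilon^-([a,b])=\varepsilon^-([a,\infty))=1-(1+\lambda\delta)^{k_a}e^{-\lambda a}$; $\varepsilon^-([0,b])=\varepsilon^-([0,\infty))=0$; $\varepsilon^+([0,b])=1-(1+\lambda\delta)^{k_b}e^{-\lambda b}$; for $a\ne0$, $\varepsilon^+([a,\infty))=1-e^{-\lambda\delta}$ and $\varepsilon^+([a,b])=\varepsilon^+([0,b])+\varepsilon^+([a,\infty))$; $\varepsilon^+([0,\infty))=0$. For $p=(p_1,\dots,p_d)$, $B(p)=\prod_{i=1}^d[p_i-\varepsilon^-_i,\,p_i+\varepsilon^+_i]$, where $\varepsilon^\pm_i=\varepsilon^\pm(I)$ if $O_i=\mathbb{P}(\Diamond^IG)$ and $\varepsilon^\pm_i=0$ if $O_i$ is an expected reward objective. *)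

theory Defs
  imports "HOL-Probability.Probability"
begin

section \<open>Markov automata\<close>

text \<open>
  The finite sets of states and actions are the finite types \<open>'s\<close> and \<open>'a\<close>. A transition is
  labelled by an action (\<open>Inl\<close>) or by a rate (\<open>Inr\<close>); a reward function assigns rewards to states
  (\<open>Inl\<close>) and to state-action pairs (\<open>Inr\<close>). The field \<open>markov_act\<close> is the distinguished
  action \<open>\<bottom>\<close> of the action set.
\<close>

record ('s, 'a) markov_automaton =
  transitions :: "('s \<times> ('a + real) \<times> 's pmf) set"
  init_state :: 's
  markov_act :: 'a
  reward_funs :: "('s + 's \<times> 'a \<Rightarrow> real) list"

definition prob_states :: "('s, 'a) markov_automaton \<Rightarrow> 's set" where
  "prob_states M = {s. \<exists>\<alpha> \<mu>. (s, Inl \<alpha>, \<mu>) \<in> transitions M}"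

definition markov_states :: "('s, 'a) markov_automaton \<Rightarrow> 's set" where
  "markov_states M = {s. \<exists>r \<mu>. (s, Inr r, \<mu>) \<in> transitions M}"

locale markov_automaton =
  fixes M :: "('s::finite, 'a::finite) markov_automaton"
  assumes rate_pos: "(s, Inr r, \<mu>) \<in> transitions M \<Longrightarrow> r > 0"
    and rate_unique:
      "(s, Inr r, \<mu>) \<in> transitions M \<Longrightarrow> (s, Inr r', \<mu>') \<in> transitions M \<Longrightarrow> r = r' \<and> \<mu> = \<mu>'"
    and action_deterministic:
      "(s, Inl \<alpha>, \<mu>) \<in> transitions M \<Longrightarrow> (s, Inl \<alpha>, \<mu>') \<in> transitions M \<Longrightarrow> \<mu> = \<mu>'"
    and maximal_progress: "prob_states M \<inter> markov_states M = {}"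
    and no_terminal: "prob_states M \<union> markov_states M = UNIV"
    and reward_nonneg: "\<rho> \<in> set (reward_funs M) \<Longrightarrow> 0 \<le> \<rho> x"

definition exit_rate :: "('s, 'a) markov_automaton \<Rightarrow> 's \<Rightarrow> real" where
  "exit_rate M s = (THE r. \<exists>\<mu>. (s, Inr r, \<mu>) \<in> transitions M)"

definition max_rate :: "('s::finite, 'a) markov_automaton \<Rightarrow> real" where
  "max_rate M = Max (exit_rate M ` markov_states M)"

definition has_succ :: "('s, 'a) markov_automaton \<Rightarrow> 's \<Rightarrow> 'a \<Rightarrow> 's pmf \<Rightarrow> bool" where
  "has_succ M s \<alpha> \<mu> \<longleftrightarrow>
     (s, Inl \<alpha>, \<mu>) \<in> transitions M \<or> (\<alpha> = markov_act M \<and> (\<exists>r. (s, Inr r, \<mu>) \<in> transitions M))"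

definition trans_prob :: "('s, 'a) markov_automaton \<Rightarrow> 's \<Rightarrow> 'a \<Rightarrow> 's \<Rightarrow> real" where
  "trans_prob M s \<alpha> s' = (if \<exists>\<mu>. has_succ M s \<alpha> \<mu> then pmf (THE \<mu>. has_succ M s \<alpha> \<mu>) s' else 0)"

definition enabled :: "('s \<Rightarrow> 'a \<Rightarrow> 's \<Rightarrow> real) \<Rightarrow> 's \<Rightarrow> 'a set" where
  "enabled P s = {\<alpha>. \<exists>s'. P s \<alpha> s' > 0}"

definition successor :: "('s \<Rightarrow> 'a \<Rightarrow> 's \<Rightarrow> real) \<Rightarrow> 's \<Rightarrow> 'a \<Rightarrow> 's pmf" where
  "successor P s \<alpha> = embed_pmf (P s \<alpha>)"


section \<open>Paths, schedulers and the induced probability measure\<close>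

text \<open>
  The \<open>i\<close>-th entry of an infinite path \<open>s\<^sub>0 \<kappa>\<^sub>0 s\<^sub>1 \<kappa>\<^sub>1 \<dots>\<close> is the triple
  \<open>(s\<^sub>i, \<alpha>(\<kappa>\<^sub>i), t(\<kappa>\<^sub>i))\<close>; as \<open>s\<^sub>i\<close> determines which of \<open>\<alpha>(\<kappa>\<^sub>i) = \<bottom>\<close> and \<open>t(\<kappa>\<^sub>i) = 0\<close> carries no
  information, this determines \<open>\<kappa>\<^sub>i\<close>. A finite path is the list of its entries together with its
  last state.
\<close>

type_synonym ('s, 'a) entry = "'s \<times> 'a \<times> real"

abbreviation state_of :: "('s, 'a) entry \<Rightarrow> 's" where "state_of \<equiv> fst"
abbreviation act_of :: "('s, 'a) entry \<Rightarrow> 'a" where "act_of x \<equiv> fst (snd x)"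
abbreviation time_of :: "('s, 'a) entry \<Rightarrow> real" where "time_of x \<equiv> snd (snd x)"

definition entry_space :: "('s, 'a) entry measure" where
  "entry_space = count_space UNIV \<Otimes>\<^sub>M (count_space UNIV \<Otimes>\<^sub>M borel)"

text \<open>
  Schedulers are total on lists of entries. Their values on lists that are not paths of the
  automaton do not influence the induced measure.
\<close>

type_synonym ('s, 'a) ma_scheduler = "('s, 'a) entry list \<Rightarrow> 's \<Rightarrow> 'a pmf"

definition generic_scheduler :: "('s, 'a) markov_automaton \<Rightarrow> ('s, 'a) ma_scheduler \<Rightarrow> bool" where
  "generic_scheduler M \<sigma> \<longleftrightarrow>
     (\<forall>h s. set_pmf (\<sigma> h s) \<subseteq> enabled (trans_prob M) s) \<and>
     (\<forall>n s \<alpha>. (\<lambda>\<omega>. pmf (\<sigma> (map \<omega> [0..<n]) s) \<alpha>)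
        \<in> borel_measurable (Pi\<^sub>M {0..<n} (\<lambda>_. entry_space)))"

text \<open>Measure on infinite sequences given by conditional distributions (Ionescu-Tulcea).\<close>

definition path_measure ::
    "(nat \<Rightarrow> (nat \<Rightarrow> 'x) \<Rightarrow> 'x measure) \<Rightarrow> 'x measure \<Rightarrow> (nat \<Rightarrow> 'x) measure" where
  "path_measure K N = projective_family.lim UNIV (Ionescu_Tulcea.CI K (\<lambda>_. N)) (\<lambda>_. N)"

definition sojourn :: "('s, 'a) markov_automaton \<Rightarrow> 's \<Rightarrow> real measure" where
  "sojourn M s =
     (if s \<in> markov_states M then density lborel (exponential_density (exit_rate M s))
      else return borel 0)"

definition entry_dist ::
    "('s, 'a) markov_automaton \<Rightarrow> ('s, 'a) ma_scheduler \<Rightarrow> ('s, 'a) entry list \<Rightarrow> 's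
      \<Rightarrow> ('s, 'a) entry measure" where
  "entry_dist M \<sigma> h s =
     return (count_space UNIV) s \<Otimes>\<^sub>M (measure_pmf (\<sigma> h s) \<Otimes>\<^sub>M sojourn M s)"

definition ma_kernel ::
    "('s, 'a) markov_automaton \<Rightarrow> ('s, 'a) ma_scheduler \<Rightarrow> nat \<Rightarrow> (nat \<Rightarrow> ('s, 'a) entry)
      \<Rightarrow> ('s, 'a) entry measure" where
  "ma_kernel M \<sigma> n \<omega> =
     (case n of
        0 \<Rightarrow> entry_dist M \<sigma> [] (init_state M)
      | Suc k \<Rightarrow> measure_pmf (successor (trans_prob M) (state_of (\<omega> k)) (act_of (\<omega> k)))
                  \<bind> entry_dist M \<sigma> (map \<omega> [0..<n]))"

definition ma_paths ::
    "('s, 'a) markov_automaton \<Rightarrow> ('s, 'a) ma_scheduler \<Rightarrow> (nat \<Rightarrow> ('s, 'a) entry) measure" where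
  "ma_paths M \<sigma> = path_measure (ma_kernel M \<sigma>) entry_space"

definition elapsed :: "(nat \<Rightarrow> ('s, 'a) entry) \<Rightarrow> nat \<Rightarrow> real" where
  "elapsed \<omega> n = (\<Sum>i<n. time_of (\<omega> i))"

locale nonzeno_markov_automaton = markov_automaton M
  for M :: "('s::finite, 'a::finite) markov_automaton" +
  assumes nonzeno:
    "generic_scheduler M \<sigma> \<Longrightarrow> AE \<omega> in ma_paths M \<sigma>. filterlim (elapsed \<omega>) at_top sequentially"


section \<open>Objectives\<close>

text \<open>\<open>Bounded a b\<close> is \<open>[a, b]\<close> and \<open>Unbounded a\<close> is \<open>[a, \<infinity>)\<close>.\<close>

datatype time_interval = Bounded real real | Unbounded real

fun interval_set :: "time_interval \<Rightarrow> real set" where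
  "interval_set (Bounded a b) = {a..b}"
| "interval_set (Unbounded a) = {a..}"

fun well_formed :: "real \<Rightarrow> time_interval \<Rightarrow> bool" where
  "well_formed \<delta> (Bounded a b) \<longleftrightarrow> 0 \<le> a \<and> a < b \<and> a / \<delta> \<in> \<nat> \<and> b / \<delta> \<in> \<nat>"
| "well_formed \<delta> (Unbounded a) \<longleftrightarrow> 0 \<le> a \<and> a / \<delta> \<in> \<nat>"

text \<open>\<open>ExpReward j G\<close> refers to the \<open>j\<close>-th reward function, counted from \<open>0\<close>.\<close>

datatype 's objective = Reach time_interval "'s set" | ExpReward nat "'s set"

fun valid_objective :: "('s, 'a) markov_automaton \<Rightarrow> real \<Rightarrow> 's objective \<Rightarrow> bool" where
  "valid_objective M \<delta> (Reach I G) \<longleftrightarrow> well_formed \<delta> I"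
| "valid_objective M \<delta> (ExpReward j G) \<longleftrightarrow> j < length (reward_funs M)"

definition reach_within :: "time_interval \<Rightarrow> 's set \<Rightarrow> (nat \<Rightarrow> ('s, 'a) entry) set" where
  "reach_within I G =
     {\<omega>. \<exists>n. state_of (\<omega> n) \<in> G \<and>
        interval_set I \<inter> {elapsed \<omega> n .. elapsed \<omega> n + time_of (\<omega> n)} \<noteq> {}}"

definition ma_reward ::
    "('s + 's \<times> 'a \<Rightarrow> real) \<Rightarrow> 's set \<Rightarrow> (nat \<Rightarrow> ('s, 'a) entry) \<Rightarrow> ennreal" where
  "ma_reward \<rho> G \<omega> =
     (\<Sum>i. if \<forall>k\<le>i. state_of (\<omega> k) \<notin> G
          then ennreal (\<rho> (Inl (state_of (\<omega> i))) * time_of (\<omega> i)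
                 + \<rho> (Inr (state_of (\<omega> i), act_of (\<omega> i))))
          else 0)"

fun ma_value :: "('s, 'a) markov_automaton \<Rightarrow> ('s, 'a) ma_scheduler \<Rightarrow> 's objective \<Rightarrow> ereal" where
  "ma_value M \<sigma> (Reach I G) = ereal (measure (ma_paths M \<sigma>) (reach_within I G))"
| "ma_value M \<sigma> (ExpReward j G) =
     enn2ereal (\<integral>\<^sup>+\<omega>. ma_reward (reward_funs M ! j) G \<omega> \<partial>ma_paths M \<sigma>)"

datatype threshold = Less | LessEq | Greater | GreaterEq

fun satisfies :: "ereal \<Rightarrow> threshold \<Rightarrow> real \<Rightarrow> bool" where
  "satisfies v Less p \<longleftrightarrow> v < ereal p"
| "satisfies v LessEq p \<longleftrightarrow> v \<le> ereal p"
| "satisfies v Greater p \<longleftrightarrow> v > ereal p"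
| "satisfies v GreaterEq p \<longleftrightarrow> v \<ge> ereal p"

definition achieve_ma ::
    "('s, 'a) markov_automaton \<Rightarrow> ('d \<Rightarrow> 's objective) \<Rightarrow> ('d \<Rightarrow> threshold) \<Rightarrow> real ^ 'd::finite \<Rightarrow> bool"
  where
  "achieve_ma M \<O> R p \<longleftrightarrow>
     (\<exists>\<sigma>. generic_scheduler M \<sigma> \<and> (\<forall>i. satisfies (ma_value M \<sigma> (\<O> i)) (R i) (p $ i)))"


section \<open>Markov decision processes and digitization\<close>

record ('s, 'a) mdp =
  mdp_prob :: "'s \<Rightarrow> 'a \<Rightarrow> 's \<Rightarrow> real"
  mdp_init :: 's
  mdp_rewards :: "('s \<Rightarrow> 'a \<Rightarrow> real) list"

type_synonym ('s, 'a) mdp_scheduler = "('s \<times> 'a) list \<Rightarrow> 's \<Rightarrow> 'a pmf"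

definition valid_mdp_scheduler :: "('s, 'a) mdp \<Rightarrow> ('s, 'a) mdp_scheduler \<Rightarrow> bool" where
  "valid_mdp_scheduler D \<sigma> \<longleftrightarrow> (\<forall>h s. set_pmf (\<sigma> h s) \<subseteq> enabled (mdp_prob D) s)"

definition mdp_kernel ::
    "('s, 'a) mdp \<Rightarrow> ('s, 'a) mdp_scheduler \<Rightarrow> nat \<Rightarrow> (nat \<Rightarrow> 's \<times> 'a) \<Rightarrow> ('s \<times> 'a) measure" where
  "mdp_kernel D \<sigma> n \<omega> = measure_pmf
     (case n of
        0 \<Rightarrow> map_pmf (Pair (mdp_init D)) (\<sigma> [] (mdp_init D))
      | Suc k \<Rightarrow> bind_pmf (successor (mdp_prob D) (fst (\<omega> k)) (snd (\<omega> k)))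
                  (\<lambda>s. map_pmf (Pair s) (\<sigma> (map \<omega> [0..<n]) s)))"

definition mdp_paths :: "('s, 'a) mdp \<Rightarrow> ('s, 'a) mdp_scheduler \<Rightarrow> (nat \<Rightarrow> 's \<times> 'a) measure" where
  "mdp_paths D \<sigma> = path_measure (mdp_kernel D \<sigma>) (count_space UNIV)"

definition digit_prob :: "('s, 'a) markov_automaton \<Rightarrow> real \<Rightarrow> 's \<Rightarrow> 'a \<Rightarrow> 's \<Rightarrow> real" where
  "digit_prob M \<delta> s \<alpha> s' =
     (if s \<in> markov_states M \<and> \<alpha> = markov_act M then
        trans_prob M s \<alpha> s' * (1 - exp (- exit_rate M s * \<delta>))
          + (if s' = s then exp (- exit_rate M s * \<delta>) else 0)
      else trans_prob M s \<alpha> s')"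

definition digit_reward ::
    "('s, 'a) markov_automaton \<Rightarrow> real \<Rightarrow> ('s + 's \<times> 'a \<Rightarrow> real) \<Rightarrow> 's \<Rightarrow> 'a \<Rightarrow> real" where
  "digit_reward M \<delta> \<rho> s \<alpha> =
     (if s \<in> prob_states M then \<rho> (Inr (s, \<alpha>))
      else if s \<in> markov_states M \<and> \<alpha> = markov_act M then
        (\<rho> (Inr (s, \<alpha>)) + \<rho> (Inl s) / exit_rate M s) * (1 - exp (- exit_rate M s * \<delta>))
      else 0)"

definition digitization :: "('s, 'a) markov_automaton \<Rightarrow> real \<Rightarrow> ('s, 'a) mdp" where
  "digitization M \<delta> =
     \<lparr>mdp_prob = digit_prob M \<delta>,
      mdp_init = init_state M,
      mdp_rewards = map (digit_reward M \<delta>) (reward_funs M)\<rparr>"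

definition digit_steps :: "('s, 'a) markov_automaton \<Rightarrow> (nat \<Rightarrow> 's \<times> 'a) \<Rightarrow> nat \<Rightarrow> nat" where
  "digit_steps M \<omega> n = card {i. i < n \<and> fst (\<omega> i) \<in> markov_states M}"

definition reach_steps ::
    "('s, 'a) markov_automaton \<Rightarrow> nat set \<Rightarrow> 's set \<Rightarrow> (nat \<Rightarrow> 's \<times> 'a) set" where
  "reach_steps M J G = {\<omega>. \<exists>n. fst (\<omega> n) \<in> G \<and> digit_steps M \<omega> n \<in> J}"

text \<open>For well-formed bounds \<open>x\<close> this is \<open>x / \<delta>\<close> itself.\<close>

definition num_steps :: "real \<Rightarrow> real \<Rightarrow> nat" where
  "num_steps \<delta> x = nat \<lfloor>x / \<delta>\<rfloor>"

fun digit_bound :: "real \<Rightarrow> time_interval \<Rightarrow> nat set" where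
  "digit_bound \<delta> (Bounded a b) =
     (if a = 0 then {0..num_steps \<delta> b} else {num_steps \<delta> a + 1..num_steps \<delta> b})"
| "digit_bound \<delta> (Unbounded a) = (if a = 0 then UNIV else {num_steps \<delta> a + 1..})"

definition mdp_reward :: "('s \<Rightarrow> 'a \<Rightarrow> real) \<Rightarrow> 's set \<Rightarrow> (nat \<Rightarrow> 's \<times> 'a) \<Rightarrow> ennreal" where
  "mdp_reward \<rho> G \<omega> =
     (\<Sum>i. if \<forall>k\<le>i. fst (\<omega> k) \<notin> G then ennreal (\<rho> (fst (\<omega> i)) (snd (\<omega> i))) else 0)"

fun digit_value ::
    "('s, 'a) markov_automaton \<Rightarrow> real \<Rightarrow> ('s, 'a) mdp_scheduler \<Rightarrow> 's objective \<Rightarrow> ereal" where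
  "digit_value M \<delta> \<sigma> (Reach I G) =
     ereal (measure (mdp_paths (digitization M \<delta>) \<sigma>) (reach_steps M (digit_bound \<delta> I) G))"
| "digit_value M \<delta> \<sigma> (ExpReward j G) =
     enn2ereal (\<integral>\<^sup>+\<omega>. mdp_reward (mdp_rewards (digitization M \<delta>) ! j) G \<omega>
       \<partial>mdp_paths (digitization M \<delta>) \<sigma>)"

definition achieve_digit ::
    "('s, 'a) markov_automaton \<Rightarrow> real \<Rightarrow> ('d \<Rightarrow> 's objective) \<Rightarrow> ('d \<Rightarrow> threshold)
      \<Rightarrow> real ^ 'd::finite \<Rightarrow> bool" where
  "achieve_digit M \<delta> \<O> R p \<longleftrightarrow>
     (\<exists>\<sigma>. valid_mdp_scheduler (digitization M \<delta>) \<sigma> \<and>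
        (\<forall>i. satisfies (digit_value M \<delta> \<sigma> (\<O> i)) (R i) (p $ i)))"


section \<open>Error bounds\<close>

text \<open>\<open>l\<close> is the maximal exit rate.\<close>

fun err_minus :: "real \<Rightarrow> real \<Rightarrow> time_interval \<Rightarrow> real" where
  "err_minus l \<delta> (Bounded a b) =
     (if a = 0 then 0 else 1 - (1 + l * \<delta>) ^ num_steps \<delta> a * exp (- l * a))"
| "err_minus l \<delta> (Unbounded a) =
     (if a = 0 then 0 else 1 - (1 + l * \<delta>) ^ num_steps \<delta> a * exp (- l * a))"

fun err_plus :: "real \<Rightarrow> real \<Rightarrow> time_interval \<Rightarrow> real" where
  "err_plus l \<delta> (Bounded a b) =
     (1 - (1 + l * \<delta>) ^ num_steps \<delta> b * exp (- l * b)) + (if a = 0 then 0 else 1 - exp (- l * \<delta>))"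
| "err_plus l \<delta> (Unbounded a) = (if a = 0 then 0 else 1 - exp (- l * \<delta>))"

fun objective_err_minus ::
    "('s::finite, 'a) markov_automaton \<Rightarrow> real \<Rightarrow> 's objective \<Rightarrow> real" where
  "objective_err_minus M \<delta> (Reach I G) = err_minus (max_rate M) \<delta> I"
| "objective_err_minus M \<delta> (ExpReward j G) = 0"

fun objective_err_plus ::
    "('s::finite, 'a) markov_automaton \<Rightarrow> real \<Rightarrow> 's objective \<Rightarrow> real" where
  "objective_err_plus M \<delta> (Reach I G) = err_plus (max_rate M) \<delta> I"
| "objective_err_plus M \<delta> (ExpReward j G) = 0"

definition err_box ::
    "('s::finite, 'a) markov_automaton \<Rightarrow> real \<Rightarrow> ('d \<Rightarrow> 's objective)
      \<Rightarrow> real ^ 'd::finite \<Rightarrow> (real ^ 'd) set" where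
  "err_box M \<delta> \<O> p =
     {p'. \<forall>i. p' $ i \<in> {p $ i - objective_err_minus M \<delta> (\<O> i) .. p $ i + objective_err_plus M \<delta> (\<O> i)}}"


section \<open>Well-definedness\<close>

lemma sets_sojourn[measurable_cong, simp]: "sets (sojourn M s) = sets borel"
  by (simp add: sojourn_def)

lemma sets_entry_dist[measurable_cong, simp]: "sets (entry_dist M \<sigma> h s) = sets entry_space"
  unfolding entry_dist_def entry_space_def by (intro sets_pair_measure_cong) auto

context markov_automaton
begin

lemma exit_rate_eq: "(s, Inr r, \<mu>) \<in> transitions M \<Longrightarrow> exit_rate M s = r"
  unfolding exit_rate_def by (rule the_equality) (auto dest: rate_unique)

lemma exit_rate_pos: "s \<in> markov_states M \<Longrightarrow> exit_rate M s > 0"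
  using exit_rate_eq rate_pos unfolding markov_states_def by blast

lemma has_succ_unique:
  assumes "has_succ M s \<alpha> \<mu>" "has_succ M s \<alpha> \<mu>'" shows "\<mu> = \<mu>'"
proof -
  have "\<not> (s \<in> prob_states M \<and> s \<in> markov_states M)"
    using maximal_progress by auto
  then show ?thesis
    using assms action_deterministic rate_unique
    unfolding has_succ_def prob_states_def markov_states_def by blast
qed

lemma trans_prob_eq: "has_succ M s \<alpha> \<mu> \<Longrightarrow> trans_prob M s \<alpha> = pmf \<mu>"
proof
  fix s' assume \<mu>: "has_succ M s \<alpha> \<mu>"
  then have "(THE \<mu>. has_succ M s \<alpha> \<mu>) = \<mu>"
    using has_succ_unique by blast
  then show "trans_prob M s \<alpha> s' = pmf \<mu> s'"
    using \<mu> by (auto simp: trans_prob_def)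
qed

lemma enabled_iff: "\<alpha> \<in> enabled (trans_prob M) s \<longleftrightarrow> (\<exists>\<mu>. has_succ M s \<alpha> \<mu>)"
proof
  assume "\<alpha> \<in> enabled (trans_prob M) s"
  then show "\<exists>\<mu>. has_succ M s \<alpha> \<mu>"
    by (auto simp: enabled_def trans_prob_def split: if_splits)
next
  assume "\<exists>\<mu>. has_succ M s \<alpha> \<mu>"
  then obtain \<mu> where \<mu>: "has_succ M s \<alpha> \<mu>" by blast
  obtain s' where "s' \<in> set_pmf \<mu>" using set_pmf_not_empty by fastforce
  then have "pmf \<mu> s' > 0" by (simp add: pmf_positive)
  then show "\<alpha> \<in> enabled (trans_prob M) s"
    using trans_prob_eq[OF \<mu>] by (auto simp: enabled_def)
qed

lemma enabled_markov:
  assumes "s \<in> markov_states M" shows "enabled (trans_prob M) s = {markov_act M}"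
proof -
  have "s \<notin> prob_states M" using assms maximal_progress by auto
  then show ?thesis
    using assms unfolding set_eq_iff enabled_iff has_succ_def prob_states_def markov_states_def by blast
qed

lemma enabled_nonempty: "enabled (trans_prob M) s \<noteq> {}"
proof -
  have "s \<in> prob_states M \<or> s \<in> markov_states M" using no_terminal by auto
  then have "\<exists>\<alpha> \<mu>. has_succ M s \<alpha> \<mu>"
    by (auto simp: has_succ_def prob_states_def markov_states_def)
  then show ?thesis using enabled_iff by blast
qed

lemma successor_eq: "has_succ M s \<alpha> \<mu> \<Longrightarrow> successor (trans_prob M) s \<alpha> = \<mu>"
  unfolding successor_def trans_prob_eq
  by (rule pmf_eqI, subst pmf_embed_pmf) (auto simp: nn_integral_pmf_eq_1)

lemma pmf_digit_successor:
  assumes "\<delta> > 0" "\<alpha> \<in> enabled (trans_prob M) s"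
  shows "pmf (successor (digit_prob M \<delta>) s \<alpha>) s' = digit_prob M \<delta> s \<alpha> s'"
proof -
  obtain \<mu> where \<mu>: "has_succ M s \<alpha> \<mu>" using assms enabled_iff by blast
  have E: "0 \<le> exit_rate M s * \<delta>" if "s \<in> markov_states M"
    using exit_rate_pos[OF that] assms by simp
  have nn: "0 \<le> digit_prob M \<delta> s \<alpha> x" for x
  proof (cases "s \<in> markov_states M \<and> \<alpha> = markov_act M")
    case True
    then have "0 \<le> 1 - exp (- exit_rate M s * \<delta>)" using E by simp
    then show ?thesis
      unfolding digit_prob_def trans_prob_eq[OF \<mu>] using True
      by (simp add: add_nonneg_nonneg mult_nonneg_nonneg del: exp_le_one_iff diff_ge_0_iff_ge)
  qed (auto simp: digit_prob_def trans_prob_eq[OF \<mu>])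
  have one: "(\<Sum>x\<in>UNIV. pmf \<mu> x) = 1"
    by (rule sum_pmf_eq_1) auto
  have "(\<Sum>x\<in>UNIV. digit_prob M \<delta> s \<alpha> x) = 1"
  proof (cases "s \<in> markov_states M \<and> \<alpha> = markov_act M")
    case True
    then have "(\<Sum>x\<in>UNIV. digit_prob M \<delta> s \<alpha> x)
        = (\<Sum>x\<in>UNIV. pmf \<mu> x) * (1 - exp (- exit_rate M s * \<delta>)) + exp (- exit_rate M s * \<delta>)"
      unfolding digit_prob_def trans_prob_eq[OF \<mu>]
      by (simp add: True sum.distrib sum_distrib_right)
    then show ?thesis unfolding one by simp
  next
    case False
    then have "digit_prob M \<delta> s \<alpha> x = pmf \<mu> x" for x
      unfolding digit_prob_def trans_prob_eq[OF \<mu>] by (rule if_not_P)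
    then show ?thesis using one by simp
  qed
  then have "(\<integral>\<^sup>+x. ennreal (digit_prob M \<delta> s \<alpha> x) \<partial>count_space UNIV) = 1"
    using nn by (simp add: nn_integral_count_space_finite sum_ennreal)
  then show ?thesis
    unfolding successor_def using nn by (intro pmf_embed_pmf) auto
qed

lemma enabled_digit_prob:
  assumes "\<delta> > 0" shows "enabled (digit_prob M \<delta>) s = enabled (trans_prob M) s"
proof (rule set_eqI, rule iffI)
  fix \<alpha> assume "\<alpha> \<in> enabled (digit_prob M \<delta>) s"
  then show "\<alpha> \<in> enabled (trans_prob M) s"
    using enabled_markov[of s]
    by (cases "s \<in> markov_states M \<and> \<alpha> = markov_act M") (auto simp: enabled_def digit_prob_def)
next
  fix \<alpha> assume \<alpha>: "\<alpha> \<in> enabled (trans_prob M) s"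
  obtain s' where "s' \<in> set_pmf (successor (digit_prob M \<delta>) s \<alpha>)"
    using set_pmf_not_empty by fastforce
  then have "digit_prob M \<delta> s \<alpha> s' > 0"
    using pmf_digit_successor[OF assms \<alpha>, of s'] pmf_positive by metis
  then show "\<alpha> \<in> enabled (digit_prob M \<delta>) s" by (auto simp: enabled_def)
qed

lemma prob_space_sojourn: "prob_space (sojourn M s)"
proof (cases "s \<in> markov_states M")
  case True
  then show ?thesis
    by (simp only: sojourn_def if_True prob_space_exponential_density[OF exit_rate_pos[OF True]])
next
  case False
  then show ?thesis
    by (simp only: sojourn_def if_False) (rule prob_space_return, simp)
qed

lemma prob_space_entry_dist: "prob_space (entry_dist M \<sigma> h s)"
  unfolding entry_dist_def
  by (intro prob_space_pair prob_space_sojourn prob_space_measure_pmf prob_space_return) simp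

lemma measurable_entry_dist:
  assumes "generic_scheduler M \<sigma>"
  shows "(\<lambda>\<omega>. entry_dist M \<sigma> (map \<omega> [0..<n]) s)
    \<in> Pi\<^sub>M {0..<n} (\<lambda>_. entry_space) \<rightarrow>\<^sub>M subprob_algebra entry_space"
proof -
  let ?N = "Pi\<^sub>M {0..<n} (\<lambda>_. entry_space :: ('s, 'a) entry measure)"
  have *: "(\<lambda>\<omega>. measure_pmf (\<sigma> (map \<omega> [0..<n]) s)) \<in> ?N \<rightarrow>\<^sub>M subprob_algebra (count_space UNIV)"
  proof (rule measurable_subprob_algebra)
    fix A :: "'a set"
    have "(\<lambda>\<omega>. ennreal (\<Sum>\<alpha>\<in>A. pmf (\<sigma> (map \<omega> [0..<n]) s) \<alpha>)) \<in> borel_measurable ?N"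
      using assms unfolding generic_scheduler_def
      by (intro measurable_compose[OF _ measurable_ennreal] borel_measurable_sum) auto
    then show "(\<lambda>\<omega>. emeasure (measure_pmf (\<sigma> (map \<omega> [0..<n]) s)) A) \<in> borel_measurable ?N"
      by (simp add: measure_pmf.emeasure_eq_measure measure_measure_pmf_finite)
  qed (auto intro: prob_space_imp_subprob_space prob_space_measure_pmf)
  show ?thesis
    unfolding entry_dist_def entry_space_def
    using * by (intro measurable_pair_measure measurable_const)
      (auto simp: space_subprob_algebra entry_space_def
        intro!: prob_space_imp_subprob_space prob_space_sojourn prob_space_return)
qed

theorem Ionescu_Tulcea_ma_kernel:
  assumes "generic_scheduler M \<sigma>"
  shows "Ionescu_Tulcea (ma_kernel M \<sigma>) (\<lambda>_. entry_space)"
proof (rule Ionescu_Tulcea.intro)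
  fix n :: nat
  let ?N = "Pi\<^sub>M {0..<n} (\<lambda>_. entry_space :: ('s, 'a) entry measure)"
  have ed: "entry_dist M \<sigma> h s \<in> space (subprob_algebra entry_space)" for h s
    by (auto simp: space_subprob_algebra intro!: prob_space_imp_subprob_space prob_space_entry_dist)
  show "ma_kernel M \<sigma> n \<in> ?N \<rightarrow>\<^sub>M subprob_algebra entry_space"
  proof (cases n)
    case 0
    then show ?thesis
      unfolding ma_kernel_def by (simp add: ed)
  next
    case (Suc k)
    have comp: "(\<lambda>\<omega>. \<omega> k) \<in> ?N \<rightarrow>\<^sub>M entry_space"
      using Suc by (intro measurable_component_singleton) auto
    have s: "(\<lambda>\<omega>. state_of (\<omega> k)) \<in> ?N \<rightarrow>\<^sub>M count_space UNIV"
      using comp unfolding entry_space_def by measurable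
    have a: "(\<lambda>\<omega>. act_of (\<omega> k)) \<in> ?N \<rightarrow>\<^sub>M count_space UNIV"
      using comp unfolding entry_space_def by measurable
    have sa: "(\<lambda>\<omega>. (state_of (\<omega> k), act_of (\<omega> k))) \<in> ?N \<rightarrow>\<^sub>M count_space UNIV"
      using measurable_Pair[OF s a] by (simp add: pair_measure_countable)
    have sc: "(\<lambda>\<omega>. measure_pmf (successor (trans_prob M) (state_of (\<omega> k)) (act_of (\<omega> k))))
        \<in> ?N \<rightarrow>\<^sub>M subprob_algebra (count_space UNIV)"
      using measurable_compose[OF sa,
          of "\<lambda>(s, a). measure_pmf (successor (trans_prob M) s a)" "subprob_algebra (count_space UNIV)"]
      by (simp add: measure_pmf_in_subprob_algebra split_beta')
    have ms: "(\<lambda>\<omega>. entry_dist M \<sigma> (map (fst \<omega>) [0..<n]) (snd \<omega>))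
        \<in> ?N \<Otimes>\<^sub>M count_space UNIV \<rightarrow>\<^sub>M subprob_algebra entry_space"
      by (rule measurable_compose_countable'
            [where f = "\<lambda>s \<omega>. entry_dist M \<sigma> (map (fst \<omega>) [0..<n]) s" and g = snd and I = UNIV])
        (auto intro: countable_finite measurable_compose[OF measurable_fst measurable_entry_dist[OF assms]])
    have "ma_kernel M \<sigma> n = (\<lambda>\<omega>. measure_pmf
        (successor (trans_prob M) (state_of (\<omega> k)) (act_of (\<omega> k))) \<bind> entry_dist M \<sigma> (map \<omega> [0..<n]))"
      by (simp only: ma_kernel_def Suc nat.case fun_eq_iff simp_thms)
    then show ?thesis
      using measurable_bind[OF sc ms] by (simp only:)
  qed
  show "prob_space (ma_kernel M \<sigma> n \<omega>)" if "\<omega> \<in> space ?N" for \<omega>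
    by (auto simp: ma_kernel_def prob_space_entry_dist ed split: nat.split
        intro!: measure_pmf.prob_space_bind[where S = entry_space])
qed

end

theorem Ionescu_Tulcea_mdp_kernel:
  fixes D :: "('s::finite, 'a::finite) mdp"
  shows "Ionescu_Tulcea (mdp_kernel D \<sigma>) (\<lambda>_. count_space UNIV)"
proof (rule Ionescu_Tulcea.intro)
  fix n :: nat
  let ?N = "Pi\<^sub>M {0..<n} (\<lambda>_. count_space UNIV :: ('s \<times> 'a) measure)"
  have "?N = count_space ({0..<n} \<rightarrow>\<^sub>E UNIV)"
    by (intro count_space_PiM_finite) auto
  then show "mdp_kernel D \<sigma> n \<in> ?N \<rightarrow>\<^sub>M subprob_algebra (count_space UNIV)"
    by (auto simp: mdp_kernel_def measure_pmf_in_subprob_algebra)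
qed (simp add: mdp_kernel_def prob_space_measure_pmf)

end

theory Submission
  imports Defs
begin

text \<open>
  A path of the automaton is digitized by repeating each Markovian entry with sojourn time \<open>t\<close>
  \<open>\<lfloor>t / \<delta>\<rfloor> + 1\<close> times. Since exponential sojourn times are memoryless, the image of the path measure
  under this map is the path measure of \<open>M\<^sub>\<delta>\<close> for the scheduler given by conditional probabilities of
  actions. Conversely, a scheduler of \<open>M\<^sub>\<delta>\<close> is simulated in \<open>M\<close> by applying it to the digitized
  history. So both models can be compared on one probability space. There the expected rewards agree,
  because a Markovian entry has \<open>1 / (1 - exp (- E \<delta>))\<close> copies on average. The reachability events
  differ only if more than \<open>k\<close> digitization steps end within time \<open>k \<delta>\<close>, or if the Markovian state
  occupied at time \<open>a\<close> is left before \<open>a + \<delta>\<close>. The first probability is bounded by a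
  submartingale argument, the second one by memorylessness.
\<close>

subsection \<open>Ionescu-Tulcea measures\<close>

text \<open>The digitized path does not reveal where its blocks begin: a loop at a Markovian state
  of the MDP is either an unfinished sojourn or a genuine self-loop. So the digitization map has no
  inverse, and its image measure is identified through the recursion of its cylinder probabilities,
  position by position. Both passages between schedulers are independent of the objectives, so one
  scheduler serves all of them at once and only a signed error per objective has to be controlled.
  Sojourn times are rounded up separately, the grid restarting at every jump. The digital clock
  therefore never lags behind real time, and a path can go wrong only by its running ahead or by the
  rounding at the lower bound a; this is why the errors are asymmetric. The factor (1 +
  \<lambda>\<delta>) exp(-\<lambda>\<delta>), the Poisson probability of at most one jump during
  \<delta>, arises because the one-step inequality of the submartingale is an equality for sojourns
  of rate \<lambda>; smaller rates only help.\<close>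

lemma (in Ionescu_Tulcea) up_to_atLeastLessThan: "up_to {0..<n} = n"
proof (rule antisym)
  show "up_to {0..<n} \<le> n" by (simp add: up_to_iff_Ico)
  show "n \<le> up_to {0..<n}"
    using up_to_less[of "{0..<n}" "n - 1"] by (cases n) auto
qed

text \<open>The limit is described by its projections to finite index sets \<open>J\<close>, each
  obtained from the chain run up to \<open>up_to J\<close>. For an initial segment that stopping
  point is \<open>n\<close> itself.\<close>

lemma (in Ionescu_Tulcea) distr_lim_C:
  "distr PF.lim (PiM {0..<n} M) (\<lambda>\<omega>. restrict \<omega> {0..<n}) = C 0 n (\<lambda>_. undefined)"
  using distr_C[of n n "\<lambda>_. undefined" 0]
  by (simp add: distr_lim CI_def up_to_atLeastLessThan)

text \<open>Tower rule for the last coordinate: the chain of length \<open>Suc n\<close> is the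
  chain of length \<open>n\<close> bound to the extension kernel \<open>eP n\<close>, which appends
  a coordinate drawn from \<open>P n\<close>.\<close>

lemma (in Ionescu_Tulcea) nn_integral_lim_step:
  assumes [measurable]: "f \<in> borel_measurable (PiM {0..<Suc n} M)"
  shows "(\<integral>\<^sup>+\<omega>. f (restrict \<omega> {0..<Suc n}) \<partial>PF.lim) =
    (\<integral>\<^sup>+\<omega>. (\<integral>\<^sup>+x. f (fun_upd (restrict \<omega> {0..<n}) n x) \<partial>P n (restrict \<omega> {0..<n})) \<partial>PF.lim)"
proof -
  have r: "(\<lambda>\<omega>. restrict \<omega> {0..<k}) \<in> PF.lim \<rightarrow>\<^sub>M PiM {0..<k} M" for k
    by (simp add: measurable_cong_sets[OF PF.sets_lim refl] measurable_restrict_subset)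
  have "(\<integral>\<^sup>+\<omega>. f (restrict \<omega> {0..<Suc n}) \<partial>PF.lim) = (\<integral>\<^sup>+\<omega>. f \<omega> \<partial>C 0 (Suc n) (\<lambda>_. undefined))"
    unfolding distr_lim_C[symmetric] by (rule nn_integral_distr[OF r, symmetric]) simp
  also have "\<dots> = (\<integral>\<^sup>+\<omega>. (\<integral>\<^sup>+x. f x \<partial>eP n \<omega>) \<partial>C 0 n (\<lambda>_. undefined))"
    using measurable_eP[of n] by (simp add: nn_integral_bind[where B = "PiM {0..<Suc n} M"] measurable_cong_sets[OF sets_C refl])
  also have "\<dots> = (\<integral>\<^sup>+\<omega>. (\<integral>\<^sup>+x. f x \<partial>eP n (restrict \<omega> {0..<n})) \<partial>PF.lim)"
    unfolding distr_lim_C[symmetric] using r measurable_eP[of n]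
    by (subst nn_integral_distr) (auto intro!: nn_integral_measurable_subprob_algebra2[where N = "PiM {0..<Suc n} M"])
  also have "\<dots> = (\<integral>\<^sup>+\<omega>. (\<integral>\<^sup>+x. f (fun_upd (restrict \<omega> {0..<n}) n x) \<partial>P n (restrict \<omega> {0..<n})) \<partial>PF.lim)"
    by (intro nn_integral_cong nn_integral_eP) (auto simp: space_PiM)
  finally show ?thesis .
qed

lemma
  assumes "Ionescu_Tulcea K (\<lambda>_. N)"
  shows sets_path_measure: "sets (path_measure K N) = sets (PiM UNIV (\<lambda>_. N))"
    and prob_space_path_measure: "prob_space (path_measure K N)"
proof -
  interpret Ionescu_Tulcea K "\<lambda>_. N" by fact
  show "sets (path_measure K N) = sets (PiM UNIV (\<lambda>_. N))"
    by (simp add: path_measure_def)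
  have "(\<lambda>\<omega>. restrict \<omega> {}) \<in> PF.lim \<rightarrow>\<^sub>M PiM {} (\<lambda>_. N)"
    unfolding measurable_cong_sets[OF PF.sets_lim refl] by (rule measurable_restrict_subset) simp
  moreover have "prob_space (distr PF.lim (PiM {} (\<lambda>_. N)) (\<lambda>\<omega>. restrict \<omega> {}))"
    unfolding distr_lim[OF finite.emptyI] by (rule PF.prob_space_P) auto
  ultimately show "prob_space (path_measure K N)"
    unfolding path_measure_def by (rule prob_space_distrD)
qed

text \<open>The tower rule without restrictions: integrand and kernel ignore coordinates beyond
  their horizon, so the \<open>undefined\<close> that \<open>restrict\<close> puts there does not
  change their values.\<close>

lemma nn_integral_path_measure_step:
  assumes IT: "Ionescu_Tulcea K (\<lambda>_. N)" and N: "space N = UNIV"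
    and F: "F \<in> borel_measurable (PiM UNIV (\<lambda>_. N))"
    and F_cong: "\<And>\<omega> \<omega>'. (\<And>i. i \<le> n \<Longrightarrow> \<omega> i = \<omega>' i) \<Longrightarrow> F \<omega> = F \<omega>'"
    and K_cong: "\<And>\<omega> \<omega>'. (\<And>i. i < n \<Longrightarrow> \<omega> i = \<omega>' i) \<Longrightarrow> K n \<omega> = K n \<omega>'"
  shows "(\<integral>\<^sup>+\<omega>. F \<omega> \<partial>path_measure K N) = (\<integral>\<^sup>+\<omega>. (\<integral>\<^sup>+x. F (fun_upd \<omega> n x) \<partial>K n \<omega>) \<partial>path_measure K N)"
proof -
  interpret Ionescu_Tulcea K "\<lambda>_. N" by fact
  have "(\<lambda>\<omega>. \<omega>) \<in> PiM {0..<Suc n} (\<lambda>_. N) \<rightarrow>\<^sub>M PiM UNIV (\<lambda>_. N)"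
  proof (rule measurable_PiM_single')
    fix i :: nat
    show "(\<lambda>\<omega>. \<omega> i) \<in> PiM {0..<Suc n} (\<lambda>_. N) \<rightarrow>\<^sub>M N"
    proof (cases "i \<in> {0..<Suc n}")
      \<comment> \<open>Coordinates outside the index set are constantly \<open>undefined\<close>,
        which lies in \<open>N\<close> because its space is the whole type.\<close>
      case False
      have "(\<lambda>\<omega>. \<omega> i) \<in> PiM {0..<Suc n} (\<lambda>_. N) \<rightarrow>\<^sub>M N \<longleftrightarrow> (\<lambda>\<omega>. undefined) \<in> PiM {0..<Suc n} (\<lambda>_. N) \<rightarrow>\<^sub>M N"
        using False by (intro measurable_cong) (auto simp: space_PiM PiE_def extensional_def)
      then show ?thesis using N by simp
    qed (rule measurable_component_singleton)
  qed (simp add: N)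
  from nn_integral_lim_step[OF measurable_compose[OF this F]]
  have "(\<integral>\<^sup>+\<omega>. F (restrict \<omega> {0..<Suc n}) \<partial>PF.lim) =
    (\<integral>\<^sup>+\<omega>. (\<integral>\<^sup>+x. F (fun_upd (restrict \<omega> {0..<n}) n x) \<partial>K n (restrict \<omega> {0..<n})) \<partial>PF.lim)" .
  moreover have "F (restrict \<omega> {0..<Suc n}) = F \<omega>" for \<omega>
    by (rule F_cong) auto
  moreover have "F (fun_upd (restrict \<omega> {0..<n}) n x) = F (fun_upd \<omega> n x)" for \<omega> x
    by (rule F_cong) auto
  moreover have "K n (restrict \<omega> {0..<n}) = K n \<omega>" for \<omega>
    by (rule K_cong) auto
  ultimately show ?thesis by (simp add: path_measure_def)
qed

subsection \<open>MDP paths and their cylinders\<close>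

lemma map_upt_length_eq_iff: "map \<omega> [0..<length h] = h \<longleftrightarrow> (\<forall>i<length h. \<omega> i = h ! i)"
  unfolding list_eq_iff_nth_eq by simp

lemma sets_cylinder:
  fixes h :: "'x::finite list"
  shows "{\<omega>. map \<omega> [0..<length h] = h} \<in> sets (PiM UNIV (\<lambda>_. count_space UNIV))"
proof -
  have "{\<omega> \<in> space (PiM UNIV (\<lambda>_. count_space UNIV)). \<forall>i\<in>{..<length h}. \<omega> i = h ! i}
      \<in> sets (PiM UNIV (\<lambda>_. count_space UNIV))"
    by measurable
  then show ?thesis
    unfolding map_upt_length_eq_iff by (simp add: space_PiM Ball_def)
qed

text \<open>Over a finite alphabet, a box that constrains finitely many coordinates below
  \<open>n\<close> is a finite disjoint union of cylinders of words of length \<open>n\<close>, and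
  such boxes determine a finite measure.\<close>

lemma measure_eqI_cylinder:
  fixes P Q :: "(nat \<Rightarrow> 'x::finite) measure"
  assumes P: "sets P = sets (PiM UNIV (\<lambda>_. count_space UNIV))"
    and Q: "sets Q = sets (PiM UNIV (\<lambda>_. count_space UNIV))"
    and "finite_measure P"
    and eq: "\<And>h. emeasure P {\<omega>. map \<omega> [0..<length h] = h} = emeasure Q {\<omega>. map \<omega> [0..<length h] = h}"
  shows "P = Q"
proof (rule measure_eqI_PiM_infinite[where I = UNIV and M = "\<lambda>_. count_space UNIV"])
  fix A :: "nat \<Rightarrow> 'x set" and J :: "nat set" assume "finite J"
  then obtain n where n: "J \<subseteq> {..<n}" using finite_nat_bounded by blast
  define H where "H = {h. set h \<subseteq> UNIV \<and> length h = n \<and> (\<forall>j\<in>J. h ! j \<in> A j)}"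
  have H: "finite H"
    by (rule finite_subset[OF _ finite_lists_length_eq[of "UNIV :: 'x set" n]]) (auto simp: H_def)
  have "prod_emb UNIV (\<lambda>_. count_space UNIV) J (Pi\<^sub>E J A) = (\<Union>h\<in>H. {\<omega>. map \<omega> [0..<length h] = h})"
  proof (intro set_eqI iffI)
    fix \<omega> assume "\<omega> \<in> prod_emb UNIV (\<lambda>_. count_space UNIV) J (Pi\<^sub>E J A)"
    then have "map \<omega> [0..<n] \<in> H"
      using n by (auto simp: prod_emb_def H_def subset_eq)
    then show "\<omega> \<in> (\<Union>h\<in>H. {\<omega>. map \<omega> [0..<length h] = h})"
      by (intro UN_I[of "map \<omega> [0..<n]"]) auto
  next
    fix \<omega> assume "\<omega> \<in> (\<Union>h\<in>H. {\<omega>. map \<omega> [0..<length h] = h})"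
    then have "map \<omega> [0..<n] \<in> H"
      by (auto simp: H_def)
    then show "\<omega> \<in> prod_emb UNIV (\<lambda>_. count_space UNIV) J (Pi\<^sub>E J A)"
      using n by (auto simp: prod_emb_def H_def subset_eq)
  qed
  moreover have "emeasure R (\<Union>h\<in>H. {\<omega>. map \<omega> [0..<length h] = h}) = (\<Sum>h\<in>H. emeasure R {\<omega>. map \<omega> [0..<length h] = h})"
    if "sets R = sets (PiM UNIV (\<lambda>_. count_space UNIV))" for R :: "(nat \<Rightarrow> 'x) measure"
    using H that sets_cylinder
    by (intro sum_emeasure[symmetric]) (auto simp: disjoint_family_on_def H_def)
  ultimately show "emeasure P (prod_emb UNIV (\<lambda>_. count_space UNIV) J (Pi\<^sub>E J A))
      = emeasure Q (prod_emb UNIV (\<lambda>_. count_space UNIV) J (Pi\<^sub>E J A))"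
    by (simp add: P Q eq)
qed (use assms in auto)

text \<open>Taking the history as a list, with the initial state following the empty list, covers
  both cases of the kernels and lets one definition serve for the automaton and for its
  digitization.\<close>

definition next_state :: "('s \<Rightarrow> 'a \<Rightarrow> 's \<Rightarrow> real) \<Rightarrow> 's \<Rightarrow> ('s \<times> 'a) list \<Rightarrow> 's pmf" where
  "next_state P s\<^sub>0 h = (if h = [] then return_pmf s\<^sub>0 else successor P (fst (last h)) (snd (last h)))"

lemma mdp_kernel_eq:
  "mdp_kernel D \<sigma> n \<omega> = measure_pmf (bind_pmf (next_state (mdp_prob D) (mdp_init D) (map \<omega> [0..<n]))
     (\<lambda>s. map_pmf (Pair s) (\<sigma> (map \<omega> [0..<n]) s)))"
  by (cases n) (auto simp: mdp_kernel_def next_state_def bind_return_pmf)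

lemma pmf_bind_map_Pair:
  "pmf (bind_pmf \<mu> (\<lambda>x. map_pmf (Pair x) (\<nu> x))) (x, y) = pmf \<mu> x * pmf (\<nu> x) y"
proof -
  have "pmf (map_pmf (Pair z) (\<nu> z)) (x, y) = indicator {x} z * pmf (\<nu> x) y" for z
    by (cases "z = x") (auto simp: pmf_map_inj' inj_on_def pmf_eq_0_set_pmf)
  then show ?thesis
    by (simp add: pmf_bind measure_pmf_single)
qed

text \<open>The recursion fixes all cylinder probabilities by induction on the word, starting from
  total mass 1. Through this criterion a measure is recognized as the path measure of an
  MDP.\<close>

lemma mdp_paths_eqI:
  fixes D :: "('s::finite, 'a::finite) mdp"
  assumes Q: "sets Q = sets (PiM UNIV (\<lambda>_. count_space UNIV))" "prob_space Q"
    and step: "\<And>h s \<alpha>. emeasure Q {\<omega>. map \<omega> [0..<length (h @ [(s, \<alpha>)])] = h @ [(s, \<alpha>)]} =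
      emeasure Q {\<omega>. map \<omega> [0..<length h] = h} *
        ennreal (pmf (next_state (mdp_prob D) (mdp_init D) h) s * pmf (\<sigma> h s) \<alpha>)"
  shows "Q = mdp_paths D \<sigma>"
proof (rule measure_eqI_cylinder[OF Q(1)])
  let ?K = "mdp_kernel D \<sigma>" and ?N = "count_space UNIV :: ('s \<times> 'a) measure"
  note IT = Ionescu_Tulcea_mdp_kernel[of D \<sigma>]
  interpret P: prob_space "mdp_paths D \<sigma>"
    unfolding mdp_paths_def by (rule prob_space_path_measure[OF IT])
  interpret Q: prob_space Q by fact
  show sets_P: "sets (mdp_paths D \<sigma>) = sets (PiM UNIV (\<lambda>_. ?N))"
    unfolding mdp_paths_def by (rule sets_path_measure[OF IT])
  show "finite_measure Q" by unfold_locales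
  fix h :: "('s \<times> 'a) list"
  show "emeasure Q {\<omega>. map \<omega> [0..<length h] = h} = emeasure (mdp_paths D \<sigma>) {\<omega>. map \<omega> [0..<length h] = h}"
  proof (induction h rule: rev_induct)
    case Nil
    have "UNIV = space Q" "UNIV = space (mdp_paths D \<sigma>)"
      using sets_eq_imp_space_eq[OF Q(1)] sets_eq_imp_space_eq[OF sets_P] by (simp_all add: space_PiM)
    then show ?case
      using P.emeasure_space_1 Q.emeasure_space_1 by simp
  next
    case (snoc x h)
    obtain s \<alpha> where x: "x = (s, \<alpha>)" by (cases x)
    let ?n = "length h"
    let ?A = "{\<omega>. map \<omega> [0..<length (h @ [x])] = h @ [x]}"
    let ?B = "{\<omega>. map \<omega> [0..<?n] = h}"
    have A: "?A \<in> sets (PiM UNIV (\<lambda>_. ?N))" and B: "?B \<in> sets (PiM UNIV (\<lambda>_. ?N))"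
      by (rule sets_cylinder)+
    have "emeasure (mdp_paths D \<sigma>) ?A = (\<integral>\<^sup>+\<omega>. indicator ?A \<omega> \<partial>mdp_paths D \<sigma>)"
      using A sets_P by simp
    also have "\<dots> = (\<integral>\<^sup>+\<omega>. (\<integral>\<^sup>+y. indicator ?A (fun_upd \<omega> ?n y) \<partial>?K ?n \<omega>) \<partial>mdp_paths D \<sigma>)"
      unfolding mdp_paths_def
    proof (rule nn_integral_path_measure_step[OF IT])
      show "indicator ?A \<in> borel_measurable (PiM UNIV (\<lambda>_. ?N))"
        using A by simp
      show "indicator ?A \<omega> = indicator ?A \<omega>'" if "\<And>i. i \<le> ?n \<Longrightarrow> \<omega> i = \<omega>' i" for \<omega> \<omega>' :: "nat \<Rightarrow> 's \<times> 'a"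
        using that unfolding indicator_def mem_Collect_eq map_upt_length_eq_iff by (simp add: less_Suc_eq_le)
      show "?K ?n \<omega> = ?K ?n \<omega>'" if "\<And>i. i < ?n \<Longrightarrow> \<omega> i = \<omega>' i" for \<omega> \<omega>' :: "nat \<Rightarrow> 's \<times> 'a"
        proof -
        have "map \<omega> [0..<?n] = map \<omega>' [0..<?n]" using that by (intro map_cong) auto
        then show ?thesis by (simp only: mdp_kernel_eq)
      qed
    qed simp
    also have "\<dots> = (\<integral>\<^sup>+\<omega>. indicator ?B \<omega> * ennreal (pmf (next_state (mdp_prob D) (mdp_init D) h) s * pmf (\<sigma> h s) \<alpha>) \<partial>mdp_paths D \<sigma>)"
    proof (rule nn_integral_cong)
      fix \<omega> :: "nat \<Rightarrow> 's \<times> 'a"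
      have "map (fun_upd \<omega> ?n y) [0..<?n] = map \<omega> [0..<?n]" for y
        by (rule map_cong) auto
      moreover have pmf: "(\<integral>\<^sup>+y. c * indicator {x} y \<partial>measure_pmf \<mu>) = c * emeasure (measure_pmf \<mu>) {x}" for c \<mu>
        by (simp add: nn_integral_cmult)
      ultimately have "indicator ?A (fun_upd \<omega> ?n y) = (indicator ?B \<omega> * indicator {x} y :: ennreal)" for y
        by (auto simp: indicator_def)
      then have "(\<integral>\<^sup>+y. indicator ?A (fun_upd \<omega> ?n y) \<partial>?K ?n \<omega>) = indicator ?B \<omega> * emeasure (?K ?n \<omega>) {x}"
        by (simp only: pmf mdp_kernel_eq)
      also have "\<dots> = indicator ?B \<omega> * ennreal (pmf (next_state (mdp_prob D) (mdp_init D) h) s * pmf (\<sigma> h s) \<alpha>)"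
        by (auto simp: indicator_def mdp_kernel_eq emeasure_pmf_single x pmf_bind_map_Pair)
      finally show "(\<integral>\<^sup>+y. indicator ?A (fun_upd \<omega> ?n y) \<partial>?K ?n \<omega>) =
        indicator ?B \<omega> * ennreal (pmf (next_state (mdp_prob D) (mdp_init D) h) s * pmf (\<sigma> h s) \<alpha>)" .
    qed
    also have "\<dots> = emeasure (mdp_paths D \<sigma>) ?B * ennreal (pmf (next_state (mdp_prob D) (mdp_init D) h) s * pmf (\<sigma> h s) \<alpha>)"
      using B sets_P by (simp add: nn_integral_multc)
    finally show ?case
      using step[of h s \<alpha>] snoc by (simp add: x)
  qed
qed

subsection \<open>Digitized paths\<close>

lemma digit_steps_Suc:
  "digit_steps M \<omega> (Suc n) = digit_steps M \<omega> n + (if fst (\<omega> n) \<in> markov_states M then 1 else 0)"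
proof -
  have "{i. i < Suc n \<and> fst (\<omega> i) \<in> markov_states M} =
    {i. i < n \<and> fst (\<omega> i) \<in> markov_states M} \<union> (if fst (\<omega> n) \<in> markov_states M then {n} else {})"
    by (auto simp: less_Suc_eq)
  then show ?thesis by (auto simp: digit_steps_def)
qed

locale digitized_markov_automaton = markov_automaton M
  for M :: "('s::finite, 'a::finite) markov_automaton" +
  fixes \<delta> :: real
  assumes delta_pos: "\<delta> > 0"
begin

section \<open>Blocks of copies and the entry behind each position\<close>

definition copies :: "('s, 'a) entry \<Rightarrow> nat" where
  "copies x = (if state_of x \<in> markov_states M then Suc (nat \<lfloor>time_of x / \<delta>\<rfloor>) else 1)"

definition start :: "(nat \<Rightarrow> ('s, 'a) entry) \<Rightarrow> nat \<Rightarrow> nat" where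
  "start \<omega> i = (\<Sum>k<i. copies (\<omega> k))"

text \<open>Inverse of \<open>start\<close>: the entry whose block contains position
  \<open>m\<close>. The least such \<open>i\<close> exists because every block is nonempty, so
  \<open>start\<close> is strictly increasing.\<close>

definition index :: "(nat \<Rightarrow> ('s, 'a) entry) \<Rightarrow> nat \<Rightarrow> nat" where
  "index \<omega> m = (LEAST i. m < start \<omega> (Suc i))"

definition digit :: "(nat \<Rightarrow> ('s, 'a) entry) \<Rightarrow> nat \<Rightarrow> 's \<times> 'a" where
  "digit \<omega> m = (state_of (\<omega> (index \<omega> m)), act_of (\<omega> (index \<omega> m)))"

text \<open>Digitization of a finite history all of whose entries are finished. A scheduler of the
  MDP is consulted on this word when it is simulated in the automaton.\<close>

definition expand :: "('s, 'a) entry list \<Rightarrow> ('s \<times> 'a) list" where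
  "expand h = concat (map (\<lambda>x. replicate (copies x) (state_of x, act_of x)) h)"

text \<open>The reading of the digital clock, in units of \<delta>, when entry \<open>i\<close>
  begins; the reachability estimates compare it with \<open>elapsed\<close>.\<close>

definition steps_before :: "(nat \<Rightarrow> ('s, 'a) entry) \<Rightarrow> nat \<Rightarrow> nat" where
  "steps_before \<omega> i = (\<Sum>k<i. if state_of (\<omega> k) \<in> markov_states M then copies (\<omega> k) else 0)"

lemma copies_pos [simp]: "0 < copies x"
  by (simp add: copies_def)

lemma start_0 [simp]: "start \<omega> 0 = 0"
  by (simp add: start_def)

lemma start_Suc: "start \<omega> (Suc i) = start \<omega> i + copies (\<omega> i)"
  by (simp add: start_def)

lemma strict_mono_start: "strict_mono (start \<omega>)"
  by (rule strict_monoI_Suc) (simp add: start_Suc)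

lemma start_mono: "i \<le> j \<Longrightarrow> start \<omega> i \<le> start \<omega> j"
  by (simp add: strict_mono_less_eq[OF strict_mono_start])

lemma le_start: "i \<le> start \<omega> i"
  by (rule strict_mono_imp_increasing[OF strict_mono_start])

lemma start_index: "start \<omega> (index \<omega> m) \<le> m" "m < start \<omega> (Suc (index \<omega> m))"
proof -
  have "m < start \<omega> (Suc m)" using le_start[of "Suc m" \<omega>] by simp
  then show "m < start \<omega> (Suc (index \<omega> m))"
    unfolding index_def by (rule LeastI)
  show "start \<omega> (index \<omega> m) \<le> m"
  proof (cases "index \<omega> m")
    case (Suc i)
    then have "\<not> m < start \<omega> (Suc i)"
      unfolding index_def by (intro not_less_Least) simp
    then show ?thesis by (simp add: Suc)
  qed simp
qed

lemma index_eq_iff: "index \<omega> m = i \<longleftrightarrow> start \<omega> i \<le> m \<and> m < start \<omega> (Suc i)"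
proof safe
  assume i: "start \<omega> i \<le> m" "m < start \<omega> (Suc i)"
  have "\<not> index \<omega> m < i"
    using start_mono[of "Suc (index \<omega> m)" i \<omega>] start_index(2)[of m \<omega>] i by linarith
  moreover have "\<not> i < index \<omega> m"
    using start_mono[of "Suc i" "index \<omega> m" \<omega>] start_index(1)[of \<omega> m] i by linarith
  ultimately show "index \<omega> m = i" by simp
qed (use start_index in auto)

lemma index_start: "j < copies (\<omega> i) \<Longrightarrow> index \<omega> (start \<omega> i + j) = i"
  by (simp add: index_eq_iff start_Suc)

lemma index_le: "index \<omega> m \<le> m"
  using start_index(1)[of \<omega> m] le_start[of "index \<omega> m" \<omega>] by linarith

lemma mono_index: "m \<le> m' \<Longrightarrow> index \<omega> m \<le> index \<omega> m'"
  using start_mono[of "Suc (index \<omega> m')" "index \<omega> m" \<omega>] start_index(1)[of \<omega> m] start_index(2)[of m' \<omega>]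
  by (rule_tac ccontr) linarith

lemma expand_append [simp]: "expand (xs @ ys) = expand xs @ expand ys"
  by (simp add: expand_def)

lemma expand_Nil [simp]: "expand [] = []"
  by (simp add: expand_def)

lemma expand_singleton [simp]: "expand [x] = replicate (copies x) (state_of x, act_of x)"
  by (simp add: expand_def)

lemma map_digit_block:
  assumes "start \<omega> i \<le> m" "m \<le> start \<omega> (Suc i)"
  shows "map (digit \<omega>) [start \<omega> i..<m] = replicate (m - start \<omega> i) (state_of (\<omega> i), act_of (\<omega> i))"
proof (rule replicate_eqI)
  fix y assume "y \<in> set (map (digit \<omega>) [start \<omega> i..<m])"
  then obtain l where l: "start \<omega> i \<le> l" "l < m" and y: "y = digit \<omega> l" by auto
  have "index \<omega> l = i" using l assms by (simp add: index_eq_iff)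
  then show "y = (state_of (\<omega> i), act_of (\<omega> i))" by (simp add: y digit_def)
qed simp

lemma map_digit_start: "map (digit \<omega>) [0..<start \<omega> i] = expand (map \<omega> [0..<i])"
proof (induction i)
  case (Suc i)
  have "map (digit \<omega>) [0..<start \<omega> (Suc i)]
      = map (digit \<omega>) [0..<start \<omega> i] @ map (digit \<omega>) [start \<omega> i..<start \<omega> (Suc i)]"
    by (subst upt_add_eq_append[of 0 "start \<omega> i" "copies (\<omega> i)", folded start_Suc]) auto
  also have "\<dots> = expand (map \<omega> [0..<Suc i])"
    using Suc map_digit_block[of \<omega> i "start \<omega> (Suc i)"] by (simp add: start_Suc)
  finally show ?case .
qed simp

lemma map_digit_prefix:
  assumes "start \<omega> i \<le> m" "m \<le> start \<omega> (Suc i)"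
  shows "map (digit \<omega>) [0..<m]
    = expand (map \<omega> [0..<i]) @ replicate (m - start \<omega> i) (state_of (\<omega> i), act_of (\<omega> i))"
proof -
  have "[0..<m] = [0..<start \<omega> i] @ [start \<omega> i..<m]"
    using upt_add_eq_append[of 0 "start \<omega> i" "m - start \<omega> i"] assms by simp
  then show ?thesis
    using map_digit_start map_digit_block[OF assms] by simp
qed

lemma length_expand: "length (expand (map \<omega> [0..<i])) = start \<omega> i"
  by (simp flip: map_digit_start)

section \<open>Digitization steps, reachability and reward, block by block\<close>

lemma steps_before_Suc:
  "steps_before \<omega> (Suc i) = steps_before \<omega> i + (if state_of (\<omega> i) \<in> markov_states M then copies (\<omega> i) else 0)"
  by (simp add: steps_before_def)

lemma steps_before_0 [simp]: "steps_before \<omega> 0 = 0"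
  by (simp add: steps_before_def)

lemma digit_steps_digit:
  assumes "j \<le> copies (\<omega> i)"
  shows "digit_steps M (digit \<omega>) (start \<omega> i + j)
    = steps_before \<omega> i + (if state_of (\<omega> i) \<in> markov_states M then j else 0)"
proof -
  have block: "digit_steps M (digit \<omega>) (start \<omega> i + j)
      = digit_steps M (digit \<omega>) (start \<omega> i) + (if state_of (\<omega> i) \<in> markov_states M then j else 0)"
    if "j \<le> copies (\<omega> i)" for i j
    using that by (induction j) (auto simp: digit_steps_Suc digit_def index_start)
  have "digit_steps M (digit \<omega>) (start \<omega> i) = steps_before \<omega> i"
  proof (induction i)
    case (Suc i)
    then show ?case using block[of "copies (\<omega> i)" i] by (simp add: start_Suc steps_before_Suc)
  qed (simp add: digit_steps_def)
  then show ?thesis using block[OF assms] by simp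
qed

text \<open>A position of the digitized path is an entry together with an offset in its block. A
  probabilistic block only has offset 0, so the step count is
  \<open>steps_before \<omega> n + j\<close> for both kinds of states.\<close>

lemma digit_reach_steps_iff:
  "digit \<omega> \<in> reach_steps M J G \<longleftrightarrow>
     (\<exists>n. state_of (\<omega> n) \<in> G \<and> (\<exists>j<copies (\<omega> n). steps_before \<omega> n + j \<in> J))"
proof
  assume "digit \<omega> \<in> reach_steps M J G"
  then obtain m where m: "fst (digit \<omega> m) \<in> G" "digit_steps M (digit \<omega>) m \<in> J"
    by (auto simp: reach_steps_def)
  define i j where "i = index \<omega> m" and "j = m - start \<omega> (index \<omega> m)"
  have mij: "m = start \<omega> i + j" "j < copies (\<omega> i)"
    using start_index(1)[of \<omega> m] start_index(2)[of m \<omega>] unfolding i_def j_def start_Suc by auto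
  have "digit_steps M (digit \<omega>) m = steps_before \<omega> i + j"
    using digit_steps_digit[of j \<omega> i] mij by (auto simp: copies_def split: if_splits)
  moreover have "state_of (\<omega> i) \<in> G" using m(1) by (simp add: digit_def i_def)
  ultimately show "\<exists>n. state_of (\<omega> n) \<in> G \<and> (\<exists>j<copies (\<omega> n). steps_before \<omega> n + j \<in> J)"
    using m(2) mij(2) by auto
next
  assume "\<exists>n. state_of (\<omega> n) \<in> G \<and> (\<exists>j<copies (\<omega> n). steps_before \<omega> n + j \<in> J)"
  then obtain n j where nj: "state_of (\<omega> n) \<in> G" "j < copies (\<omega> n)" "steps_before \<omega> n + j \<in> J" by auto
  have "digit_steps M (digit \<omega>) (start \<omega> n + j) = steps_before \<omega> n + j"
    using digit_steps_digit[of j \<omega> n] nj by (auto simp: copies_def split: if_splits)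
  moreover have "fst (digit \<omega> (start \<omega> n + j)) \<in> G"
    using nj by (simp add: digit_def index_start)
  ultimately show "digit \<omega> \<in> reach_steps M J G"
    using nj(3) by (auto simp: reach_steps_def)
qed

text \<open>Grouping the series by blocks: its partial sums at the boundaries \<open>start\<close>
  are the partial sums of the right side, and a subsequence of a convergent sequence has the same
  limit.\<close>

lemma mdp_reward_digit:
  "mdp_reward \<rho> G (digit \<omega>) =
     (\<Sum>i. if \<forall>k\<le>i. state_of (\<omega> k) \<notin> G
          then of_nat (copies (\<omega> i)) * ennreal (\<rho> (state_of (\<omega> i)) (act_of (\<omega> i))) else 0)"
    (is "_ = (\<Sum>i. ?g i)")
proof -
  define f where "f m = (if \<forall>k\<le>m. fst (digit \<omega> k) \<notin> G
    then ennreal (\<rho> (fst (digit \<omega> m)) (snd (digit \<omega> m))) else 0)" for m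
  \<comment> \<open>All copies in a block show the same state, so the condition of not having met
    \<open>G\<close> is constant on the block.\<close>
  have avoid: "(\<forall>k\<le>start \<omega> i + j. fst (digit \<omega> k) \<notin> G) \<longleftrightarrow> (\<forall>k\<le>i. state_of (\<omega> k) \<notin> G)"
    if "j < copies (\<omega> i)" for i j
  proof safe
    fix k assume *: "\<forall>k\<le>start \<omega> i + j. fst (digit \<omega> k) \<notin> G" and k: "k \<le> i" "state_of (\<omega> k) \<in> G"
    have "fst (digit \<omega> (start \<omega> k)) = state_of (\<omega> k)"
      using index_start[of 0 \<omega> k] by (simp add: digit_def)
    moreover have "start \<omega> k \<le> start \<omega> i + j" using start_mono[OF k(1)] by (rule trans_le_add1)
    ultimately show False using * k(2) by metis
  next
    fix k assume *: "\<forall>k\<le>i. state_of (\<omega> k) \<notin> G" and k: "k \<le> start \<omega> i + j" "fst (digit \<omega> k) \<in> G"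
    have "index \<omega> k \<le> i"
      using mono_index[OF k(1), of \<omega>] index_start[of j \<omega> i, OF that] by simp
    then show False using * k(2) by (simp add: digit_def)
  qed
  have block: "f (start \<omega> i + j) = (if \<forall>k\<le>i. state_of (\<omega> k) \<notin> G
      then ennreal (\<rho> (state_of (\<omega> i)) (act_of (\<omega> i))) else 0)"
    if "j < copies (\<omega> i)" for i j
    unfolding f_def avoid[OF that] by (auto simp: digit_def index_start[of j \<omega> i, OF that])
  have split: "(\<Sum>m<a + b. f m) = (\<Sum>m<a. f m) + (\<Sum>j<b. f (a + j))" for a b
    by (induction b) (simp_all add: add.assoc)
  have "(\<Sum>m<start \<omega> n. f m) = (\<Sum>i<n. ?g i)" for n
  proof (induction n)
    case (Suc n)
    have "(\<Sum>m<start \<omega> (Suc n). f m) = (\<Sum>m<start \<omega> n. f m) + (\<Sum>j<copies (\<omega> n). f (start \<omega> n + j))"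
      unfolding start_Suc by (rule split)
    also have "(\<Sum>j<copies (\<omega> n). f (start \<omega> n + j)) = ?g n"
      by (auto simp: block)
    finally show ?case using Suc by simp
  qed simp
  then have "(\<lambda>n. \<Sum>m<start \<omega> n. f m) \<longlonglongrightarrow> (\<Sum>i. ?g i)"
    by (simp add: summable_LIMSEQ)
  moreover have "(\<lambda>n. \<Sum>m<start \<omega> n. f m) \<longlonglongrightarrow> suminf f"
    using LIMSEQ_subseq_LIMSEQ[OF summable_LIMSEQ[of f] strict_mono_start] by (simp add: o_def)
  ultimately have "suminf f = (\<Sum>i. ?g i)"
    by (rule LIMSEQ_unique[symmetric])
  then show ?thesis by (simp add: mdp_reward_def f_def[abs_def])
qed

end

subsection \<open>Sojourn times\<close>

context markov_automaton
begin

text \<open>The closed ray serves to count copies, the open one to measure survival beyond a time;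
  they agree because the exponential law has no atoms.\<close>

lemma emeasure_sojourn_atLeast:
  assumes s: "s \<in> markov_states M" and "0 \<le> x"
  shows "emeasure (sojourn M s) {x..} = ennreal (exp (- exit_rate M s * x))"
    and "emeasure (sojourn M s) {x<..} = ennreal (exp (- exit_rate M s * x))"
proof -
  interpret prob_space "sojourn M s" by (rule prob_space_sojourn)
  have E: "0 < exit_rate M s" by (rule exit_rate_pos[OF s])
  have *: "sojourn M s = density lborel (exponential_density (exit_rate M s))"
    using s by (simp add: sojourn_def)
  have space: "space (sojourn M s) = UNIV" by (simp add: *)
  have "emeasure (sojourn M s) {..x} = ennreal (1 - exp (- x * exit_rate M s))"
    unfolding * using emeasure_erlang_density[OF E, of 0 x] by (simp add: erlang_CDF_0 \<open>0 \<le> x\<close> mult.commute)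
  moreover have "exp (- x * exit_rate M s) \<le> 1" using E \<open>0 \<le> x\<close> by simp
  ultimately have "prob {..x} = 1 - exp (- x * exit_rate M s)"
    by (simp add: measure_def)
  moreover have "{x<..} = space (sojourn M s) - {..x}" by (auto simp: space)
  ultimately have "prob {x<..} = exp (- exit_rate M s * x)"
    by (simp add: prob_compl mult.commute)
  then show gt: "emeasure (sojourn M s) {x<..} = ennreal (exp (- exit_rate M s * x))"
    by (simp add: emeasure_eq_measure)
  have "emeasure (sojourn M s) {x} = 0"
    unfolding * by (simp add: emeasure_density nn_integral_0_iff_AE AE_lborel_singleton)
  then have "emeasure (sojourn M s) ({x<..} \<union> {x}) = emeasure (sojourn M s) {x<..}"
    by (intro emeasure_Un_null_set) (auto simp: null_sets_def)
  moreover have "{x<..} \<union> {x} = {x..}" by auto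
  ultimately show "emeasure (sojourn M s) {x..} = ennreal (exp (- exit_rate M s * x))"
    using gt by simp
qed

lemma AE_sojourn: "AE t in sojourn M s. 0 \<le> t \<and> (s \<notin> markov_states M \<longrightarrow> t = 0)"
proof (cases "s \<in> markov_states M")
  case True
  then show ?thesis
    unfolding sojourn_def if_P[OF True] by (subst AE_density) (auto simp: exponential_density_def)
next
  case False
  then show ?thesis
    unfolding sojourn_def if_not_P[OF False] by (subst AE_return) auto
qed

lemma nn_integral_sojourn_time:
  "(\<integral>\<^sup>+t. ennreal t \<partial>sojourn M s) = ennreal (if s \<in> markov_states M then 1 / exit_rate M s else 0)"
proof (cases "s \<in> markov_states M")
  case True
  have E: "0 < exit_rate M s" by (rule exit_rate_pos[OF True])
  have "(\<integral>\<^sup>+t. ennreal t \<partial>sojourn M s) = (\<integral>\<^sup>+t. ennreal (exponential_density (exit_rate M s) t) * ennreal t \<partial>lborel)"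
    using True by (simp add: sojourn_def nn_integral_density)
  also have "\<dots> = (\<integral>\<^sup>+t. ennreal (exponential_density (exit_rate M s) t * t ^ 1) \<partial>lborel)"
    using E by (intro nn_integral_cong) (auto simp: exponential_density_def ennreal_mult')
  also have "\<dots> = ennreal (1 / exit_rate M s)"
    using nn_integral_erlang_ith_moment[OF E, of 0 1] by simp
  finally show ?thesis using True by simp
next
  case False
  then show ?thesis by (simp add: sojourn_def nn_integral_return)
qed

end

context digitized_markov_automaton
begin

text \<open>The probability that an entry in state \<open>s\<close> has more than \<open>j\<close>
  copies. A Markovian sojourn has a copy at offset \<open>j\<close> iff it lasts at least
  \<open>j\<close> full periods; a probabilistic entry only has the one at offset 0.\<close>

definition survival :: "'s \<Rightarrow> nat \<Rightarrow> real" where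
  "survival s j = (if s \<in> markov_states M then exp (- exit_rate M s * (real j * \<delta>)) else if j = 0 then 1 else 0)"

lemma measurable_copies_sojourn: "(\<lambda>t. copies (s, \<alpha>, t)) \<in> sojourn M s \<rightarrow>\<^sub>M count_space UNIV"
  unfolding copies_def fst_conv snd_conv by measurable

lemma sets_copies_sojourn: "{t. copies (s, \<alpha>, t) \<in> C} \<in> sets (sojourn M s)"
  using measurable_sets[OF measurable_copies_sojourn, of C s \<alpha>] sets_eq_imp_space_eq[OF sets_sojourn, of M s]
  by (simp add: vimage_def)

lemma less_copies_iff:
  assumes "0 \<le> t"
  shows "j < copies (s, \<alpha>, t) \<longleftrightarrow> (if s \<in> markov_states M then real j * \<delta> \<le> t else j = 0)"
proof -
  have "j < Suc (nat \<lfloor>t / \<delta>\<rfloor>) \<longleftrightarrow> real j \<le> t / \<delta>"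
    using assms delta_pos by (simp add: less_Suc_eq_le le_nat_iff le_floor_iff)
  also have "\<dots> \<longleftrightarrow> real j * \<delta> \<le> t" using delta_pos by (simp add: field_simps)
  finally show ?thesis by (auto simp: copies_def)
qed

lemma emeasure_sojourn_less_copies:
  "emeasure (sojourn M s) {t. j < copies (s, \<alpha>, t)} = ennreal (survival s j)"
proof (cases "s \<in> markov_states M")
  case True
  have "emeasure (sojourn M s) {t. j < copies (s, \<alpha>, t)} = emeasure (sojourn M s) {real j * \<delta>..}"
  proof (rule emeasure_eq_AE)
    show "AE t in sojourn M s. t \<in> {t. j < copies (s, \<alpha>, t)} \<longleftrightarrow> t \<in> {real j * \<delta>..}"
      using AE_sojourn[of s] by eventually_elim (simp add: less_copies_iff True)
    show "{t. j < copies (s, \<alpha>, t)} \<in> sets (sojourn M s)"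
      using sets_copies_sojourn[of s \<alpha> "{j<..}"] by simp
  qed simp
  also have "\<dots> = ennreal (survival s j)"
    using True delta_pos by (simp add: emeasure_sojourn_atLeast survival_def)
  finally show ?thesis .
next
  case False
  then show ?thesis
    by (cases "j = 0") (auto simp: survival_def copies_def sojourn_def)
qed

lemma survival_nonneg: "0 \<le> survival s j"
  by (simp add: survival_def)

lemma survival_Suc_le: "survival s (Suc j) \<le> survival s j"
  using delta_pos exit_rate_pos[of s] by (auto simp: survival_def distrib_right mult_left_mono)

lemma emeasure_sojourn_copies_eq:
  "emeasure (sojourn M s) {t. copies (s, \<alpha>, t) = Suc j} = ennreal (survival s j - survival s (Suc j))"
proof -
  interpret prob_space "sojourn M s" by (rule prob_space_sojourn)
  have "{t. copies (s, \<alpha>, t) = Suc j} = {t. j < copies (s, \<alpha>, t)} - {t. Suc j < copies (s, \<alpha>, t)}"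
    by auto
  moreover have "{t. j < copies (s, \<alpha>, t)} \<in> sets (sojourn M s)" for j
    using sets_copies_sojourn[of s \<alpha> "{j<..}"] by simp
  moreover have "{t. Suc j < copies (s, \<alpha>, t)} \<subseteq> {t. j < copies (s, \<alpha>, t)}"
    by auto
  ultimately have "emeasure (sojourn M s) {t. copies (s, \<alpha>, t) = Suc j}
      = emeasure (sojourn M s) {t. j < copies (s, \<alpha>, t)} - emeasure (sojourn M s) {t. Suc j < copies (s, \<alpha>, t)}"
    by (simp only: emeasure_Diff emeasure_finite not_False_eq_True simp_thms infinity_ennreal_def)
  then show ?thesis
    by (simp add: emeasure_sojourn_less_copies ennreal_minus survival_nonneg)
qed

text \<open>Memorylessness on the grid: from offset \<open>j\<close> the block either continues,
  which keeps the state \<open>s\<close>, or ends and a fresh successor is drawn. Both ways of being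
  in \<open>s\<close> next are added up, which is how \<open>digit_prob\<close> merges survival and
  self-loop.\<close>

lemma digit_prob_survival:
  assumes "\<alpha> \<in> enabled (trans_prob M) s"
  shows "survival s (Suc j) * (if s' = s then 1 else 0) + (survival s j - survival s (Suc j)) * trans_prob M s \<alpha> s'
    = survival s j * digit_prob M \<delta> s \<alpha> s'"
proof (cases "s \<in> markov_states M")
  case True
  then have "\<alpha> = markov_act M" using assms enabled_markov by auto
  moreover have "survival s (Suc j) = survival s j * exp (- exit_rate M s * \<delta>)"
    using True by (simp add: survival_def distrib_right distrib_left flip: exp_add)
  ultimately show ?thesis
    using True by (simp add: digit_prob_def algebra_simps)
next
  case False
  then show ?thesis by (simp add: survival_def digit_prob_def)
qed

text \<open>The tail-sum formula for integer variables turns the mean into the geometric series of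
  the survival probabilities.\<close>

lemma nn_integral_sojourn_copies:
  assumes "s \<in> markov_states M"
  shows "(\<integral>\<^sup>+t. of_nat (copies (s, \<alpha>, t)) \<partial>sojourn M s) = ennreal (1 / (1 - exp (- exit_rate M s * \<delta>)))"
proof -
  let ?q = "exp (- exit_rate M s * \<delta>)"
  have q: "0 \<le> ?q" "?q < 1" using exit_rate_pos[OF assms] delta_pos by auto
  from measurable_copies_sojourn[of s \<alpha>]
  have "(\<integral>\<^sup>+t. of_nat (copies (s, \<alpha>, t)) \<partial>sojourn M s) = (\<Sum>j. emeasure (sojourn M s) {t \<in> space (sojourn M s). j < copies (s, \<alpha>, t)})"
    by (rule nn_integral_nat_function)
  also have "\<dots> = (\<Sum>j. ennreal (?q ^ j))"
  proof -
    have "space (sojourn M s) = UNIV" using sets_eq_imp_space_eq[OF sets_sojourn] by simp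
    moreover have "survival s j = ?q ^ j" for j
      unfolding survival_def if_P[OF assms] exp_of_nat_mult[symmetric] by (rule arg_cong[where f = exp]) simp
    ultimately show ?thesis
      by (simp only: emeasure_sojourn_less_copies UNIV_I simp_thms)
  qed
  also have "\<dots> = ennreal (\<Sum>j. ?q ^ j)"
    using q by (intro suminf_ennreal2) (auto intro!: summable_geometric)
  also have "(\<Sum>j. ?q ^ j) = 1 / (1 - ?q)"
    using q by (intro suminf_geometric) auto
  finally show ?thesis .
qed

end

subsection \<open>Integration over paths of a Markov automaton\<close>

abbreviation path_space :: "(nat \<Rightarrow> ('s, 'a) entry) measure" where
  "path_space \<equiv> PiM UNIV (\<lambda>_. entry_space)"

lemma space_entry_space [simp]: "space entry_space = UNIV"
  by (simp add: entry_space_def space_pair_measure)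

lemma space_path_space [simp]: "space path_space = UNIV"
  by (simp add: space_PiM)

lemma measurable_entry [measurable]:
  shows "state_of \<in> entry_space \<rightarrow>\<^sub>M count_space UNIV"
    and "(\<lambda>x. act_of x) \<in> entry_space \<rightarrow>\<^sub>M count_space UNIV"
    and "(\<lambda>x. time_of x) \<in> borel_measurable entry_space"
  unfolding entry_space_def by measurable

lemma measurable_path_component [measurable]: "(\<lambda>\<omega>. \<omega> n) \<in> path_space \<rightarrow>\<^sub>M entry_space"
  by (rule measurable_component_singleton) simp

lemma measurable_nat_fun2:
  fixes f g :: "'x \<Rightarrow> nat"
  assumes f: "f \<in> N \<rightarrow>\<^sub>M count_space UNIV" and g: "g \<in> N \<rightarrow>\<^sub>M count_space UNIV"
  shows "(\<lambda>x. h (f x) (g x)) \<in> N \<rightarrow>\<^sub>M count_space UNIV"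
  by (rule measurable_compose_countable[OF measurable_compose[OF g] f]) simp

context digitized_markov_automaton
begin

section \<open>Measurability of the digitization map\<close>

lemma measurable_copies [measurable]: "copies \<in> entry_space \<rightarrow>\<^sub>M count_space UNIV"
  unfolding copies_def[abs_def] by measurable

lemma measurable_start [measurable]: "(\<lambda>\<omega>. start \<omega> i) \<in> path_space \<rightarrow>\<^sub>M count_space UNIV"
proof (induction i)
  case (Suc i)
  have "(\<lambda>\<omega>. copies (\<omega> i)) \<in> path_space \<rightarrow>\<^sub>M count_space UNIV" by measurable
  from measurable_nat_fun2[OF Suc this, of "(+)"] show ?case by (simp add: start_Suc)
qed simp

lemma measurable_steps_before [measurable]: "(\<lambda>\<omega>. steps_before \<omega> i) \<in> path_space \<rightarrow>\<^sub>M count_space UNIV"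
proof (induction i)
  case (Suc i)
  have "(\<lambda>\<omega>. if state_of (\<omega> i) \<in> markov_states M then copies (\<omega> i) else 0) \<in> path_space \<rightarrow>\<^sub>M count_space UNIV" by measurable
  from measurable_nat_fun2[OF Suc this, of "(+)"] show ?case by (simp add: steps_before_Suc)
qed simp

lemma measurable_index [measurable]: "(\<lambda>\<omega>. index \<omega> m) \<in> path_space \<rightarrow>\<^sub>M count_space UNIV"
proof -
  have "{\<omega> \<in> space path_space. start \<omega> i \<le> m \<and> m < start \<omega> (Suc i)} \<in> sets path_space" for i
    by measurable
  then show ?thesis
    by (simp add: measurable_count_space_eq2_countable vimage_def index_eq_iff)
qed

lemma measurable_state_act: "(\<lambda>x. (state_of x, act_of x)) \<in> entry_space \<rightarrow>\<^sub>M count_space (UNIV :: ('s \<times> 'a) set)"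
  using measurable_Pair[OF measurable_entry(1,2)] by (simp add: pair_measure_countable)

lemma measurable_digit_component [measurable]: "(\<lambda>\<omega>. digit \<omega> m) \<in> path_space \<rightarrow>\<^sub>M count_space UNIV"
  unfolding digit_def
  by (rule measurable_compose_countable[where f = "\<lambda>i \<omega>. (state_of (\<omega> i), act_of (\<omega> i))"])
    (use measurable_compose[OF measurable_path_component measurable_state_act] in measurable)

lemma measurable_digit: "digit \<in> path_space \<rightarrow>\<^sub>M PiM UNIV (\<lambda>_. count_space UNIV)"
  by (rule measurable_PiM_single') auto

text \<open>Words form a countable type, so the expansion is built by case distinction on its
  values. The index set \<open>I\<close> is general because the word is read off full paths and, for
  the measurability of schedulers, off finite histories.\<close>

lemma measurable_expand:
  assumes "{0..<n} \<subseteq> I"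
  shows "(\<lambda>\<omega>. expand (map \<omega> [0..<n])) \<in> PiM I (\<lambda>_. entry_space) \<rightarrow>\<^sub>M count_space UNIV"
proof -
  have "(\<lambda>\<omega>. expand (map \<omega> [0..<k])) \<in> PiM I (\<lambda>_. entry_space) \<rightarrow>\<^sub>M count_space UNIV" if "k \<le> n" for k
    using that
  proof (induction k)
    case (Suc k)
    have k: "(\<lambda>\<omega>. \<omega> k) \<in> PiM I (\<lambda>_. entry_space :: ('s, 'a) entry measure) \<rightarrow>\<^sub>M entry_space"
      using Suc.prems assms by (intro measurable_component_singleton) auto
    have last: "(\<lambda>\<omega>. replicate (copies (\<omega> k)) (state_of (\<omega> k), act_of (\<omega> k)))
        \<in> PiM I (\<lambda>_. entry_space) \<rightarrow>\<^sub>M count_space UNIV"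
    proof (rule measurable_compose_countable[where f = "\<lambda>c \<omega>. replicate c (state_of (\<omega> k), act_of (\<omega> k))"])
      show "(\<lambda>\<omega> :: nat \<Rightarrow> ('s, 'a) entry. replicate c (state_of (\<omega> k), act_of (\<omega> k))) \<in> PiM I (\<lambda>_. entry_space) \<rightarrow>\<^sub>M count_space UNIV" for c
        by (rule measurable_compose[where g = "replicate c", OF measurable_compose[OF k measurable_state_act]]) simp
    qed (rule measurable_compose[OF k measurable_copies])
    have "(\<lambda>\<omega>. expand (map \<omega> [0..<k]) @ replicate (copies (\<omega> k)) (state_of (\<omega> k), act_of (\<omega> k)))
        \<in> PiM I (\<lambda>_. entry_space) \<rightarrow>\<^sub>M count_space UNIV"
    proof (rule measurable_compose_countable[where f = "\<lambda>xs \<omega>. xs @ replicate (copies (\<omega> k)) (state_of (\<omega> k), act_of (\<omega> k))"])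
      show "(\<lambda>\<omega> :: nat \<Rightarrow> ('s, 'a) entry. xs @ replicate (copies (\<omega> k)) (state_of (\<omega> k), act_of (\<omega> k))) \<in> PiM I (\<lambda>_. entry_space) \<rightarrow>\<^sub>M count_space UNIV" for xs
        by (rule measurable_compose[where g = "append xs", OF last]) simp
    qed (use Suc in simp)
    then show ?case by simp
  qed simp
  then show ?thesis by simp
qed

end

section \<open>Conditional laws of the next state, action and sojourn time\<close>

locale scheduled_markov_automaton = digitized_markov_automaton M \<delta>
  for M :: "('s::finite, 'a::finite) markov_automaton" and \<delta> +
  fixes \<sigma> :: "('s, 'a) ma_scheduler"
  assumes generic: "generic_scheduler M \<sigma>"
begin

abbreviation "paths \<equiv> ma_paths M \<sigma>"

abbreviation next_ma :: "nat \<Rightarrow> (nat \<Rightarrow> ('s, 'a) entry) \<Rightarrow> 's pmf" where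
  "next_ma n \<omega> \<equiv> next_state (trans_prob M) (init_state M) (map (\<lambda>i. (state_of (\<omega> i), act_of (\<omega> i))) [0..<n])"

lemma sets_paths [measurable_cong, simp]: "sets paths = sets path_space"
  unfolding ma_paths_def by (rule sets_path_measure[OF Ionescu_Tulcea_ma_kernel[OF generic]])

lemma space_paths [simp]: "space paths = UNIV"
  using sets_eq_imp_space_eq[OF sets_paths] by simp

sublocale paths: prob_space paths
  unfolding ma_paths_def by (rule prob_space_path_measure[OF Ionescu_Tulcea_ma_kernel[OF generic]])

lemma set_pmf_scheduler: "set_pmf (\<sigma> h s) \<subseteq> enabled (trans_prob M) s"
  using generic by (simp add: generic_scheduler_def)

lemma nn_integral_entry_dist:
  assumes f: "f \<in> borel_measurable entry_space"
  shows "(\<integral>\<^sup>+x. f x \<partial>entry_dist M \<sigma> h s) = (\<integral>\<^sup>+\<alpha>. (\<integral>\<^sup>+t. f (s, \<alpha>, t) \<partial>sojourn M s) \<partial>measure_pmf (\<sigma> h s))"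
proof -
  interpret so: prob_space "sojourn M s" by (rule prob_space_sojourn)
  interpret q: prob_space "measure_pmf (\<sigma> h s) \<Otimes>\<^sub>M sojourn M s"
    by (intro prob_space_pair so.prob_space_axioms prob_space_measure_pmf)
  have f': "f \<in> borel_measurable (return (count_space UNIV) s \<Otimes>\<^sub>M (measure_pmf (\<sigma> h s) \<Otimes>\<^sub>M sojourn M s))"
    unfolding entry_dist_def[symmetric] measurable_cong_sets[OF sets_entry_dist refl] by (rule f)
  have fs: "(\<lambda>y. f (s, y)) \<in> borel_measurable (measure_pmf (\<sigma> h s) \<Otimes>\<^sub>M sojourn M s)"
    using measurable_Pair2[OF f', of s] by simp
  have "(\<integral>\<^sup>+x. f x \<partial>entry_dist M \<sigma> h s)
      = (\<integral>\<^sup>+x. (\<integral>\<^sup>+y. f (x, y) \<partial>(measure_pmf (\<sigma> h s) \<Otimes>\<^sub>M sojourn M s)) \<partial>return (count_space UNIV) s)"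
    unfolding entry_dist_def by (rule q.nn_integral_fst[symmetric, OF f'])
  also have "\<dots> = (\<integral>\<^sup>+y. f (s, y) \<partial>(measure_pmf (\<sigma> h s) \<Otimes>\<^sub>M sojourn M s))"
    by (rule nn_integral_return) auto
  also have "\<dots> = (\<integral>\<^sup>+\<alpha>. (\<integral>\<^sup>+t. f (s, \<alpha>, t) \<partial>sojourn M s) \<partial>measure_pmf (\<sigma> h s))"
    by (rule so.nn_integral_fst[symmetric, OF fs])
  finally show ?thesis .
qed

lemma measurable_fun_upd_path: "(\<lambda>x. fun_upd \<omega> n x) \<in> entry_space \<rightarrow>\<^sub>M path_space"
  by (rule measurable_PiM_single') (auto simp: fun_upd_def)

text \<open>Entry \<open>n\<close> is drawn in the order state, action, sojourn time, and the last
  draw depends on the state only. An integrand that ignores later entries is integrated one draw at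
  a time.\<close>

lemma nn_integral_paths_step:
  assumes F: "F \<in> borel_measurable path_space"
    and F_cong: "\<And>\<omega> \<omega>'. (\<And>i. i \<le> n \<Longrightarrow> \<omega> i = \<omega>' i) \<Longrightarrow> F \<omega> = F \<omega>'"
  shows "(\<integral>\<^sup>+\<omega>. F \<omega> \<partial>paths) =
    (\<integral>\<^sup>+\<omega>. (\<integral>\<^sup>+s. (\<integral>\<^sup>+\<alpha>. (\<integral>\<^sup>+t. F (fun_upd \<omega> n (s, \<alpha>, t)) \<partial>sojourn M s)
       \<partial>measure_pmf (\<sigma> (map \<omega> [0..<n]) s)) \<partial>measure_pmf (next_ma n \<omega>)) \<partial>paths)"
proof -
  have K: "(\<integral>\<^sup>+x. f x \<partial>ma_kernel M \<sigma> n \<omega>) =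
    (\<integral>\<^sup>+s. (\<integral>\<^sup>+\<alpha>. (\<integral>\<^sup>+t. f (s, \<alpha>, t) \<partial>sojourn M s)
       \<partial>measure_pmf (\<sigma> (map \<omega> [0..<n]) s)) \<partial>measure_pmf (next_ma n \<omega>))"
    if f: "f \<in> borel_measurable entry_space" for f \<omega>
  proof (cases n)
    case 0
    then show ?thesis
      by (simp add: ma_kernel_def next_state_def nn_integral_entry_dist[OF f])
  next
    case (Suc k)
    have "entry_dist M \<sigma> h s \<in> space (subprob_algebra entry_space)" for h s
      by (auto simp: space_subprob_algebra intro!: prob_space_imp_subprob_space prob_space_entry_dist)
    then have "(\<integral>\<^sup>+x. f x \<partial>(measure_pmf (next_ma n \<omega>) \<bind> entry_dist M \<sigma> (map \<omega> [0..<n]))) =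
      (\<integral>\<^sup>+s. (\<integral>\<^sup>+x. f x \<partial>entry_dist M \<sigma> (map \<omega> [0..<n]) s) \<partial>measure_pmf (next_ma n \<omega>))"
      by (intro nn_integral_bind[OF f]) simp
    moreover have "ma_kernel M \<sigma> n \<omega> = measure_pmf (next_ma n \<omega>) \<bind> entry_dist M \<sigma> (map \<omega> [0..<n])"
      using Suc by (simp add: ma_kernel_def next_state_def)
    ultimately show ?thesis
      by (simp only: nn_integral_entry_dist[OF f])
  qed
  have "(\<integral>\<^sup>+\<omega>. F \<omega> \<partial>paths) = (\<integral>\<^sup>+\<omega>. (\<integral>\<^sup>+x. F (fun_upd \<omega> n x) \<partial>ma_kernel M \<sigma> n \<omega>) \<partial>paths)"
    unfolding ma_paths_def
  proof (rule nn_integral_path_measure_step[OF Ionescu_Tulcea_ma_kernel[OF generic] _ F F_cong])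
    fix \<omega> \<omega>' :: "nat \<Rightarrow> ('s, 'a) entry" assume *: "\<And>i. i < n \<Longrightarrow> \<omega> i = \<omega>' i"
    then have "map \<omega> [0..<n] = map \<omega>' [0..<n]" by (intro map_cong) auto
    then show "ma_kernel M \<sigma> n \<omega> = ma_kernel M \<sigma> n \<omega>'"
      using * by (cases n) (simp_all only: ma_kernel_def nat.case lessI)
  qed auto
  also have "\<dots> = (\<integral>\<^sup>+\<omega>. (\<integral>\<^sup>+s. (\<integral>\<^sup>+\<alpha>. (\<integral>\<^sup>+t. F (fun_upd \<omega> n (s, \<alpha>, t)) \<partial>sojourn M s)
       \<partial>measure_pmf (\<sigma> (map \<omega> [0..<n]) s)) \<partial>measure_pmf (next_ma n \<omega>)) \<partial>paths)"
    by (intro nn_integral_cong K measurable_compose[OF measurable_fun_upd_path F])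
  finally show ?thesis .
qed

lemma emeasure_sojourn_space [simp]: "emeasure (sojourn M s) (space (sojourn M s)) = 1"
  by (rule prob_space.emeasure_space_1[OF prob_space_sojourn])

text \<open>The conditional law of the state of entry \<open>n\<close> given the past, tested
  against functions \<open>F\<close> of the past; the draws of action and sojourn time have total
  mass 1.\<close>

lemma nn_integral_state:
  assumes F: "F \<in> borel_measurable path_space"
    and F_cong: "\<And>\<omega> \<omega>'. (\<And>i. i < n \<Longrightarrow> \<omega> i = \<omega>' i) \<Longrightarrow> F \<omega> = F \<omega>'"
  shows "(\<integral>\<^sup>+\<omega>. F \<omega> * indicator {s} (state_of (\<omega> n)) \<partial>paths)
    = (\<integral>\<^sup>+\<omega>. F \<omega> * ennreal (pmf (next_ma n \<omega>) s) \<partial>paths)"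
proof (subst nn_integral_paths_step[where n = n])
  show "(\<lambda>\<omega>. F \<omega> * indicator {s} (state_of (\<omega> n))) \<in> borel_measurable path_space"
    using F by measurable
  show "F \<omega> * indicator {s} (state_of (\<omega> n)) = F \<omega>' * indicator {s} (state_of (\<omega>' n))"
    if "\<And>i. i \<le> n \<Longrightarrow> \<omega> i = \<omega>' i" for \<omega> \<omega>'
    using F_cong[of \<omega> \<omega>'] that by auto
  have "F (fun_upd \<omega> n x) = F \<omega>" for \<omega> x by (rule F_cong) auto
  then show "(\<integral>\<^sup>+\<omega>. (\<integral>\<^sup>+s'. (\<integral>\<^sup>+\<alpha>. (\<integral>\<^sup>+t. F (fun_upd \<omega> n (s', \<alpha>, t)) * indicator {s} (state_of (fun_upd \<omega> n (s', \<alpha>, t) n)) \<partial>sojourn M s')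
       \<partial>measure_pmf (\<sigma> (map \<omega> [0..<n]) s')) \<partial>measure_pmf (next_ma n \<omega>)) \<partial>paths)
     = (\<integral>\<^sup>+\<omega>. F \<omega> * ennreal (pmf (next_ma n \<omega>) s) \<partial>paths)"
    by (simp add: nn_integral_cmult emeasure_pmf_single)
qed

lemma measurable_scheduler [measurable]:
  "(\<lambda>\<omega>. pmf (\<sigma> (map \<omega> [0..<n]) s) \<alpha>) \<in> borel_measurable path_space"
proof -
  have "(\<lambda>\<omega>. pmf (\<sigma> (map \<omega> [0..<n]) s) \<alpha>) \<in> borel_measurable (PiM {0..<n} (\<lambda>_. entry_space))"
    using generic by (simp add: generic_scheduler_def)
  moreover have "(\<lambda>\<omega>. restrict \<omega> {0..<n}) \<in> path_space \<rightarrow>\<^sub>M PiM {0..<n} (\<lambda>_. entry_space)"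
    by (rule measurable_restrict_subset) simp
  ultimately have "(\<lambda>\<omega>. pmf (\<sigma> (map (restrict \<omega> {0..<n}) [0..<n]) s) \<alpha>) \<in> borel_measurable path_space"
    by (rule measurable_compose[rotated])
  moreover have "map (restrict \<omega> {0..<n}) [0..<n] = map \<omega> [0..<n]" for \<omega> :: "nat \<Rightarrow> ('s, 'a) entry"
    by (rule map_cong) auto
  ultimately show ?thesis by (simp only:)
qed

text \<open>The conditional law of the action given the past and the current state. The state
  indicator stays on both sides, which avoids dividing by the probability of the state.\<close>

lemma nn_integral_action:
  assumes F: "F \<in> borel_measurable path_space"
    and F_cong: "\<And>\<omega> \<omega>'. (\<And>i. i < n \<Longrightarrow> \<omega> i = \<omega>' i) \<Longrightarrow> F \<omega> = F \<omega>'"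
  shows "(\<integral>\<^sup>+\<omega>. F \<omega> * indicator {s} (state_of (\<omega> n)) * indicator {\<alpha>} (act_of (\<omega> n)) \<partial>paths)
    = (\<integral>\<^sup>+\<omega>. F \<omega> * ennreal (pmf (\<sigma> (map \<omega> [0..<n]) s) \<alpha>) * indicator {s} (state_of (\<omega> n)) \<partial>paths)"
proof -
  have F': "(\<lambda>\<omega>. F \<omega> * ennreal (pmf (\<sigma> (map \<omega> [0..<n]) s) \<alpha>)) \<in> borel_measurable path_space"
    using F by measurable
  have "(\<integral>\<^sup>+\<omega>. F \<omega> * indicator {s} (state_of (\<omega> n)) * indicator {\<alpha>} (act_of (\<omega> n)) \<partial>paths)
    = (\<integral>\<^sup>+\<omega>. (F \<omega> * ennreal (pmf (\<sigma> (map \<omega> [0..<n]) s) \<alpha>)) * ennreal (pmf (next_ma n \<omega>) s) \<partial>paths)"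
  proof (subst nn_integral_paths_step[where n = n])
    show "(\<lambda>\<omega>. F \<omega> * indicator {s} (state_of (\<omega> n)) * indicator {\<alpha>} (act_of (\<omega> n))) \<in> borel_measurable path_space"
      using F by measurable
    show "F \<omega> * indicator {s} (state_of (\<omega> n)) * indicator {\<alpha>} (act_of (\<omega> n)) = F \<omega>' * indicator {s} (state_of (\<omega>' n)) * indicator {\<alpha>} (act_of (\<omega>' n))"
      if "\<And>i. i \<le> n \<Longrightarrow> \<omega> i = \<omega>' i" for \<omega> \<omega>'
      using F_cong[of \<omega> \<omega>'] that by auto
    have 1: "F (fun_upd \<omega> n x) = F \<omega>" for \<omega> x by (rule F_cong) auto
    have 2: "(\<integral>\<^sup>+s'. F \<omega> * indicator {s} s' * ennreal (pmf (\<sigma> (map \<omega> [0..<n]) s') \<alpha>) \<partial>measure_pmf (next_ma n \<omega>))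
        = F \<omega> * ennreal (pmf (\<sigma> (map \<omega> [0..<n]) s) \<alpha>) * ennreal (pmf (next_ma n \<omega>) s)" for \<omega>
    proof -
      have "(\<integral>\<^sup>+s'. F \<omega> * indicator {s} s' * ennreal (pmf (\<sigma> (map \<omega> [0..<n]) s') \<alpha>) \<partial>measure_pmf (next_ma n \<omega>))
        = (\<integral>\<^sup>+s'. F \<omega> * ennreal (pmf (\<sigma> (map \<omega> [0..<n]) s) \<alpha>) * indicator {s} s' \<partial>measure_pmf (next_ma n \<omega>))"
        by (intro nn_integral_cong) (auto simp: indicator_def)
      then show ?thesis by (simp add: nn_integral_cmult emeasure_pmf_single)
    qed
    show "(\<integral>\<^sup>+\<omega>. (\<integral>\<^sup>+s'. (\<integral>\<^sup>+\<alpha>'. (\<integral>\<^sup>+t. F (fun_upd \<omega> n (s', \<alpha>', t)) * indicator {s} (state_of (fun_upd \<omega> n (s', \<alpha>', t) n))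
           * indicator {\<alpha>} (act_of (fun_upd \<omega> n (s', \<alpha>', t) n)) \<partial>sojourn M s')
         \<partial>measure_pmf (\<sigma> (map \<omega> [0..<n]) s')) \<partial>measure_pmf (next_ma n \<omega>)) \<partial>paths)
       = (\<integral>\<^sup>+\<omega>. (F \<omega> * ennreal (pmf (\<sigma> (map \<omega> [0..<n]) s) \<alpha>)) * ennreal (pmf (next_ma n \<omega>) s) \<partial>paths)"
      by (simp add: 1 nn_integral_cmult emeasure_pmf_single 2)
  qed
  also have "\<dots> = (\<integral>\<^sup>+\<omega>. F \<omega> * ennreal (pmf (\<sigma> (map \<omega> [0..<n]) s) \<alpha>) * indicator {s} (state_of (\<omega> n)) \<partial>paths)"
  proof (rule nn_integral_state[OF F', symmetric])
    fix \<omega> \<omega>' :: "nat \<Rightarrow> ('s, 'a) entry" assume *: "\<And>i. i < n \<Longrightarrow> \<omega> i = \<omega>' i"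
    then have "map \<omega> [0..<n] = map \<omega>' [0..<n]" by (intro map_cong) auto
    then show "F \<omega> * ennreal (pmf (\<sigma> (map \<omega> [0..<n]) s) \<alpha>) = F \<omega>' * ennreal (pmf (\<sigma> (map \<omega>' [0..<n]) s) \<alpha>)"
      using F_cong[OF *] by (simp only:)
  qed
  finally show ?thesis .
qed

text \<open>The inner integral is over a fixed measure only once the state is fixed; there are
  finitely many states, and each is treated separately.\<close>

lemma borel_measurable_resample:
  fixes F :: "(nat \<Rightarrow> ('s, 'a) entry) \<Rightarrow> ennreal"
  assumes F: "F \<in> borel_measurable path_space"
  shows "(\<lambda>\<omega>. \<integral>\<^sup>+t. F (fun_upd \<omega> n (state_of (\<omega> n), act_of (\<omega> n), t)) \<partial>sojourn M (state_of (\<omega> n))) \<in> borel_measurable path_space"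
proof (rule measurable_compose_countable[where f = "\<lambda>s \<omega>. \<integral>\<^sup>+t. F (fun_upd \<omega> n (s, act_of (\<omega> n), t)) \<partial>sojourn M s" and g = "\<lambda>\<omega>. state_of (\<omega> n)"])
  fix s
  interpret so: prob_space "sojourn M s" by (rule prob_space_sojourn)
  have e: "(\<lambda>p :: (nat \<Rightarrow> ('s, 'a) entry) \<times> real. (s, act_of (fst p n), snd p)) \<in> path_space \<Otimes>\<^sub>M sojourn M s \<rightarrow>\<^sub>M (entry_space :: ('s, 'a) entry measure)"
    unfolding entry_space_def by measurable
  have "(\<lambda>p :: (nat \<Rightarrow> ('s, 'a) entry) \<times> real. fun_upd (fst p) n (s, act_of (fst p n), snd p)) \<in> path_space \<Otimes>\<^sub>M sojourn M s \<rightarrow>\<^sub>M path_space"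
  proof (rule measurable_PiM_single')
    fix i :: nat
    show "(\<lambda>p :: (nat \<Rightarrow> ('s, 'a) entry) \<times> real. fun_upd (fst p) n (s, act_of (fst p n), snd p) i) \<in> path_space \<Otimes>\<^sub>M sojourn M s \<rightarrow>\<^sub>M entry_space"
      using e by (cases "i = n") auto
  qed simp
  from measurable_compose[OF this F]
  show "(\<lambda>\<omega>. \<integral>\<^sup>+t. F (fun_upd \<omega> n (s, act_of (\<omega> n), t)) \<partial>sojourn M s) \<in> borel_measurable path_space"
    by (intro so.borel_measurable_nn_integral) (simp add: split_beta')
qed measurable

text \<open>Given its state, the sojourn time of entry \<open>n\<close> is independent of the past
  and of the action, so redrawing it preserves the law of the entries up to \<open>n\<close>.
  Memorylessness and sojourn means always enter through this identity.\<close>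

lemma nn_integral_resample:
  assumes F: "F \<in> borel_measurable path_space"
    and F_cong: "\<And>\<omega> \<omega>'. (\<And>i. i \<le> n \<Longrightarrow> \<omega> i = \<omega>' i) \<Longrightarrow> F \<omega> = F \<omega>'"
  shows "(\<integral>\<^sup>+\<omega>. F \<omega> \<partial>paths) =
    (\<integral>\<^sup>+\<omega>. (\<integral>\<^sup>+t. F (fun_upd \<omega> n (state_of (\<omega> n), act_of (\<omega> n), t)) \<partial>sojourn M (state_of (\<omega> n))) \<partial>paths)"
    (is "_ = (\<integral>\<^sup>+\<omega>. ?G \<omega> \<partial>paths)")
proof -
  have "(\<integral>\<^sup>+\<omega>. ?G \<omega> \<partial>paths) = (\<integral>\<^sup>+\<omega>. (\<integral>\<^sup>+s. (\<integral>\<^sup>+\<alpha>. (\<integral>\<^sup>+t. ?G (fun_upd \<omega> n (s, \<alpha>, t)) \<partial>sojourn M s)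
       \<partial>measure_pmf (\<sigma> (map \<omega> [0..<n]) s)) \<partial>measure_pmf (next_ma n \<omega>)) \<partial>paths)"
  proof (rule nn_integral_paths_step[OF borel_measurable_resample[OF F]])
    fix \<omega> \<omega>' :: "nat \<Rightarrow> ('s, 'a) entry" assume *: "\<And>i. i \<le> n \<Longrightarrow> \<omega> i = \<omega>' i"
    then have "F (fun_upd \<omega> n x) = F (fun_upd \<omega>' n x)" for x by (intro F_cong) auto
    then show "?G \<omega> = ?G \<omega>'" using *[of n] by simp
  qed
  \<comment> \<open>After the update \<open>?G\<close> no longer depends on the first of the two
    drawn times, so the innermost integral is over a constant and a single draw remains.\<close>
  also have "\<dots> = (\<integral>\<^sup>+\<omega>. F \<omega> \<partial>paths)"
    by (subst nn_integral_paths_step[OF F F_cong, where n = n]) simp_all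
  finally show ?thesis ..
qed

lemma AE_entry:
  assumes Q: "Measurable.pred entry_space Q"
    and *: "\<And>s \<alpha>. \<alpha> \<in> enabled (trans_prob M) s \<Longrightarrow> AE t in sojourn M s. Q (s, \<alpha>, t)"
  shows "AE \<omega> in paths. Q (\<omega> n)"
proof -
  let ?B = "{\<omega>. \<not> Q (\<omega> n)}"
  have "{\<omega> \<in> space path_space. \<not> Q (\<omega> n)} \<in> sets path_space" using Q by measurable
  then have B: "?B \<in> sets path_space" by simp
  have "emeasure paths ?B = (\<integral>\<^sup>+\<omega>. indicator ?B \<omega> \<partial>paths)"
    using B by simp
  also have "\<dots> = (\<integral>\<^sup>+\<omega>. (\<integral>\<^sup>+s. (\<integral>\<^sup>+\<alpha>. (\<integral>\<^sup>+t. indicator ?B (fun_upd \<omega> n (s, \<alpha>, t)) \<partial>sojourn M s)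
       \<partial>measure_pmf (\<sigma> (map \<omega> [0..<n]) s)) \<partial>measure_pmf (next_ma n \<omega>)) \<partial>paths)"
  proof (rule nn_integral_paths_step)
    show "indicator ?B \<in> borel_measurable path_space" using B by simp
  qed (simp add: indicator_def)
  also have "\<dots> = (\<integral>\<^sup>+\<omega>. (\<integral>\<^sup>+s. (\<integral>\<^sup>+\<alpha>. 0
       \<partial>measure_pmf (\<sigma> (map \<omega> [0..<n]) s)) \<partial>measure_pmf (next_ma n \<omega>)) \<partial>paths)"
  proof -
    have "(\<integral>\<^sup>+t. indicator ?B (fun_upd \<omega> n (s, \<alpha>, t)) \<partial>sojourn M s) = 0"
      if "\<alpha> \<in> set_pmf (\<sigma> (map \<omega> [0..<n]) s)" for \<omega> s \<alpha>
    proof -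
      have "AE t in sojourn M s. Q (s, \<alpha>, t)"
        using that * set_pmf_scheduler by blast
      then have "AE t in sojourn M s. indicator ?B (fun_upd \<omega> n (s, \<alpha>, t)) = (0::ennreal)"
        by eventually_elim simp
      then show ?thesis by (subst nn_integral_cong_AE) auto
    qed
    then have "(\<integral>\<^sup>+\<alpha>. (\<integral>\<^sup>+t. indicator ?B (fun_upd \<omega> n (s, \<alpha>, t)) \<partial>sojourn M s)
        \<partial>measure_pmf (\<sigma> (map \<omega> [0..<n]) s)) = (\<integral>\<^sup>+\<alpha>. 0 \<partial>measure_pmf (\<sigma> (map \<omega> [0..<n]) s))" for \<omega> s
      by (intro nn_integral_cong_AE AE_pmfI)
    then show ?thesis by (simp only:)
  qed
  finally have "emeasure paths ?B = 0" by simp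
  then show ?thesis
    using B by (intro AE_I[of _ _ ?B]) auto
qed

text \<open>The path space contains arbitrary sequences of entries. Almost all of them have enabled
  actions and admissible sojourn times, and the pathwise arguments are restricted to these.\<close>

lemma AE_regular:
  "AE \<omega> in paths. \<forall>n. act_of (\<omega> n) \<in> enabled (trans_prob M) (state_of (\<omega> n)) \<and> 0 \<le> time_of (\<omega> n)
     \<and> (state_of (\<omega> n) \<notin> markov_states M \<longrightarrow> time_of (\<omega> n) = 0)"
proof (subst AE_all_countable, rule allI, rule AE_entry)
  fix s \<alpha> assume "\<alpha> \<in> enabled (trans_prob M) s"
  then show "AE t in sojourn M s. act_of (s, \<alpha>, t) \<in> enabled (trans_prob M) (state_of (s, \<alpha>, t)) \<and> 0 \<le> time_of (s, \<alpha>, t)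
     \<and> (state_of (s, \<alpha>, t) \<notin> markov_states M \<longrightarrow> time_of (s, \<alpha>, t) = 0)"
    using AE_sojourn[of s] by simp
next
  have "Measurable.pred entry_space (\<lambda>x :: ('s, 'a) entry. act_of x \<in> enabled (trans_prob M) (state_of x))"
    using measurable_compose[OF measurable_state_act, of "\<lambda>(s, \<alpha>). \<alpha> \<in> enabled (trans_prob M) s" "count_space UNIV"]
    by (simp add: split_beta')
  then show "Measurable.pred entry_space (\<lambda>x :: ('s, 'a) entry. act_of x \<in> enabled (trans_prob M) (state_of x) \<and> 0 \<le> time_of x
     \<and> (state_of x \<notin> markov_states M \<longrightarrow> time_of x = 0))"
    by measurable
qed

end

subsection \<open>The distribution of digitized paths\<close>

context scheduled_markov_automaton
begin

abbreviation expanded :: "(nat \<Rightarrow> ('s, 'a) entry) \<Rightarrow> nat \<Rightarrow> ('s \<times> 'a) list" where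
  "expanded \<omega> i \<equiv> expand (map \<omega> [0..<i])"

text \<open>The arguments of \<open>g\<close> range over countable types, so \<open>g\<close> may be
  arbitrary: word, state, action and number of copies are fixed one after the other.\<close>

lemma measurable_digit_data:
  "(\<lambda>\<omega>. g (expanded \<omega> i) (state_of (\<omega> i)) (act_of (\<omega> i)) (copies (\<omega> i)) :: ennreal) \<in> borel_measurable path_space"
  by (rule measurable_compose_countable[where f = "\<lambda>e \<omega>. g e (state_of (\<omega> i)) (act_of (\<omega> i)) (copies (\<omega> i))"],
      rule measurable_compose_countable[where f = "\<lambda>s \<omega>. g e s (act_of (\<omega> i)) (copies (\<omega> i))" for e],
      rule measurable_compose_countable[where f = "\<lambda>\<alpha> \<omega>. g e s \<alpha> (copies (\<omega> i))" for e s],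
      rule measurable_compose_countable[where f = "\<lambda>c \<omega>. g e s \<alpha> c" for e s \<alpha>])
    (simp_all add: measurable_expand)

lemma measurable_paths: "f \<in> path_space \<rightarrow>\<^sub>M N \<Longrightarrow> f \<in> paths \<rightarrow>\<^sub>M N"
  by (simp add: measurable_cong_sets[OF sets_paths refl])

lemma map_upt_cong: "(\<And>i. i < n \<Longrightarrow> \<omega> i = \<omega>' i) \<Longrightarrow> map \<omega> [0..<n] = map \<omega>' [0..<n]"
  by (intro map_cong) auto

lemma expanded_fun_upd: "map (fun_upd \<omega> i x) [0..<i] = map \<omega> [0..<i]"
  by (rule map_upt_cong) simp

lemma nn_integral_digit_data:
  "(\<integral>\<^sup>+\<omega>. g (expanded \<omega> i) (state_of (\<omega> i)) (act_of (\<omega> i)) (copies (\<omega> i)) \<partial>paths) =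
   (\<integral>\<^sup>+\<omega>. (\<integral>\<^sup>+t. g (expanded \<omega> i) (state_of (\<omega> i)) (act_of (\<omega> i)) (copies (state_of (\<omega> i), act_of (\<omega> i), t))
      \<partial>sojourn M (state_of (\<omega> i))) \<partial>paths)"
proof (subst nn_integral_resample[OF measurable_digit_data, where n = i])
  fix \<omega> \<omega>' :: "nat \<Rightarrow> ('s, 'a) entry" assume *: "\<And>k. k \<le> i \<Longrightarrow> \<omega> k = \<omega>' k"
  have "map \<omega> [0..<i] = map \<omega>' [0..<i]" by (rule map_upt_cong) (simp add: *)
  then show "g (expanded \<omega> i) (state_of (\<omega> i)) (act_of (\<omega> i)) (copies (\<omega> i)) =
    g (expanded \<omega>' i) (state_of (\<omega>' i)) (act_of (\<omega>' i)) (copies (\<omega>' i))"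
    using *[of i] by (simp only: order_refl)
qed (simp only: expanded_fun_upd fun_upd_same fst_conv snd_conv)

lemma nn_integral_digit_data_next:
  "(\<integral>\<^sup>+\<omega>. g (expanded \<omega> i) (state_of (\<omega> i)) (act_of (\<omega> i)) (copies (\<omega> i)) * indicator {s} (state_of (\<omega> (Suc i))) \<partial>paths) =
   (\<integral>\<^sup>+\<omega>. g (expanded \<omega> i) (state_of (\<omega> i)) (act_of (\<omega> i)) (copies (\<omega> i))
      * ennreal (pmf (successor (trans_prob M) (state_of (\<omega> i)) (act_of (\<omega> i))) s) \<partial>paths)"
proof (subst nn_integral_state[OF measurable_digit_data])
  fix \<omega> \<omega>' :: "nat \<Rightarrow> ('s, 'a) entry" assume *: "\<And>k. k < Suc i \<Longrightarrow> \<omega> k = \<omega>' k"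
  have "map \<omega> [0..<i] = map \<omega>' [0..<i]" by (rule map_upt_cong) (simp add: *)
  then show "g (expanded \<omega> i) (state_of (\<omega> i)) (act_of (\<omega> i)) (copies (\<omega> i)) =
    g (expanded \<omega>' i) (state_of (\<omega>' i)) (act_of (\<omega>' i)) (copies (\<omega>' i))"
    using *[of i] by (simp only: lessI)
qed (simp add: next_state_def)

section \<open>Cylinder probabilities of the digitized path\<close>

abbreviation digit_prefix :: "('s \<times> 'a) list \<Rightarrow> (nat \<Rightarrow> ('s, 'a) entry) set" where
  "digit_prefix h \<equiv> {\<omega>. map (digit \<omega>) [0..<length h] = h}"

abbreviation digit_prefix_state :: "('s \<times> 'a) list \<Rightarrow> 's \<Rightarrow> (nat \<Rightarrow> ('s, 'a) entry) set" where
  "digit_prefix_state h s \<equiv> {\<omega>. map (digit \<omega>) [0..<length h] = h \<and> fst (digit \<omega> (length h)) = s}"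

lemma sets_digit_prefix [measurable]: "digit_prefix h \<in> sets path_space"
  using measurable_sets[OF measurable_digit sets_cylinder[of h]] by (simp add: vimage_def)

lemma sets_digit_prefix_state [measurable]: "digit_prefix_state h s \<in> sets path_space"
proof -
  have "{\<omega>. fst (digit \<omega> (length h)) = s} \<in> sets path_space"
    using measurable_sets[OF measurable_digit_component, of "{x. fst x = s}" "length h"] by (simp add: vimage_def)
  with sets_digit_prefix[of h] have "digit_prefix h \<inter> {\<omega>. fst (digit \<omega> (length h)) = s} \<in> sets path_space"
    by (rule sets.Int)
  then show ?thesis by (simp add: Int_def)
qed

lemma digit_0: "digit \<omega> 0 = (state_of (\<omega> 0), act_of (\<omega> 0))"
  using index_start[of 0 \<omega> 0] by (simp add: digit_def)

lemma emeasure_digit_prefix_disabled: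
  assumes "\<alpha> \<notin> enabled (trans_prob M) s"
  shows "emeasure paths (digit_prefix (h @ [(s, \<alpha>)])) = 0"
proof -
  have "AE \<omega> in paths. \<omega> \<notin> digit_prefix (h @ [(s, \<alpha>)])"
    using AE_regular
  proof eventually_elim
    case (elim \<omega>)
    then have "digit \<omega> (length h) \<noteq> (s, \<alpha>)"
      using assms by (auto simp: digit_def)
    then show ?case by simp
  qed
  then show ?thesis
    using sets_digit_prefix[of "h @ [(s, \<alpha>)]"]
    by (subst AE_iff_measurable[symmetric, of _ _ "\<lambda>\<omega>. \<omega> \<notin> digit_prefix (h @ [(s, \<alpha>)])"]) auto
qed

text \<open>The event is split according to the entry \<open>i\<close> that covers the last position of \<open>h\<close>: given the past,
  either the sojourn time of entry \<open>i\<close> extends beyond that position or entry \<open>i + 1\<close> follows.\<close>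

lemma emeasure_digit_prefix_state:
  "emeasure paths (digit_prefix_state h s')
    = emeasure paths (digit_prefix h) * ennreal (pmf (next_state (digit_prob M \<delta>) (init_state M) h) s')"
proof (cases h rule: rev_cases)
  case Nil
  have "emeasure paths (digit_prefix_state h s') = (\<integral>\<^sup>+\<omega>. indicator (digit_prefix_state h s') \<omega> \<partial>paths)"
    by simp
  also have "\<dots> = (\<integral>\<^sup>+\<omega>. 1 * indicator {s'} (state_of (\<omega> 0)) \<partial>paths)"
    unfolding Nil by (intro nn_integral_cong) (auto simp: digit_0 indicator_def)
  also have "\<dots> = ennreal (pmf (return_pmf (init_state M)) s')"
    using nn_integral_state[of "\<lambda>_. 1" 0 s'] paths.emeasure_space_1 by (simp add: next_state_def)
  finally show ?thesis
    using paths.emeasure_space_1 by (simp add: Nil next_state_def)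
next
  case (snoc g x)
  obtain s \<alpha> where x: "x = (s, \<alpha>)" by (cases x)
  let ?m = "length g"
  show ?thesis
  proof (cases "\<alpha> \<in> enabled (trans_prob M) s")
    case False
    \<comment> \<open>For a disabled action \<open>successor\<close> carries no information, but
      then the prefix is a null event and both sides vanish.\<close>
    have 0: "emeasure paths (digit_prefix h) = 0"
      unfolding snoc x by (rule emeasure_digit_prefix_disabled[OF False])
    have "emeasure paths (digit_prefix_state h s') \<le> emeasure paths (digit_prefix h)"
      by (intro emeasure_mono) (use sets_digit_prefix[of h] in auto)
    then show ?thesis using 0 by simp
  next
    case True
    then obtain \<mu> where \<mu>: "has_succ M s \<alpha> \<mu>" using enabled_iff by blast
    \<comment> \<open>\<open>U\<close> says that, if entry \<open>i\<close> covers the last position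
      \<open>?m\<close> of \<open>h\<close>, its past, state and action agree with \<open>h\<close>.
      \<open>gt l\<close> says that its block reaches position \<open>?m + l\<close>, and
      \<open>eq\<close> that it ends at \<open>?m\<close>. As functions of word, state, action and
      copies they fit the identities for digitized data.\<close>
    define U :: "('s \<times> 'a) list \<Rightarrow> 's \<Rightarrow> 'a \<Rightarrow> ennreal" where
      "U e s'' \<alpha>'' = (if length e \<le> ?m \<and> e @ replicate (?m - length e) (s, \<alpha>) = g \<and> s'' = s \<and> \<alpha>'' = \<alpha> then 1 else 0)" for e s'' \<alpha>''
    define gt where "gt l e c = (if ?m + l < length e + c then 1 else 0 :: ennreal)" for l and e :: "('s \<times> 'a) list" and c :: nat
    define eq where "eq e c = (if ?m + 1 = length e + c then 1 else 0 :: ennreal)" for e :: "('s \<times> 'a) list" and c :: nat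
    let ?U = "\<lambda>\<omega> i. U (expanded \<omega> i) (state_of (\<omega> i)) (act_of (\<omega> i))"
    have idx: "?U \<omega> i * gt 0 (expanded \<omega> i) (copies (\<omega> i)) = (if index \<omega> ?m = i then indicator (digit_prefix h) \<omega> else 0)" for \<omega> i
    proof -
      have "index \<omega> ?m = i \<and> \<omega> \<in> digit_prefix h \<longleftrightarrow> start \<omega> i \<le> ?m \<and> ?m < start \<omega> i + copies (\<omega> i)
         \<and> expanded \<omega> i @ replicate (?m - start \<omega> i) (state_of (\<omega> i), act_of (\<omega> i)) = g \<and> (state_of (\<omega> i), act_of (\<omega> i)) = (s, \<alpha>)"
      proof (cases "index \<omega> ?m = i")
        case True
        then have "start \<omega> i \<le> ?m" "?m < start \<omega> i + copies (\<omega> i)" by (auto simp: index_eq_iff start_Suc)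
        then show ?thesis
          using True map_digit_prefix[of \<omega> i ?m] by (auto simp: start_Suc snoc x digit_def)
      next
        case False
        then show ?thesis by (auto simp: index_eq_iff start_Suc)
      qed
      then show ?thesis
        by (auto simp: U_def gt_def length_expand indicator_def)
    qed
    have next_digit: "fst (digit \<omega> (Suc ?m)) = (if Suc ?m < start \<omega> i + copies (\<omega> i) then state_of (\<omega> i) else state_of (\<omega> (Suc i)))"
      if "index \<omega> ?m = i" for \<omega> i
    proof -
      have "start \<omega> i \<le> ?m" "?m < start \<omega> i + copies (\<omega> i)"
        using that by (auto simp: index_eq_iff start_Suc)
      then have "index \<omega> (Suc ?m) = (if Suc ?m < start \<omega> i + copies (\<omega> i) then i else Suc i)"
        using copies_pos[of "\<omega> (Suc i)"] by (auto simp: index_eq_iff start_Suc simp del: copies_pos)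
      then show ?thesis by (simp add: digit_def)
    qed
    \<comment> \<open>Position \<open>?m + 1\<close> either still belongs to the block of entry
      \<open>i\<close>, so its state is \<open>s\<close>, or it is the first position of entry
      \<open>i + 1\<close>.\<close>
    have idx': "?U \<omega> i * gt 1 (expanded \<omega> i) (copies (\<omega> i)) * indicator {s'} s
        + ?U \<omega> i * eq (expanded \<omega> i) (copies (\<omega> i)) * indicator {s'} (state_of (\<omega> (Suc i)))
        = (if index \<omega> ?m = i then indicator (digit_prefix_state h s') \<omega> else 0)" for \<omega> i
    proof (cases "index \<omega> ?m = i")
      case i: True
      have le: "start \<omega> i \<le> ?m" "?m < start \<omega> i + copies (\<omega> i)"
        using i by (auto simp: index_eq_iff start_Suc)
      have U: "?U \<omega> i = indicator (digit_prefix h) \<omega>"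
        using idx[of \<omega> i] i le by (simp add: gt_def length_expand)
      have s: "state_of (\<omega> i) = s" if "\<omega> \<in> digit_prefix h"
        using that i by (simp add: snoc x digit_def)
      show ?thesis
      proof (cases "\<omega> \<in> digit_prefix h")
        case True
        then show ?thesis
          using i le U s[OF True] next_digit[OF i] by (auto simp: gt_def eq_def length_expand indicator_def snoc)
      next
        case False
        then show ?thesis using i U by (simp add: indicator_def)
      qed
    next
      case False
      then have "?U \<omega> i * gt 0 (expanded \<omega> i) (copies (\<omega> i)) = 0" using idx[of \<omega> i] by simp
      then have "?U \<omega> i = 0 \<or> \<not> ?m < length (expanded \<omega> i) + copies (\<omega> i)"
        by (auto simp: gt_def split: if_splits)
      then show ?thesis
        using False by (auto simp: gt_def eq_def)
    qed
    \<comment> \<open>An entry index never exceeds its position, so the sum over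
      \<open>i \<le> ?m\<close> meets the covering entry exactly once.\<close>
    have sums: "(\<Sum>i\<le>?m. if index \<omega> ?m = i then c else 0) = c" for \<omega> and c :: ennreal
      using index_le[of \<omega> ?m] by simp
    let ?p = "pmf (next_state (digit_prob M \<delta>) (init_state M) h) s'"
    have p: "?p = digit_prob M \<delta> s \<alpha> s'"
      using pmf_digit_successor[OF delta_pos True] by (simp add: snoc x next_state_def)
    have step: "(\<integral>\<^sup>+\<omega>. ?U \<omega> i * gt 1 (expanded \<omega> i) (copies (\<omega> i)) * indicator {s'} s
        + ?U \<omega> i * eq (expanded \<omega> i) (copies (\<omega> i)) * indicator {s'} (state_of (\<omega> (Suc i))) \<partial>paths)
      = (\<integral>\<^sup>+\<omega>. ?U \<omega> i * gt 0 (expanded \<omega> i) (copies (\<omega> i)) \<partial>paths) * ennreal ?p" for i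
    proof -
      \<comment> \<open>Where \<open>U\<close> is nonzero, state and action are \<open>s\<close> and
        \<open>\<alpha>\<close>, so the successor probability is a constant.\<close>
      have succ: "U e s'' \<alpha>'' * c * ennreal (pmf (successor (trans_prob M) s'' \<alpha>'') s') = U e s'' \<alpha>'' * c * ennreal (trans_prob M s \<alpha> s')" for e s'' \<alpha>'' c
        by (auto simp: U_def successor_eq[OF \<mu>] trans_prob_eq[OF \<mu>])
      \<comment> \<open>Position \<open>?m + l\<close> has offset \<open>?m - length e + l\<close>
        in the block. The subtraction is exact, since \<open>U\<close> vanishes unless
        \<open>length e \<le> ?m\<close>.\<close>
      have tail: "(\<integral>\<^sup>+t. U e s'' \<alpha>'' * gt l e (copies (s'', \<alpha>'', t)) * c \<partial>sojourn M s'') = U e s'' \<alpha>'' * ennreal (survival s (?m - length e + l)) * c" for e s'' \<alpha>'' l c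
      proof (cases "U e s'' \<alpha>'' = 0")
        case False
        then have e: "length e \<le> ?m" "s'' = s" "\<alpha>'' = \<alpha>" by (auto simp: U_def split: if_splits)
        have "gt l e (copies (s, \<alpha>, t)) = indicator {t. ?m - length e + l < copies (s, \<alpha>, t)} t" for t
          using e by (auto simp: gt_def indicator_def)
        moreover have "{t. ?m - length e + l < copies (s, \<alpha>, t)} \<in> sets (sojourn M s)"
          using sets_copies_sojourn[of s \<alpha> "{?m - length e + l<..}"] by simp
        ultimately show ?thesis
          by (simp add: e nn_integral_cmult nn_integral_multc emeasure_sojourn_less_copies)
      qed simp
      have exact: "(\<integral>\<^sup>+t. U e s'' \<alpha>'' * eq e (copies (s'', \<alpha>'', t)) * c \<partial>sojourn M s'')
          = U e s'' \<alpha>'' * ennreal (survival s (?m - length e) - survival s (Suc (?m - length e))) * c" for e s'' \<alpha>'' c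
      proof (cases "U e s'' \<alpha>'' = 0")
        case False
        then have e: "length e \<le> ?m" "s'' = s" "\<alpha>'' = \<alpha>" by (auto simp: U_def split: if_splits)
        have "eq e (copies (s, \<alpha>, t)) = indicator {t. copies (s, \<alpha>, t) = Suc (?m - length e)} t" for t
          using e by (auto simp: eq_def indicator_def)
        moreover have "{t. copies (s, \<alpha>, t) = Suc (?m - length e)} \<in> sets (sojourn M s)"
          using sets_copies_sojourn[of s \<alpha> "{Suc (?m - length e)}"] by simp
        ultimately show ?thesis
          by (simp add: e nn_integral_cmult nn_integral_multc emeasure_sojourn_copies_eq)
      qed simp
      have "(\<integral>\<^sup>+\<omega>. ?U \<omega> i * gt 1 (expanded \<omega> i) (copies (\<omega> i)) * indicator {s'} s
        + ?U \<omega> i * eq (expanded \<omega> i) (copies (\<omega> i)) * indicator {s'} (state_of (\<omega> (Suc i))) \<partial>paths)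
       = (\<integral>\<^sup>+\<omega>. ?U \<omega> i * gt 1 (expanded \<omega> i) (copies (\<omega> i)) * indicator {s'} s \<partial>paths)
        + (\<integral>\<^sup>+\<omega>. ?U \<omega> i * eq (expanded \<omega> i) (copies (\<omega> i)) * indicator {s'} (state_of (\<omega> (Suc i))) \<partial>paths)"
        by (intro nn_integral_add borel_measurable_times_ennreal[where g = "\<lambda>\<omega>. indicator {s'} (state_of (\<omega> (Suc i)))"]
            measurable_paths[OF measurable_digit_data[of "\<lambda>e s'' \<alpha>'' c. U e s'' \<alpha>'' * gt 1 e c * indicator {s'} s" i]]
            measurable_paths[OF measurable_digit_data[of "\<lambda>e s'' \<alpha>'' c. U e s'' \<alpha>'' * eq e c" i]]) measurable
      also have "\<dots> = (\<integral>\<^sup>+\<omega>. ?U \<omega> i * gt 1 (expanded \<omega> i) (copies (\<omega> i)) * indicator {s'} s \<partial>paths)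
        + (\<integral>\<^sup>+\<omega>. ?U \<omega> i * eq (expanded \<omega> i) (copies (\<omega> i)) * ennreal (trans_prob M s \<alpha> s') \<partial>paths)"
        using nn_integral_digit_data_next[of "\<lambda>e s'' \<alpha>'' c. U e s'' \<alpha>'' * eq e c" i s'] by (simp only: succ)
      also have "\<dots> = (\<integral>\<^sup>+\<omega>. ?U \<omega> i * ennreal (survival s (?m - length (expanded \<omega> i) + 1)) * indicator {s'} s \<partial>paths)
        + (\<integral>\<^sup>+\<omega>. ?U \<omega> i * ennreal (survival s (?m - length (expanded \<omega> i)) - survival s (Suc (?m - length (expanded \<omega> i)))) * ennreal (trans_prob M s \<alpha> s') \<partial>paths)"
        using nn_integral_digit_data[of "\<lambda>e s'' \<alpha>'' c. U e s'' \<alpha>'' * gt 1 e c * indicator {s'} s" i]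
          nn_integral_digit_data[of "\<lambda>e s'' \<alpha>'' c. U e s'' \<alpha>'' * eq e c * ennreal (trans_prob M s \<alpha> s')" i]
        by (simp only: tail exact)
      also have "\<dots> = (\<integral>\<^sup>+\<omega>. ?U \<omega> i * ennreal (survival s (?m - length (expanded \<omega> i) + 1)) * indicator {s'} s
        + ?U \<omega> i * ennreal (survival s (?m - length (expanded \<omega> i)) - survival s (Suc (?m - length (expanded \<omega> i)))) * ennreal (trans_prob M s \<alpha> s') \<partial>paths)"
        by (intro nn_integral_add[symmetric]
            measurable_paths[OF measurable_digit_data[of "\<lambda>e s'' \<alpha>'' c. U e s'' \<alpha>'' * ennreal (survival s (?m - length e + 1)) * indicator {s'} s" i]]
            measurable_paths[OF measurable_digit_data[of "\<lambda>e s'' \<alpha>'' c. U e s'' \<alpha>'' * ennreal (survival s (?m - length e) - survival s (Suc (?m - length e))) * ennreal (trans_prob M s \<alpha> s')" i]])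
      \<comment> \<open>By \<open>digit_prob_survival\<close> the two summands merge, and the
        transition probability of the MDP comes out as a factor that does not depend on
        \<open>i\<close>.\<close>
      also have "\<dots> = (\<integral>\<^sup>+\<omega>. ?U \<omega> i * ennreal (survival s (?m - length (expanded \<omega> i) + 0)) * ennreal ?p \<partial>paths)"
      proof (intro nn_integral_cong)
        fix \<omega>
        let ?j = "?m - length (expanded \<omega> i)"
        have "ennreal (survival s (Suc ?j)) * indicator {s'} s + ennreal (survival s ?j - survival s (Suc ?j)) * ennreal (trans_prob M s \<alpha> s')
          = ennreal (survival s (Suc ?j) * (if s' = s then 1 else 0) + (survival s ?j - survival s (Suc ?j)) * trans_prob M s \<alpha> s')"
          using survival_nonneg survival_Suc_le[of s ?j] by (auto simp: trans_prob_eq[OF \<mu>] ennreal_mult ennreal_plus)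
        also have "\<dots> = ennreal (survival s ?j) * ennreal ?p"
          unfolding digit_prob_survival[OF True] p[symmetric] using survival_nonneg by (simp add: ennreal_mult)
        finally show "?U \<omega> i * ennreal (survival s (?m - length (expanded \<omega> i) + 1)) * indicator {s'} s
          + ?U \<omega> i * ennreal (survival s (?m - length (expanded \<omega> i)) - survival s (Suc (?m - length (expanded \<omega> i)))) * ennreal (trans_prob M s \<alpha> s')
          = ?U \<omega> i * ennreal (survival s (?m - length (expanded \<omega> i) + 0)) * ennreal ?p"
          by (simp add: mult.assoc flip: distrib_left)
      qed
      also have "\<dots> = (\<integral>\<^sup>+\<omega>. ?U \<omega> i * gt 0 (expanded \<omega> i) (copies (\<omega> i)) * ennreal ?p \<partial>paths)"
        using nn_integral_digit_data[of "\<lambda>e s'' \<alpha>'' c. U e s'' \<alpha>'' * gt 0 e c * ennreal ?p" i] by (simp only: tail)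
      also have "\<dots> = (\<integral>\<^sup>+\<omega>. ?U \<omega> i * gt 0 (expanded \<omega> i) (copies (\<omega> i)) \<partial>paths) * ennreal ?p"
        using measurable_digit_data[of "\<lambda>e s'' \<alpha>'' c. U e s'' \<alpha>'' * gt 0 e c" i]
        by (intro nn_integral_multc) simp
      finally show ?thesis .
    qed
    have "emeasure paths (digit_prefix_state h s') = (\<integral>\<^sup>+\<omega>. indicator (digit_prefix_state h s') \<omega> \<partial>paths)"
      using sets_digit_prefix_state[of h s'] by simp
    also have "\<dots> = (\<integral>\<^sup>+\<omega>. (\<Sum>i\<le>?m. if index \<omega> ?m = i then indicator (digit_prefix_state h s') \<omega> else 0) \<partial>paths)"
      by (simp only: sums)
    also have "\<dots> = (\<Sum>i\<le>?m. (\<integral>\<^sup>+\<omega>. (if index \<omega> ?m = i then indicator (digit_prefix_state h s') \<omega> else 0) \<partial>paths))"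
      by (intro nn_integral_sum) measurable
    also have "\<dots> = (\<Sum>i\<le>?m. (\<integral>\<^sup>+\<omega>. (if index \<omega> ?m = i then indicator (digit_prefix h) \<omega> else 0) \<partial>paths) * ennreal ?p)"
      by (simp only: idx[symmetric] idx'[symmetric] step)
    also have "\<dots> = (\<integral>\<^sup>+\<omega>. (\<Sum>i\<le>?m. if index \<omega> ?m = i then indicator (digit_prefix h) \<omega> else 0) \<partial>paths) * ennreal ?p"
      unfolding sum_distrib_right[symmetric]
      by (subst nn_integral_sum) (simp_all, measurable)
    also have "\<dots> = emeasure paths (digit_prefix h) * ennreal ?p"
      using sets_digit_prefix[of h] by (simp only: sums) simp
    finally show ?thesis .
  qed
qed



text \<open>The state transitions of the digitized path have the right law for every scheduler, so
  recognizing an MDP scheduler is a matter of the actions alone.\<close>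

lemma distr_digit:
  assumes action: "\<And>h s \<alpha>. emeasure paths (digit_prefix (h @ [(s, \<alpha>)]))
    = emeasure paths (digit_prefix_state h s) * ennreal (pmf (\<sigma>' h s) \<alpha>)"
  shows "distr paths (PiM UNIV (\<lambda>_. count_space UNIV)) digit = mdp_paths (digitization M \<delta>) \<sigma>'"
proof (rule mdp_paths_eqI)
  have digit: "digit \<in> paths \<rightarrow>\<^sub>M PiM UNIV (\<lambda>_. count_space UNIV)"
    using measurable_digit by (simp add: measurable_cong_sets[OF sets_paths refl])
  show "prob_space (distr paths (PiM UNIV (\<lambda>_. count_space UNIV)) digit)"
    by (rule paths.prob_space_distr[OF digit])
  have cyl: "emeasure (distr paths (PiM UNIV (\<lambda>_. count_space UNIV)) digit) {\<omega>. map \<omega> [0..<length h] = h}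
      = emeasure paths (digit_prefix h)" for h
    by (subst emeasure_distr[OF digit sets_cylinder]) (simp add: vimage_def)
  fix h :: "('s \<times> 'a) list" and s \<alpha>
  show "emeasure (distr paths (PiM UNIV (\<lambda>_. count_space UNIV)) digit) {\<omega>. map \<omega> [0..<length (h @ [(s, \<alpha>)])] = h @ [(s, \<alpha>)]} =
    emeasure (distr paths (PiM UNIV (\<lambda>_. count_space UNIV)) digit) {\<omega>. map \<omega> [0..<length h] = h} *
    ennreal (pmf (next_state (mdp_prob (digitization M \<delta>)) (mdp_init (digitization M \<delta>)) h) s * pmf (\<sigma>' h s) \<alpha>)"
    unfolding cyl action emeasure_digit_prefix_state by (simp add: digitization_def ennreal_mult mult.assoc)
qed simp

section \<open>Schedulers of the digitization: conditional probabilities and simulation\<close>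

lemma emeasure_digit_prefix_snoc_le:
  "emeasure paths (digit_prefix (h @ [(s, \<alpha>)])) \<le> emeasure paths (digit_prefix_state h s)"
  using sets_digit_prefix_state[of h s] by (intro emeasure_mono) auto

lemma sum_emeasure_digit_prefix:
  "(\<Sum>\<alpha>\<in>UNIV. emeasure paths (digit_prefix (h @ [(s, \<alpha>)]))) = emeasure paths (digit_prefix_state h s)"
proof -
  have "(\<Sum>\<alpha>\<in>UNIV. emeasure paths (digit_prefix (h @ [(s, \<alpha>)]))) = emeasure paths (\<Union>\<alpha>. digit_prefix (h @ [(s, \<alpha>)]))"
  proof (rule sum_emeasure)
    show "disjoint_family (\<lambda>\<alpha>. digit_prefix (h @ [(s, \<alpha>)]))"
      by (auto simp: disjoint_family_on_def)
  qed (use sets_digit_prefix in \<open>auto simp del: length_append upt_Suc\<close>)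
  also have "(\<Union>\<alpha>. digit_prefix (h @ [(s, \<alpha>)])) = digit_prefix_state h s"
    by (auto simp: prod_eq_iff)
  finally show ?thesis .
qed

text \<open>Histories of probability 0 have no conditional law; an arbitrary enabled action is
  chosen there because validity is demanded on all histories.\<close>

definition digit_scheduler :: "('s, 'a) mdp_scheduler" where
  "digit_scheduler h s =
     (if measure paths (digit_prefix_state h s) = 0 then return_pmf (SOME \<alpha>. \<alpha> \<in> enabled (trans_prob M) s)
      else embed_pmf (\<lambda>\<alpha>. measure paths (digit_prefix (h @ [(s, \<alpha>)])) / measure paths (digit_prefix_state h s)))"

lemma pmf_digit_scheduler:
  assumes "measure paths (digit_prefix_state h s) \<noteq> 0"
  shows "pmf (digit_scheduler h s) \<alpha> = measure paths (digit_prefix (h @ [(s, \<alpha>)])) / measure paths (digit_prefix_state h s)"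
proof -
  let ?m = "measure paths (digit_prefix_state h s)"
  have "ennreal (\<Sum>\<alpha>\<in>UNIV. measure paths (digit_prefix (h @ [(s, \<alpha>)]))) = ennreal ?m"
    using sum_emeasure_digit_prefix[of h s] by (simp add: paths.emeasure_eq_measure sum_nonneg)
  then have "(\<Sum>\<alpha>\<in>UNIV. measure paths (digit_prefix (h @ [(s, \<alpha>)]))) = ?m"
    by (simp add: sum_nonneg)
  then have "(\<Sum>\<alpha>\<in>UNIV. measure paths (digit_prefix (h @ [(s, \<alpha>)])) / ?m) = 1"
    using assms by (simp flip: sum_divide_distrib)
  then have "(\<integral>\<^sup>+\<alpha>. ennreal (measure paths (digit_prefix (h @ [(s, \<alpha>)])) / ?m) \<partial>count_space UNIV) = 1"
    by (simp add: nn_integral_count_space_finite sum_nonneg)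
  then show ?thesis
    using assms unfolding digit_scheduler_def by (simp add: pmf_embed_pmf)
qed

text \<open>An action in the support extends the history with positive probability, whereas disabled
  actions only occur on null events.\<close>

lemma valid_digit_scheduler: "valid_mdp_scheduler (digitization M \<delta>) digit_scheduler"
  unfolding valid_mdp_scheduler_def
proof (intro allI subsetI)
  fix h s \<alpha> assume \<alpha>: "\<alpha> \<in> set_pmf (digit_scheduler h s)"
  have "\<alpha> \<in> enabled (trans_prob M) s"
  proof (cases "measure paths (digit_prefix_state h s) = 0")
    case True
    then show ?thesis
      using \<alpha> someI_ex[of "\<lambda>\<alpha>. \<alpha> \<in> enabled (trans_prob M) s"] enabled_nonempty[of s]
      by (auto simp: digit_scheduler_def)
  next
    case False
    have "pmf (digit_scheduler h s) \<alpha> \<noteq> 0" using \<alpha> by (simp add: set_pmf_iff)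
    then have "measure paths (digit_prefix (h @ [(s, \<alpha>)])) \<noteq> 0"
      unfolding pmf_digit_scheduler[OF False] by simp
    then show ?thesis
      using emeasure_digit_prefix_disabled[of \<alpha> s h] unfolding measure_def by fastforce
  qed
  then show "\<alpha> \<in> enabled (mdp_prob (digitization M \<delta>)) s"
    by (simp add: digitization_def enabled_digit_prob[OF delta_pos])
qed

lemma distr_digit_scheduler:
  "distr paths (PiM UNIV (\<lambda>_. count_space UNIV)) digit = mdp_paths (digitization M \<delta>) digit_scheduler"
proof (rule distr_digit)
  fix h :: "('s \<times> 'a) list" and s \<alpha>
  show "emeasure paths (digit_prefix (h @ [(s, \<alpha>)])) = emeasure paths (digit_prefix_state h s) * ennreal (pmf (digit_scheduler h s) \<alpha>)"
  proof (cases "measure paths (digit_prefix_state h s) = 0")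
    case True
    then show ?thesis
      using emeasure_digit_prefix_snoc_le[of h s \<alpha>] by (simp add: paths.emeasure_eq_measure del: length_append)
  next
    case False
    then show ?thesis
      unfolding pmf_digit_scheduler[OF False] paths.emeasure_eq_measure by (simp flip: ennreal_mult)
  qed
qed

text \<open>The simulation consults \<open>\<sigma>'\<close> at block boundaries, the MDP at every
  position. At Markovian states this makes no difference, since one action is enabled; a
  probabilistic block has a single position, and there the digitized history is the expansion of the
  finished entries.\<close>

lemma distr_digit_simulated:
  assumes \<sigma>: "\<And>h s. \<sigma> h s = \<sigma>' (expand h) s" and valid: "valid_mdp_scheduler (digitization M \<delta>) \<sigma>'"
  shows "distr paths (PiM UNIV (\<lambda>_. count_space UNIV)) digit = mdp_paths (digitization M \<delta>) \<sigma>'"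
proof (rule distr_digit)
  fix h :: "('s \<times> 'a) list" and s \<alpha>
  let ?m = "length h"
  show "emeasure paths (digit_prefix (h @ [(s, \<alpha>)])) = emeasure paths (digit_prefix_state h s) * ennreal (pmf (\<sigma>' h s) \<alpha>)"
  proof (cases "s \<in> markov_states M")
    case True
    have "set_pmf (\<sigma>' h s) \<subseteq> {markov_act M}"
      using valid enabled_markov[OF True]
      by (auto simp: valid_mdp_scheduler_def digitization_def enabled_digit_prob[OF delta_pos])
    then have \<sigma>': "\<sigma>' h s = return_pmf (markov_act M)"
      by (simp add: set_pmf_subset_singleton)
    have "emeasure paths (digit_prefix (h @ [(s, \<alpha>')])) = 0" if "\<alpha>' \<noteq> markov_act M" for \<alpha>'
      using that enabled_markov[OF True] by (intro emeasure_digit_prefix_disabled) simp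
    moreover from this have "emeasure paths (digit_prefix_state h s) = emeasure paths (digit_prefix (h @ [(s, markov_act M)]))"
      unfolding sum_emeasure_digit_prefix[symmetric]
      by (subst sum.remove[of _ "markov_act M"]) (simp_all del: length_append)
    ultimately show ?thesis
      by (cases "\<alpha> = markov_act M") (simp_all add: \<sigma>' del: length_append)
  next
    case False
    \<comment> \<open>\<open>F \<omega> i\<close> depends only on the entries before
      \<open>i\<close>, and where it is nonzero the simulated scheduler takes the constant value
      \<open>\<sigma>' h s\<close>.\<close>
    define F :: "(nat \<Rightarrow> ('s, 'a) entry) \<Rightarrow> nat \<Rightarrow> ennreal" where
      "F \<omega> i = (if expanded \<omega> i = h then 1 else 0)" for \<omega> i
    have F: "(\<lambda>\<omega>. F \<omega> i) \<in> borel_measurable path_space" for i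
      unfolding F_def using measurable_digit_data[of "\<lambda>e _ _ _. if e = h then 1 else 0" i] by simp
    have F_cong: "F \<omega> i = F \<omega>' i" if "\<And>k. k < i \<Longrightarrow> \<omega> k = \<omega>' k" for \<omega> \<omega>' i
    proof -
      have "map \<omega> [0..<i] = map \<omega>' [0..<i]" by (rule map_upt_cong) (rule that)
      then show ?thesis by (simp only: F_def)
    qed
    have idx: "F \<omega> i * indicator {s} (state_of (\<omega> i)) = (if index \<omega> ?m = i then indicator (digit_prefix_state h s) \<omega> else 0)" for \<omega> i
    proof (cases "index \<omega> ?m = i \<and> state_of (\<omega> i) = s")
      case True
      then have "start \<omega> i = ?m" using \<open>s \<notin> markov_states M\<close>
        by (auto simp: index_eq_iff start_Suc copies_def)
      then have "map (digit \<omega>) [0..<?m] = expanded \<omega> i" using map_digit_start[of \<omega> i] by simp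
      then show ?thesis using True by (simp add: F_def indicator_def digit_def)
    next
      case False
      show ?thesis
      proof (cases "index \<omega> ?m = i")
        case True
        then show ?thesis using False by (simp add: digit_def)
      next
        case index: False
        have "expanded \<omega> i \<noteq> h"
        proof
          assume "expanded \<omega> i = h"
          then have "start \<omega> i = ?m" using length_expand[of \<omega> i] by simp
          then show False using index by (auto simp: index_eq_iff start_Suc)
        qed
        then show ?thesis using index by (simp add: F_def)
      qed
    qed
    have idx': "F \<omega> i * indicator {s} (state_of (\<omega> i)) * indicator {\<alpha>} (act_of (\<omega> i))
        = (if index \<omega> ?m = i then indicator (digit_prefix (h @ [(s, \<alpha>)])) \<omega> else 0)" for \<omega> i
      unfolding idx by (auto simp: indicator_def digit_def)
    have sums: "(\<Sum>i\<le>?m. if index \<omega> ?m = i then c else 0) = c" for \<omega> and c :: ennreal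
      using index_le[of \<omega> ?m] by simp
    have sched: "F \<omega> i * ennreal (pmf (\<sigma> (map \<omega> [0..<i]) s) \<alpha>) * c = F \<omega> i * c * ennreal (pmf (\<sigma>' h s) \<alpha>)" for \<omega> i c
      by (simp add: F_def \<sigma> mult.commute)
    have "emeasure paths (digit_prefix (h @ [(s, \<alpha>)])) = (\<integral>\<^sup>+\<omega>. indicator (digit_prefix (h @ [(s, \<alpha>)])) \<omega> \<partial>paths)"
      using sets_digit_prefix[of "h @ [(s, \<alpha>)]"] by simp
    also have "\<dots> = (\<integral>\<^sup>+\<omega>. (\<Sum>i\<le>?m. F \<omega> i * indicator {s} (state_of (\<omega> i)) * indicator {\<alpha>} (act_of (\<omega> i))) \<partial>paths)"
      by (simp only: sums idx')
    also have "\<dots> = (\<Sum>i\<le>?m. (\<integral>\<^sup>+\<omega>. F \<omega> i * indicator {s} (state_of (\<omega> i)) * indicator {\<alpha>} (act_of (\<omega> i)) \<partial>paths))"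
      by (intro nn_integral_sum measurable_paths borel_measurable_times_ennreal F) measurable
    also have "\<dots> = (\<Sum>i\<le>?m. (\<integral>\<^sup>+\<omega>. F \<omega> i * indicator {s} (state_of (\<omega> i)) * ennreal (pmf (\<sigma>' h s) \<alpha>) \<partial>paths))"
      by (simp only: nn_integral_action[OF F F_cong] sched)
    also have "\<dots> = (\<integral>\<^sup>+\<omega>. (\<Sum>i\<le>?m. F \<omega> i * indicator {s} (state_of (\<omega> i)) * ennreal (pmf (\<sigma>' h s) \<alpha>)) \<partial>paths)"
      by (intro nn_integral_sum[symmetric] measurable_paths borel_measurable_times_ennreal F) measurable
    also have "\<dots> = (\<integral>\<^sup>+\<omega>. indicator (digit_prefix_state h s) \<omega> * ennreal (pmf (\<sigma>' h s) \<alpha>) \<partial>paths)"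
      by (simp only: sum_distrib_right[symmetric] idx sums)
    also have "\<dots> = emeasure paths (digit_prefix_state h s) * ennreal (pmf (\<sigma>' h s) \<alpha>)"
      using sets_digit_prefix_state[of h s] by (simp add: nn_integral_multc)
    finally show ?thesis .
  qed
qed

end

subsection \<open>Rewards and reachability along digitized paths\<close>

lemma interval_meets_Bounded:
  "interval_set (Bounded a b) \<inter> {x .. x + t} \<noteq> {} \<longleftrightarrow> 0 \<le> t \<and> a \<le> b \<and> x \<le> b \<and> a \<le> x + t"
proof
  assume "0 \<le> t \<and> a \<le> b \<and> x \<le> b \<and> a \<le> x + t"
  then have "max a x \<in> interval_set (Bounded a b) \<inter> {x .. x + t}" by auto
  then show "interval_set (Bounded a b) \<inter> {x .. x + t} \<noteq> {}" by blast
qed auto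

lemma interval_meets_Unbounded:
  "interval_set (Unbounded a) \<inter> {x .. x + t} \<noteq> {} \<longleftrightarrow> 0 \<le> t \<and> a \<le> x + t"
proof
  assume "0 \<le> t \<and> a \<le> x + t"
  then have "x + t \<in> interval_set (Unbounded a) \<inter> {x .. x + t}" by auto
  then show "interval_set (Unbounded a) \<inter> {x .. x + t} \<noteq> {}" by blast
qed auto

lemma measurable_digit_steps:
  fixes M :: "('s::finite, 'a::finite) markov_automaton"
  shows "(\<lambda>\<omega>. digit_steps M \<omega> n) \<in> PiM UNIV (\<lambda>_. count_space UNIV) \<rightarrow>\<^sub>M count_space UNIV"
proof (induction n)
  case (Suc n)
  have "(\<lambda>\<omega>. if fst (\<omega> n) \<in> markov_states M then 1 else 0 :: nat)
      \<in> PiM UNIV (\<lambda>_. count_space (UNIV :: ('s \<times> 'a) set)) \<rightarrow>\<^sub>M count_space UNIV"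
    by (rule measurable_compose[where f = "\<lambda>\<omega>. \<omega> n" and g = "\<lambda>x. if fst x \<in> markov_states M then 1 else 0", OF measurable_component_singleton]) auto
  from measurable_nat_fun2[OF Suc this, of "(+)"] show ?case by (simp add: digit_steps_Suc)
qed (simp add: digit_steps_def)

lemma measurable_fst_component:
  fixes n :: nat
  shows "(\<lambda>\<omega>. fst (\<omega> n)) \<in> PiM UNIV (\<lambda>_. count_space (UNIV :: ('s \<times> 'a) set)) \<rightarrow>\<^sub>M count_space UNIV"
  by (rule measurable_compose[where f = "\<lambda>\<omega>. \<omega> n" and g = fst, OF measurable_component_singleton]) auto

lemma sets_reach_steps:
  fixes M :: "('s::finite, 'a::finite) markov_automaton"
  shows "reach_steps M J G \<in> sets (PiM UNIV (\<lambda>_. count_space UNIV))"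
proof -
  note [measurable] = measurable_digit_steps measurable_fst_component
  have "{\<omega> \<in> space (PiM UNIV (\<lambda>_. count_space (UNIV :: ('s \<times> 'a) set))). \<exists>n. fst (\<omega> n) \<in> G \<and> digit_steps M \<omega> n \<in> J}
      \<in> sets (PiM UNIV (\<lambda>_. count_space UNIV))"
    by measurable
  then show ?thesis by (simp add: reach_steps_def space_PiM)
qed

lemma borel_measurable_mdp_reward:
  fixes \<rho> :: "'s::finite \<Rightarrow> 'a::finite \<Rightarrow> real"
  shows "mdp_reward \<rho> G \<in> borel_measurable (PiM UNIV (\<lambda>_. count_space UNIV))"
proof -
  note [measurable] = measurable_fst_component
  have [measurable]: "(\<lambda>\<omega>. ennreal (\<rho> (fst (\<omega> i)) (snd (\<omega> i)))) \<in> borel_measurable (PiM UNIV (\<lambda>_. count_space UNIV))" for i :: nat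
    by (rule measurable_compose[where f = "\<lambda>\<omega>. \<omega> i" and g = "\<lambda>x. ennreal (\<rho> (fst x) (snd x))", OF measurable_component_singleton]) auto
  show ?thesis unfolding mdp_reward_def[abs_def] by measurable
qed

context scheduled_markov_automaton
begin

lemma measurable_elapsed [measurable]: "(\<lambda>\<omega>. elapsed \<omega> n) \<in> borel_measurable path_space"
  unfolding elapsed_def by measurable

lemma elapsed_Suc: "elapsed \<omega> (Suc n) = elapsed \<omega> n + time_of (\<omega> n)"
  by (simp add: elapsed_def)

lemma sets_reach_within: "(reach_within I G :: (nat \<Rightarrow> ('s, 'a) entry) set) \<in> sets path_space"
proof -
  have "{\<omega> \<in> space path_space :: (nat \<Rightarrow> ('s, 'a) entry) set. \<exists>n. state_of (\<omega> n) \<in> G \<and>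
      interval_set I \<inter> {elapsed \<omega> n .. elapsed \<omega> n + time_of (\<omega> n)} \<noteq> {}} \<in> sets path_space"
    by (cases I) (simp_all only: interval_meets_Bounded interval_meets_Unbounded, measurable)
  then show ?thesis by (simp add: reach_within_def)
qed

lemma sets_digit_reach: "{\<omega>. digit \<omega> \<in> reach_steps M J G} \<in> sets path_space"
  using measurable_sets[OF measurable_digit sets_reach_steps[of M J G]] by (simp add: vimage_def)

lemma measure_mdp_reach_steps:
  assumes "distr paths (PiM UNIV (\<lambda>_. count_space UNIV)) digit = mdp_paths D \<sigma>'"
  shows "measure (mdp_paths D \<sigma>') (reach_steps M J G) = measure paths {\<omega>. digit \<omega> \<in> reach_steps M J G}"
  unfolding assms[symmetric]
  by (subst measure_distr[OF measurable_paths[OF measurable_digit] sets_reach_steps]) (simp add: vimage_def)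

text \<open>Resampling the sojourn time in step \<open>i\<close>, the expected number of copies \<open>1 / (1 - exp (- E \<delta>))\<close>
  cancels the factor by which digitization scales down the reward of a Markovian state.\<close>

lemma nn_integral_mdp_reward:
  assumes eq: "distr paths (PiM UNIV (\<lambda>_. count_space UNIV)) digit = mdp_paths D \<sigma>'"
    and \<rho>: "\<rho> \<in> set (reward_funs M)"
  shows "(\<integral>\<^sup>+\<omega>. mdp_reward (digit_reward M \<delta> \<rho>) G \<omega> \<partial>mdp_paths D \<sigma>') = (\<integral>\<^sup>+\<omega>. ma_reward \<rho> G \<omega> \<partial>paths)"
proof -
  \<comment> \<open>Avoiding \<open>G\<close> up to and including entry \<open>i\<close> is a matter
    of states, so this factor survives redrawing the sojourn time of entry \<open>i\<close>.\<close>
  define C :: "nat \<Rightarrow> (nat \<Rightarrow> ('s, 'a) entry) \<Rightarrow> ennreal" where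
    "C i \<omega> = (if \<forall>k\<le>i. state_of (\<omega> k) \<notin> G then 1 else 0)" for i \<omega>
  have C [measurable]: "C i \<in> borel_measurable path_space" for i
    unfolding C_def[abs_def] by measurable
  have C_cong: "C i \<omega> = C i \<omega>'" if "\<And>k. k \<le> i \<Longrightarrow> state_of (\<omega> k) = state_of (\<omega>' k)" for i \<omega> \<omega>'
    using that by (auto simp: C_def)
  have C_upd: "C i (fun_upd \<omega> i (state_of (\<omega> i), \<alpha>, t)) = C i \<omega>" for i \<omega> \<alpha> t
    by (rule C_cong) simp
  have [measurable]: "(\<lambda>\<omega>. f (state_of (\<omega> i)) (act_of (\<omega> i))) \<in> borel_measurable path_space" for f :: "'s \<Rightarrow> 'a \<Rightarrow> real" and i
    using measurable_compose[OF measurable_compose[OF measurable_path_component measurable_state_act], of "\<lambda>(s, \<alpha>). f s \<alpha>" borel i]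
    by (simp add: split_beta')
  have rho: "0 \<le> \<rho> x" for x using reward_nonneg[OF \<rho>] .
  \<comment> \<open>The expected reward of one entry given its state and action, the common value of
    both sides: a Markovian state is occupied for \<open>1 / exit_rate M s\<close> on
    average.\<close>
  define w where "w s \<alpha> = \<rho> (Inr (s, \<alpha>)) + (if s \<in> markov_states M then \<rho> (Inl s) / exit_rate M s else 0)" for s \<alpha>
  have dig: "(\<integral>\<^sup>+\<omega>. C i \<omega> * (of_nat (copies (\<omega> i)) * ennreal (digit_reward M \<delta> \<rho> (state_of (\<omega> i)) (act_of (\<omega> i)))) \<partial>paths)
      = (\<integral>\<^sup>+\<omega>. C i \<omega> * ennreal (w (state_of (\<omega> i)) (act_of (\<omega> i))) \<partial>paths)" for i
  proof -
    have "(\<integral>\<^sup>+\<omega>. C i \<omega> * (of_nat (copies (\<omega> i)) * ennreal (digit_reward M \<delta> \<rho> (state_of (\<omega> i)) (act_of (\<omega> i)))) \<partial>paths)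
      = (\<integral>\<^sup>+\<omega>. (\<integral>\<^sup>+t. C i \<omega> * (of_nat (copies (state_of (\<omega> i), act_of (\<omega> i), t)) * ennreal (digit_reward M \<delta> \<rho> (state_of (\<omega> i)) (act_of (\<omega> i)))) \<partial>sojourn M (state_of (\<omega> i))) \<partial>paths)"
    proof (subst nn_integral_resample[where n = i])
      show "(\<lambda>\<omega>. C i \<omega> * (of_nat (copies (\<omega> i)) * ennreal (digit_reward M \<delta> \<rho> (state_of (\<omega> i)) (act_of (\<omega> i))))) \<in> borel_measurable path_space"
        by measurable
      show "C i \<omega> * (of_nat (copies (\<omega> i)) * ennreal (digit_reward M \<delta> \<rho> (state_of (\<omega> i)) (act_of (\<omega> i)))) =
        C i \<omega>' * (of_nat (copies (\<omega>' i)) * ennreal (digit_reward M \<delta> \<rho> (state_of (\<omega>' i)) (act_of (\<omega>' i))))"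
        if "\<And>k. k \<le> i \<Longrightarrow> \<omega> k = \<omega>' k" for \<omega> \<omega>'
        using that C_cong[of i \<omega> \<omega>'] by simp
    qed (simp add: C_upd)
    also have "\<dots> = (\<integral>\<^sup>+\<omega>. C i \<omega> * ennreal (w (state_of (\<omega> i)) (act_of (\<omega> i))) \<partial>paths)"
    \<comment> \<open>At Markovian states \<open>digit_reward\<close> is 0 for actions other than
      \<open>markov_act M\<close>, so the equality is claimed for paths with enabled
      actions.\<close>
    proof (rule nn_integral_cong_AE)
      show "AE \<omega> in paths. (\<integral>\<^sup>+t. C i \<omega> * (of_nat (copies (state_of (\<omega> i), act_of (\<omega> i), t)) * ennreal (digit_reward M \<delta> \<rho> (state_of (\<omega> i)) (act_of (\<omega> i)))) \<partial>sojourn M (state_of (\<omega> i)))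
          = C i \<omega> * ennreal (w (state_of (\<omega> i)) (act_of (\<omega> i)))"
        using AE_regular
      proof eventually_elim
        case (elim \<omega>)
        let ?s = "state_of (\<omega> i)" and ?a = "act_of (\<omega> i)"
        have "(\<integral>\<^sup>+t. C i \<omega> * (of_nat (copies (?s, ?a, t)) * ennreal (digit_reward M \<delta> \<rho> ?s ?a)) \<partial>sojourn M ?s)
          = C i \<omega> * ((\<integral>\<^sup>+t. of_nat (copies (?s, ?a, t)) \<partial>sojourn M ?s) * ennreal (digit_reward M \<delta> \<rho> ?s ?a))"
          using measurable_copies_sojourn[of ?s ?a]
          by (subst nn_integral_cmult) (auto simp: nn_integral_multc)
        also have "(\<integral>\<^sup>+t. of_nat (copies (?s, ?a, t)) \<partial>sojourn M ?s) * ennreal (digit_reward M \<delta> \<rho> ?s ?a) = ennreal (w ?s ?a)"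
        proof (cases "?s \<in> markov_states M")
          case True
          then have a: "?a = markov_act M" and ps: "?s \<notin> prob_states M"
            using elim enabled_markov[OF True] maximal_progress by auto
          have "ennreal (1 / (1 - exp (- exit_rate M ?s * \<delta>))) * ennreal (digit_reward M \<delta> \<rho> ?s ?a) = ennreal (w ?s ?a)"
            using True a ps exit_rate_pos[OF True] delta_pos by (simp add: ennreal_mult'[symmetric] digit_reward_def w_def)
          then show ?thesis by (simp only: nn_integral_sojourn_copies[OF True])
        next
          case False
          then have "?s \<in> prob_states M" using no_terminal by auto
          then show ?thesis
            using False by (simp add: copies_def digit_reward_def w_def)
        qed
        finally show ?case .
      qed
    qed
    finally show ?thesis .
  qed
  have ma: "(\<integral>\<^sup>+\<omega>. C i \<omega> * ennreal (\<rho> (Inl (state_of (\<omega> i))) * time_of (\<omega> i) + \<rho> (Inr (state_of (\<omega> i), act_of (\<omega> i)))) \<partial>paths)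
      = (\<integral>\<^sup>+\<omega>. C i \<omega> * ennreal (w (state_of (\<omega> i)) (act_of (\<omega> i))) \<partial>paths)" for i
  proof -
    have "(\<integral>\<^sup>+\<omega>. C i \<omega> * ennreal (\<rho> (Inl (state_of (\<omega> i))) * time_of (\<omega> i) + \<rho> (Inr (state_of (\<omega> i), act_of (\<omega> i)))) \<partial>paths)
      = (\<integral>\<^sup>+\<omega>. (\<integral>\<^sup>+t. C i \<omega> * ennreal (\<rho> (Inl (state_of (\<omega> i))) * t + \<rho> (Inr (state_of (\<omega> i), act_of (\<omega> i)))) \<partial>sojourn M (state_of (\<omega> i))) \<partial>paths)"
    proof (subst nn_integral_resample[where n = i])
      show "(\<lambda>\<omega>. C i \<omega> * ennreal (\<rho> (Inl (state_of (\<omega> i))) * time_of (\<omega> i) + \<rho> (Inr (state_of (\<omega> i), act_of (\<omega> i))))) \<in> borel_measurable path_space"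
        by measurable
      show "C i \<omega> * ennreal (\<rho> (Inl (state_of (\<omega> i))) * time_of (\<omega> i) + \<rho> (Inr (state_of (\<omega> i), act_of (\<omega> i)))) =
        C i \<omega>' * ennreal (\<rho> (Inl (state_of (\<omega>' i))) * time_of (\<omega>' i) + \<rho> (Inr (state_of (\<omega>' i), act_of (\<omega>' i))))"
        if "\<And>k. k \<le> i \<Longrightarrow> \<omega> k = \<omega>' k" for \<omega> \<omega>'
        using that C_cong[of i \<omega> \<omega>'] by simp
    qed (simp add: C_upd)
    also have "\<dots> = (\<integral>\<^sup>+\<omega>. C i \<omega> * ennreal (w (state_of (\<omega> i)) (act_of (\<omega> i))) \<partial>paths)"
    proof (rule nn_integral_cong)
      fix \<omega> :: "nat \<Rightarrow> ('s, 'a) entry"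
      let ?s = "state_of (\<omega> i)" and ?a = "act_of (\<omega> i)"
      have "(\<integral>\<^sup>+t. C i \<omega> * ennreal (\<rho> (Inl ?s) * t + \<rho> (Inr (?s, ?a))) \<partial>sojourn M ?s)
        = C i \<omega> * (\<integral>\<^sup>+t. ennreal (\<rho> (Inl ?s) * t + \<rho> (Inr (?s, ?a))) \<partial>sojourn M ?s)"
        by (rule nn_integral_cmult) measurable
      also have "(\<integral>\<^sup>+t. ennreal (\<rho> (Inl ?s) * t + \<rho> (Inr (?s, ?a))) \<partial>sojourn M ?s)
          = (\<integral>\<^sup>+t. ennreal (\<rho> (Inl ?s)) * ennreal t + ennreal (\<rho> (Inr (?s, ?a))) \<partial>sojourn M ?s)"
        using AE_sojourn[of ?s]
        by (intro nn_integral_cong_AE) (auto simp: ennreal_plus ennreal_mult rho elim!: eventually_mono)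
      also have "\<dots> = ennreal (\<rho> (Inl ?s)) * (\<integral>\<^sup>+t. ennreal t \<partial>sojourn M ?s) + ennreal (\<rho> (Inr (?s, ?a)))"
        by (subst nn_integral_add) (auto simp: nn_integral_cmult)
      also have "\<dots> = ennreal (w ?s ?a)"
        using exit_rate_pos[of ?s] rho
        by (auto simp: nn_integral_sojourn_time w_def ennreal_mult[symmetric] ennreal_plus[symmetric] add.commute simp del: ennreal_plus)
      finally show "(\<integral>\<^sup>+t. C i \<omega> * ennreal (\<rho> (Inl ?s) * t + \<rho> (Inr (?s, ?a))) \<partial>sojourn M ?s) = C i \<omega> * ennreal (w ?s ?a)" .
    qed
    finally show ?thesis .
  qed
  have "(\<integral>\<^sup>+\<omega>. mdp_reward (digit_reward M \<delta> \<rho>) G \<omega> \<partial>mdp_paths D \<sigma>') = (\<integral>\<^sup>+\<omega>. mdp_reward (digit_reward M \<delta> \<rho>) G (digit \<omega>) \<partial>paths)"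
    unfolding eq[symmetric]
    by (rule nn_integral_distr) (simp_all add: measurable_paths[OF measurable_digit] borel_measurable_mdp_reward)
  also have "\<dots> = (\<integral>\<^sup>+\<omega>. (\<Sum>i. C i \<omega> * (of_nat (copies (\<omega> i)) * ennreal (digit_reward M \<delta> \<rho> (state_of (\<omega> i)) (act_of (\<omega> i))))) \<partial>paths)"
    unfolding mdp_reward_digit by (intro nn_integral_cong suminf_cong) (auto simp: C_def)
  also have "\<dots> = (\<Sum>i. \<integral>\<^sup>+\<omega>. C i \<omega> * (of_nat (copies (\<omega> i)) * ennreal (digit_reward M \<delta> \<rho> (state_of (\<omega> i)) (act_of (\<omega> i)))) \<partial>paths)"
    by (intro nn_integral_suminf measurable_paths) measurable
  also have "\<dots> = (\<Sum>i. \<integral>\<^sup>+\<omega>. C i \<omega> * ennreal (\<rho> (Inl (state_of (\<omega> i))) * time_of (\<omega> i) + \<rho> (Inr (state_of (\<omega> i), act_of (\<omega> i)))) \<partial>paths)"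
    by (simp only: dig ma)
  also have "\<dots> = (\<integral>\<^sup>+\<omega>. (\<Sum>i. C i \<omega> * ennreal (\<rho> (Inl (state_of (\<omega> i))) * time_of (\<omega> i) + \<rho> (Inr (state_of (\<omega> i), act_of (\<omega> i))))) \<partial>paths)"
    by (intro nn_integral_suminf[symmetric] measurable_paths) measurable
  also have "\<dots> = (\<integral>\<^sup>+\<omega>. ma_reward \<rho> G \<omega> \<partial>paths)"
    unfolding ma_reward_def by (intro nn_integral_cong suminf_cong) (auto simp: C_def)
  finally show ?thesis .
qed

end

subsection \<open>Error probabilities\<close>

text \<open>By induction, since \<open>a * q ^ k\<close> is at most \<open>(q + b) * q ^ k\<close>.
  For \<open>a = q + b\<close> it is the factorization of \<open>a ^ k - q ^ k\<close>. It is
  applied with \<open>a = 1 + l * \<delta>\<close>, \<open>b = E * \<delta>\<close> and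
  \<open>q = exp ((l - E) * \<delta>)\<close>, which is 1 if \<open>E = l\<close>.\<close>

lemma geometric_potential_bound:
  fixes a b q :: real
  assumes "0 \<le> q" "0 \<le> a" "a \<le> q + b"
  shows "a ^ k \<le> (\<Sum>j<k. a ^ (k - Suc j) * (b * q ^ j)) + q ^ k"
proof (induction k)
  case (Suc k)
  have "(\<Sum>j<k. a ^ (Suc k - Suc j) * (b * q ^ j)) = a * (\<Sum>j<k. a ^ (k - Suc j) * (b * q ^ j))"
    unfolding sum_distrib_left
    by (intro sum.cong refl) (simp add: Suc_diff_Suc mult.assoc flip: power_Suc)
  then have eq: "(\<Sum>j<Suc k. a ^ (Suc k - Suc j) * (b * q ^ j)) + q ^ Suc k
      = a * (\<Sum>j<k. a ^ (k - Suc j) * (b * q ^ j)) + (q + b) * q ^ k"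
    by (simp add: algebra_simps)
  have "a ^ Suc k \<le> a * ((\<Sum>j<k. a ^ (k - Suc j) * (b * q ^ j)) + q ^ k)"
    using Suc assms by (simp add: mult_left_mono)
  also have "\<dots> \<le> a * (\<Sum>j<k. a ^ (k - Suc j) * (b * q ^ j)) + (q + b) * q ^ k"
    using assms mult_right_mono[of a "q + b" "q ^ k"] by (simp add: algebra_simps)
  finally show ?case unfolding eq .
qed simp

context scheduled_markov_automaton
begin

abbreviation regular :: "(nat \<Rightarrow> ('s, 'a) entry) \<Rightarrow> bool" where
  "regular \<omega> \<equiv> \<forall>n. act_of (\<omega> n) \<in> enabled (trans_prob M) (state_of (\<omega> n)) \<and> 0 \<le> time_of (\<omega> n)
     \<and> (state_of (\<omega> n) \<notin> markov_states M \<longrightarrow> time_of (\<omega> n) = 0)"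

section \<open>Real time against the digital clock\<close>

lemma exit_rate_le_max_rate: "s \<in> markov_states M \<Longrightarrow> exit_rate M s \<le> max_rate M"
  unfolding max_rate_def by (intro Max_ge) auto

lemma elapsed_nonneg: "regular \<omega> \<Longrightarrow> 0 \<le> elapsed \<omega> n"
  unfolding elapsed_def by (intro sum_nonneg) simp

lemma elapsed_mono: "regular \<omega> \<Longrightarrow> m \<le> n \<Longrightarrow> elapsed \<omega> m \<le> elapsed \<omega> n"
  unfolding elapsed_def by (intro sum_mono2) auto

lemma time_less_copies:
  assumes "s \<in> markov_states M" "0 \<le> t"
  shows "t < real (copies (s, \<alpha>, t)) * \<delta>"
  using less_copies_iff[of t "copies (s, \<alpha>, t)" s \<alpha>] assms by simp

text \<open>Every Markovian sojourn is rounded up strictly, so the digital clock is ahead once a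
  step has been made. The strict version excludes entries that begin exactly at a time bound after
  too few steps.\<close>

lemma elapsed_le_steps:
  assumes "regular \<omega>"
  shows "elapsed \<omega> n \<le> real (steps_before \<omega> n) * \<delta>"
    and "0 < steps_before \<omega> n \<Longrightarrow> elapsed \<omega> n < real (steps_before \<omega> n) * \<delta>"
proof -
  have "elapsed \<omega> n \<le> real (steps_before \<omega> n) * \<delta> \<and> (0 < steps_before \<omega> n \<longrightarrow> elapsed \<omega> n < real (steps_before \<omega> n) * \<delta>)"
  proof (induction n)
    case 0
    then show ?case by (simp add: elapsed_def)
  next
    case (Suc n)
    show ?case
    proof (cases "state_of (\<omega> n) \<in> markov_states M")
      case True
      then have "time_of (\<omega> n) < real (copies (\<omega> n)) * \<delta>"
        using time_less_copies[of "state_of (\<omega> n)" "time_of (\<omega> n)" "act_of (\<omega> n)"] assms by simp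
      then show ?thesis
        using Suc True by (simp add: elapsed_Suc steps_before_Suc distrib_right)
    next
      case False
      then show ?thesis
        using Suc assms by (simp add: elapsed_Suc steps_before_Suc)
    qed
  qed
  then show "elapsed \<omega> n \<le> real (steps_before \<omega> n) * \<delta>"
    and "0 < steps_before \<omega> n \<Longrightarrow> elapsed \<omega> n < real (steps_before \<omega> n) * \<delta>" by auto
qed

text \<open>One sojourn of the submartingale, with \<open>k\<close> steps and time \<open>r\<close>
  left and \<open>f t\<close> the potential after a sojourn of length \<open>t\<close>. A jump in
  period \<open>j\<close> uses \<open>j + 1\<close> steps, a sojourn beyond \<open>r\<close> is
  safe, and a jump between \<open>real k * \<delta>\<close> and \<open>r\<close> uses too many steps
  and adds nothing to the bound.\<close>

lemma nn_integral_sojourn_potential: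
  fixes l r :: real
  assumes s: "s \<in> markov_states M" and l: "exit_rate M s \<le> l" and r: "real k * \<delta> \<le> r"
    and jump: "\<And>j t. j < k \<Longrightarrow> real j * \<delta> \<le> t \<Longrightarrow> t < real (Suc j) * \<delta>
      \<Longrightarrow> ennreal ((1 + l * \<delta>) ^ (k - Suc j) * exp (- l * (r - t))) \<le> f t"
    and late: "\<And>t. r < t \<Longrightarrow> 1 \<le> f t"
  shows "ennreal ((1 + l * \<delta>) ^ k * exp (- l * r)) \<le> (\<integral>\<^sup>+t. f t \<partial>sojourn M s)"
proof -
  let ?E = "exit_rate M s"
  define a where "a = 1 + l * \<delta>"
  define q where "q = exp ((l - ?E) * \<delta>)"
  have E: "0 < ?E" by (rule exit_rate_pos[OF s])
  have a: "0 < a" unfolding a_def using l E delta_pos by (simp add: add_pos_nonneg)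
  have r0: "0 \<le> r" using r delta_pos by (rule_tac order_trans[of _ "real k * \<delta>"]) auto
  define B where "B j = {real j * \<delta>..<real (Suc j) * \<delta>}" for j
  define g where "g j t = ennreal (a ^ (k - Suc j) * exp (- l * (r - t))) * indicator (B j) t" for j t
  have g_meas: "g j \<in> borel_measurable borel" for j
    unfolding g_def[abs_def] B_def by measurable
  have B_unique: "i = j" if "t \<in> B i" "t \<in> B j" for i j t
  proof -
    have "real i \<le> t / \<delta>" "t / \<delta> < real i + 1" "real j \<le> t / \<delta>" "t / \<delta> < real j + 1"
      using that delta_pos by (auto simp: B_def field_simps)
    then have "\<lfloor>t / \<delta>\<rfloor> = int i" "\<lfloor>t / \<delta>\<rfloor> = int j" by linarith+
    then show ?thesis by simp
  qed
  \<comment> \<open>Density times potential is proportional to \<open>exp ((l - ?E) * t)\<close>,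
    which is nondecreasing because \<open>?E \<le> l\<close>. On period \<open>j\<close> it is at
    least its value \<open>q ^ j\<close> at the left end, and the period has length
    \<delta>.\<close>
  have g_int: "ennreal (a ^ (k - Suc j) * exp (- l * r) * ((?E * \<delta>) * q ^ j)) \<le> (\<integral>\<^sup>+t. g j t \<partial>sojourn M s)" for j
  proof -
    have "ennreal (a ^ (k - Suc j) * exp (- l * r) * ((?E * \<delta>) * q ^ j))
        = (\<integral>\<^sup>+t. ennreal (a ^ (k - Suc j) * exp (- l * r) * (?E * q ^ j)) * indicator (B j) t \<partial>lborel)"
    proof -
      have "emeasure lborel (B j) = ennreal \<delta>"
        unfolding B_def using delta_pos by (simp add: distrib_right)
      moreover have "(\<integral>\<^sup>+t. ennreal (a ^ (k - Suc j) * exp (- l * r) * (?E * q ^ j)) * indicator (B j) t \<partial>lborel)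
          = ennreal (a ^ (k - Suc j) * exp (- l * r) * (?E * q ^ j)) * emeasure lborel (B j)"
        by (rule nn_integral_cmult_indicator) (simp add: B_def)
      ultimately show ?thesis
        using delta_pos by (simp add: ennreal_mult' mult_ac)
    qed
    also have "\<dots> \<le> (\<integral>\<^sup>+t. ennreal (exponential_density ?E t) * g j t \<partial>lborel)"
    proof (rule nn_integral_mono)
      fix t
      show "ennreal (a ^ (k - Suc j) * exp (- l * r) * (?E * q ^ j)) * indicator (B j) t \<le> ennreal (exponential_density ?E t) * g j t"
      proof (cases "t \<in> B j")
        case True
        then have t: "real j * \<delta> \<le> t" by (simp add: B_def)
        have t0: "0 \<le> t" using t delta_pos by (rule_tac order_trans[of _ "real j * \<delta>"]) auto
        have "q ^ j = exp ((l - ?E) * (real j * \<delta>))"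
          unfolding q_def exp_of_nat_mult[symmetric] by (rule arg_cong[where f = exp]) simp
        also have "\<dots> \<le> exp ((l - ?E) * t)"
          using t l by (simp add: mult_left_mono)
        finally have q: "q ^ j \<le> exp ((l - ?E) * t)" .
        have "a ^ (k - Suc j) * exp (- l * r) * (?E * q ^ j) \<le> a ^ (k - Suc j) * exp (- l * r) * (?E * exp ((l - ?E) * t))"
          using q a E by (intro mult_left_mono) auto
        also have "\<dots> = (?E * exp (- t * ?E)) * (a ^ (k - Suc j) * exp (- l * (r - t)))"
          by (simp add: algebra_simps flip: exp_add)
        finally have "ennreal (a ^ (k - Suc j) * exp (- l * r) * (?E * q ^ j)) \<le> ennreal (?E * exp (- t * ?E)) * ennreal (a ^ (k - Suc j) * exp (- l * (r - t)))"
          using a E by (simp add: ennreal_mult[symmetric] ennreal_leI)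
        then show ?thesis
          using True t0 by (simp add: g_def exponential_density_def)
      qed simp
    qed
    also have "\<dots> = (\<integral>\<^sup>+t. g j t \<partial>sojourn M s)"
      using s g_meas by (simp add: sojourn_def nn_integral_density)
    finally show ?thesis .
  qed
  have "a ^ k \<le> (\<Sum>j<k. a ^ (k - Suc j) * ((?E * \<delta>) * q ^ j)) + q ^ k"
  proof (rule geometric_potential_bound)
    \<comment> \<open>Splitting off the rate \<open>?E\<close> leaves
      \<open>1 + (l - ?E) * \<delta>\<close>, which is at most \<open>q\<close> by
      \<open>1 + x \<le> exp x\<close>.\<close>
    have "a = (1 + (l - ?E) * \<delta>) + ?E * \<delta>" by (simp add: a_def algebra_simps)
    also have "\<dots> \<le> q + ?E * \<delta>" unfolding q_def by (simp add: exp_ge_add_one_self)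
    finally show "a \<le> q + ?E * \<delta>" .
  qed (use a in \<open>simp_all add: q_def\<close>)
  then have "a ^ k * exp (- l * r) \<le> ((\<Sum>j<k. a ^ (k - Suc j) * ((?E * \<delta>) * q ^ j)) + q ^ k) * exp (- l * r)"
    by (intro mult_right_mono) auto
  also have "\<dots> = (\<Sum>j<k. a ^ (k - Suc j) * exp (- l * r) * ((?E * \<delta>) * q ^ j)) + q ^ k * exp (- l * r)"
    unfolding distrib_right sum_distrib_right by (simp add: mult_ac)
  \<comment> \<open>The right side is the probability of a sojourn beyond \<open>r\<close>; it
    dominates the last term because \<open>real k * \<delta> \<le> r\<close>.\<close>
  also have "q ^ k * exp (- l * r) \<le> exp (- ?E * r)"
  proof -
    have "q ^ k = exp ((l - ?E) * (real k * \<delta>))"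
      unfolding q_def exp_of_nat_mult[symmetric] by (rule arg_cong[where f = exp]) simp
    also have "\<dots> \<le> exp ((l - ?E) * r)"
      using r l by (simp add: mult_left_mono)
    finally have "q ^ k * exp (- l * r) \<le> exp ((l - ?E) * r) * exp (- l * r)"
      by (intro mult_right_mono) auto
    then show ?thesis by (simp add: algebra_simps flip: exp_add)
  qed
  finally have "ennreal (a ^ k * exp (- l * r)) \<le> ennreal ((\<Sum>j<k. a ^ (k - Suc j) * exp (- l * r) * ((?E * \<delta>) * q ^ j)) + exp (- ?E * r))"
    by (intro ennreal_leI) simp
  also have "\<dots> = (\<Sum>j<k. ennreal (a ^ (k - Suc j) * exp (- l * r) * ((?E * \<delta>) * q ^ j))) + ennreal (exp (- ?E * r))"
    using a E delta_pos by (subst ennreal_plus) (auto intro!: sum_nonneg simp: q_def)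
  also have "\<dots> \<le> (\<Sum>j<k. \<integral>\<^sup>+t. g j t \<partial>sojourn M s) + emeasure (sojourn M s) {r<..}"
    using emeasure_sojourn_atLeast(2)[OF s r0] by (intro add_mono sum_mono g_int) simp
  also have "\<dots> = (\<integral>\<^sup>+t. (\<Sum>j<k. g j t) + indicator {r<..} t \<partial>sojourn M s)"
    using g_meas by (subst nn_integral_add) (auto simp: nn_integral_sum)
  also have "\<dots> \<le> (\<integral>\<^sup>+t. f t \<partial>sojourn M s)"
  proof (rule nn_integral_mono)
    fix t
    show "(\<Sum>j<k. g j t) + indicator {r<..} t \<le> f t"
    proof (cases "\<exists>j<k. t \<in> B j")
      case True
      then obtain j where j: "j < k" "t \<in> B j" by blast
      have "(\<Sum>i<k. g i t) = (\<Sum>i\<in>{j}. g i t)"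
        using j B_unique by (intro sum.mono_neutral_right) (auto simp: g_def indicator_def)
      moreover have "t \<le> r"
      proof -
        have "t < real (Suc j) * \<delta>" using j by (simp add: B_def)
        also have "\<dots> \<le> real k * \<delta>" using j delta_pos by (intro mult_right_mono) auto
        finally show ?thesis using r by simp
      qed
      moreover have "g j t \<le> f t"
        using jump[of j t] j by (simp add: g_def B_def a_def)
      ultimately show ?thesis by simp
    next
      case False
      then have "(\<Sum>j<k. g j t) = 0" by (auto simp: g_def)
      then show ?thesis using late[of t] by (simp add: indicator_def)
    qed
  qed
  finally show ?thesis by (simp add: a_def)
qed

text \<open>The bound \<open>m \<le> n\<close> remembers the event: elapsed time may pass the limit
  later, so the condition at \<open>n\<close> alone would not be monotone in
  \<open>n\<close>.\<close>

definition crowded :: "nat \<Rightarrow> nat \<Rightarrow> (nat \<Rightarrow> ('s, 'a) entry) \<Rightarrow> bool" where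
  "crowded k n \<omega> \<longleftrightarrow> (\<exists>m\<le>n. elapsed \<omega> m \<le> real k * \<delta> \<and> k < steps_before \<omega> m)"

text \<open>A lower bound for the conditional probability of never becoming crowded, given the first \<open>n\<close>
  entries. The resulting process is a submartingale.\<close>

definition potential :: "nat \<Rightarrow> nat \<Rightarrow> (nat \<Rightarrow> ('s, 'a) entry) \<Rightarrow> real" where
  "potential k n \<omega> =
     (if crowded k n \<omega> then 0
      else if real k * \<delta> < elapsed \<omega> n then 1
      else (1 + max_rate M * \<delta>) ^ (k - steps_before \<omega> n) * exp (- max_rate M * (real k * \<delta> - elapsed \<omega> n)))"

lemma measurable_crowded [measurable]: "Measurable.pred path_space (crowded k n)"
  unfolding crowded_def[abs_def] by measurable

lemma measurable_potential [measurable]: "potential k n \<in> borel_measurable path_space"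
proof -
  have [measurable]: "(\<lambda>\<omega>. (1 + max_rate M * \<delta>) ^ (k - steps_before \<omega> n)) \<in> borel_measurable path_space"
    by (rule measurable_compose[OF measurable_steps_before]) simp
  show ?thesis unfolding potential_def[abs_def] by measurable
qed

lemma elapsed_cong: "(\<And>i. i < n \<Longrightarrow> \<omega> i = \<omega>' i) \<Longrightarrow> elapsed \<omega> n = elapsed \<omega>' n"
  by (simp add: elapsed_def)

lemma steps_before_cong: "(\<And>i. i < n \<Longrightarrow> \<omega> i = \<omega>' i) \<Longrightarrow> steps_before \<omega> n = steps_before \<omega>' n"
  unfolding steps_before_def by (intro sum.cong) auto

lemma crowded_cong:
  assumes "\<And>i. i < n \<Longrightarrow> \<omega> i = \<omega>' i"
  shows "crowded k n \<omega> = crowded k n \<omega>'"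
proof -
  have "elapsed \<omega> m = elapsed \<omega>' m \<and> steps_before \<omega> m = steps_before \<omega>' m" if "m \<le> n" for m
    using assms that by (auto intro!: elapsed_cong steps_before_cong)
  then show ?thesis by (auto simp: crowded_def)
qed

lemma potential_cong: "(\<And>i. i < n \<Longrightarrow> \<omega> i = \<omega>' i) \<Longrightarrow> potential k n \<omega> = potential k n \<omega>'"
  unfolding potential_def using crowded_cong[of n \<omega> \<omega>' k] elapsed_cong[of n \<omega> \<omega>'] steps_before_cong[of n \<omega> \<omega>'] by simp

lemma crowded_Suc: "crowded k (Suc n) \<omega> \<longleftrightarrow> crowded k n \<omega> \<or> elapsed \<omega> (Suc n) \<le> real k * \<delta> \<and> k < steps_before \<omega> (Suc n)"
  unfolding crowded_def by (auto simp: le_Suc_eq)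

text \<open>Once crowded, the value 0 is trivial. Otherwise only a Markovian sojourn begun by time
  \<open>real k * \<delta>\<close> matters: a probabilistic entry changes neither clock, and after
  that time a path that is not crowded stays so, with potential 1.\<close>

lemma potential_le_resampled:
  assumes \<omega>: "regular \<omega>"
  shows "ennreal (potential k n \<omega>) \<le>
    (\<integral>\<^sup>+t. ennreal (potential k (Suc n) (fun_upd \<omega> n (state_of (\<omega> n), act_of (\<omega> n), t))) \<partial>sojourn M (state_of (\<omega> n)))"
    (is "_ \<le> (\<integral>\<^sup>+t. ennreal (potential k (Suc n) (?\<omega> t)) \<partial>_)")
proof (cases "crowded k n \<omega>")
  case True
  then show ?thesis by (simp add: potential_def)
next
  case not_crowded: False
  let ?s = "state_of (\<omega> n)" and ?a = "act_of (\<omega> n)"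
  have el: "elapsed (?\<omega> t) (Suc n) = elapsed \<omega> n + t" for t
    using elapsed_cong[of n "?\<omega> t" \<omega>] by (simp add: elapsed_Suc)
  have st: "steps_before (?\<omega> t) (Suc n) = steps_before \<omega> n + (if ?s \<in> markov_states M then copies (?s, ?a, t) else 0)" for t
    using steps_before_cong[of n "?\<omega> t" \<omega>] by (simp add: steps_before_Suc)
  have cr: "crowded k (Suc n) (?\<omega> t) \<longleftrightarrow> elapsed \<omega> n + t \<le> real k * \<delta> \<and> k < steps_before (?\<omega> t) (Suc n)" for t
    using crowded_cong[of n "?\<omega> t" \<omega> k] not_crowded by (simp add: crowded_Suc el)
  show ?thesis
  proof (cases "real k * \<delta> < elapsed \<omega> n")
    case True
    have "AE t in sojourn M ?s. ennreal (potential k n \<omega>) = ennreal (potential k (Suc n) (?\<omega> t))"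
      using AE_sojourn[of ?s]
    proof eventually_elim
      case (elim t)
      then show ?case using True not_crowded by (simp add: potential_def cr el)
    qed
    then have "(\<integral>\<^sup>+t. ennreal (potential k n \<omega>) \<partial>sojourn M ?s) = (\<integral>\<^sup>+t. ennreal (potential k (Suc n) (?\<omega> t)) \<partial>sojourn M ?s)"
      by (rule nn_integral_cong_AE)
    then show ?thesis by simp
  next
    case False
    \<comment> \<open>Not being crowded at \<open>n\<close> itself bounds the steps by
      \<open>k\<close>, so the truncated subtraction in \<open>potential\<close> is exact.\<close>
    then have d: "steps_before \<omega> n \<le> k"
      using not_crowded unfolding crowded_def by (meson not_le order_refl)
    show ?thesis
    proof (cases "?s \<in> markov_states M")
      case True
      let ?k = "k - steps_before \<omega> n" and ?r = "real k * \<delta> - elapsed \<omega> n"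
      have r: "real ?k * \<delta> \<le> ?r"
        using elapsed_le_steps(1)[OF \<omega>, of n] d by (simp add: of_nat_diff algebra_simps)
      have "ennreal ((1 + max_rate M * \<delta>) ^ ?k * exp (- max_rate M * ?r)) \<le> (\<integral>\<^sup>+t. ennreal (potential k (Suc n) (?\<omega> t)) \<partial>sojourn M ?s)"
      proof (rule nn_integral_sojourn_potential[OF True exit_rate_le_max_rate[OF True] r])
        fix j t assume j: "j < ?k" "real j * \<delta> \<le> t" "t < real (Suc j) * \<delta>"
        have t0: "0 \<le> t" using j delta_pos by (rule_tac order_trans[of _ "real j * \<delta>"]) auto
        have c: "copies (?s, ?a, t) = Suc j"
          using less_copies_iff[OF t0, of j ?s ?a] less_copies_iff[OF t0, of "Suc j" ?s ?a] j True by auto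
        have "real (Suc j) * \<delta> \<le> real ?k * \<delta>" using j delta_pos by (intro mult_right_mono) auto
        then have "elapsed \<omega> n + t \<le> real k * \<delta>" using j r by linarith
        moreover have "\<not> k < steps_before (?\<omega> t) (Suc n)" using j True by (simp add: st c)
        ultimately have "potential k (Suc n) (?\<omega> t) = (1 + max_rate M * \<delta>) ^ (?k - Suc j) * exp (- max_rate M * (?r - t))"
          using True by (simp add: potential_def cr el st c algebra_simps)
        then show "ennreal ((1 + max_rate M * \<delta>) ^ (?k - Suc j) * exp (- max_rate M * (?r - t))) \<le> ennreal (potential k (Suc n) (?\<omega> t))"
          by simp
      next
        fix t assume "?r < t"
        then have "potential k (Suc n) (?\<omega> t) = 1" by (simp add: potential_def cr el)
        then show "1 \<le> ennreal (potential k (Suc n) (?\<omega> t))" by simp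
      qed
      then show ?thesis using not_crowded False by (simp add: potential_def)
    next
      case PS: False
      have "AE t in sojourn M ?s. ennreal (potential k n \<omega>) = ennreal (potential k (Suc n) (?\<omega> t))"
        using AE_sojourn[of ?s]
      proof eventually_elim
        case (elim t)
        then show ?case using PS False d not_crowded by (simp add: potential_def cr el st)
      qed
      then have "(\<integral>\<^sup>+t. ennreal (potential k n \<omega>) \<partial>sojourn M ?s) = (\<integral>\<^sup>+t. ennreal (potential k (Suc n) (?\<omega> t)) \<partial>sojourn M ?s)"
        by (rule nn_integral_cong_AE)
      then show ?thesis by simp
    qed
  qed
qed

text \<open>The submartingale property in expectation: the conditional expectation after entry
  \<open>n\<close>, given its past, state and action, is the integral over the redrawn sojourn
  time.\<close>

lemma nn_integral_potential_mono: "(\<integral>\<^sup>+\<omega>. ennreal (potential k n \<omega>) \<partial>paths) \<le> (\<integral>\<^sup>+\<omega>. ennreal (potential k (Suc n) \<omega>) \<partial>paths)"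
proof -
  have "(\<integral>\<^sup>+\<omega>. ennreal (potential k n \<omega>) \<partial>paths) \<le> (\<integral>\<^sup>+\<omega>. (\<integral>\<^sup>+t. ennreal (potential k (Suc n) (fun_upd \<omega> n (state_of (\<omega> n), act_of (\<omega> n), t))) \<partial>sojourn M (state_of (\<omega> n))) \<partial>paths)"
    using AE_regular by (intro nn_integral_mono_AE) (elim eventually_mono, rule potential_le_resampled)
  also have "\<dots> = (\<integral>\<^sup>+\<omega>. ennreal (potential k (Suc n) \<omega>) \<partial>paths)"
  proof (rule nn_integral_resample[symmetric, of "\<lambda>\<omega>. ennreal (potential k (Suc n) \<omega>)"])
    show "ennreal (potential k (Suc n) \<omega>) = ennreal (potential k (Suc n) \<omega>')" if "\<And>i. i \<le> n \<Longrightarrow> \<omega> i = \<omega>' i" for \<omega> \<omega>'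
      using potential_cong[of "Suc n" \<omega> \<omega>' k] that by (simp add: less_Suc_eq_le)
  qed measurable
  finally show ?thesis .
qed

lemma max_rate_nonneg: "markov_states M \<noteq> {} \<Longrightarrow> 0 \<le> max_rate M"
  using exit_rate_le_max_rate exit_rate_pos by force

text \<open>By \<open>1 + x \<le> exp x\<close>, as the time left is at least \<delta> times the
  steps left. This makes the expected potential a lower bound for the probability of not being
  crowded.\<close>

lemma potential_le_1:
  assumes "markov_states M \<noteq> {}" and \<omega>: "regular \<omega>"
  shows "potential k n \<omega> \<le> (if crowded k n \<omega> then 0 else 1)"
proof (cases "crowded k n \<omega> \<or> real k * \<delta> < elapsed \<omega> n")
  case False
  then have d: "steps_before \<omega> n \<le> k"
    unfolding crowded_def by (meson not_le order_refl)
  let ?k = "k - steps_before \<omega> n" and ?r = "real k * \<delta> - elapsed \<omega> n" and ?l = "max_rate M"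
  have r: "real ?k * \<delta> \<le> ?r"
    using elapsed_le_steps(1)[OF \<omega>, of n] d by (simp add: of_nat_diff algebra_simps)
  have l: "0 \<le> ?l" using assms(1) by (rule max_rate_nonneg)
  have "(1 + ?l * \<delta>) ^ ?k \<le> exp (?l * \<delta>) ^ ?k"
    using l delta_pos by (intro power_mono exp_ge_add_one_self) auto
  also have "\<dots> = exp (?l * (real ?k * \<delta>))"
    unfolding exp_of_nat_mult[symmetric] by (rule arg_cong[where f = exp]) simp
  also have "\<dots> \<le> exp (?l * ?r)"
    using r l by (simp only: exp_le_cancel_iff mult_left_mono)
  finally have "(1 + ?l * \<delta>) ^ ?k * exp (- ?l * ?r) \<le> exp (?l * ?r) * exp (- ?l * ?r)"
    by (intro mult_right_mono) auto
  also have "\<dots> = 1" by (simp flip: exp_add)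
  finally show ?thesis using False by (simp add: potential_def)
qed (auto simp: potential_def)

text \<open>The potential starts at the constant \<open>?c\<close>, which therefore bounds the
  probability of not being crowded at each \<open>n\<close> from below. Continuity along the
  increasing events removes the horizon.\<close>

lemma measure_crowded_le:
  assumes "markov_states M \<noteq> {}"
  shows "measure paths {\<omega>. \<exists>n. crowded k n \<omega>} \<le> 1 - (1 + max_rate M * \<delta>) ^ k * exp (- max_rate M * (real k * \<delta>))"
    (is "_ \<le> 1 - ?c")
proof -
  have cm [measurable]: "{\<omega>. crowded k n \<omega>} \<in> sets path_space" for n
    using measurable_crowded[of k n] by (simp add: pred_def)
  have c0: "0 \<le> ?c" using max_rate_nonneg[OF assms] delta_pos by simp
  have n: "measure paths {\<omega>. crowded k n \<omega>} \<le> 1 - ?c" for n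
  proof -
    have "\<not> real k * \<delta> < 0" using delta_pos by (simp add: not_less)
    then have "potential k 0 \<omega> = ?c" for \<omega>
      by (simp add: potential_def crowded_def elapsed_def)
    then have "ennreal ?c = (\<integral>\<^sup>+\<omega>. ennreal (potential k 0 \<omega>) \<partial>paths)"
      using paths.emeasure_space_1 by simp
    also have "\<dots> \<le> (\<integral>\<^sup>+\<omega>. ennreal (potential k n \<omega>) \<partial>paths)"
    proof (induction n)
      case (Suc n)
      then show ?case using nn_integral_potential_mono order_trans by blast
    qed simp
    also have "\<dots> \<le> (\<integral>\<^sup>+\<omega>. indicator (- {\<omega>. crowded k n \<omega>}) \<omega> \<partial>paths)"
    proof (rule nn_integral_mono_AE)
      show "AE \<omega> in paths. ennreal (potential k n \<omega>) \<le> indicator (- {\<omega>. crowded k n \<omega>}) \<omega>"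
        using AE_regular
      proof eventually_elim
        case (elim \<omega>)
        have "ennreal (potential k n \<omega>) \<le> ennreal (if crowded k n \<omega> then 0 else 1)"
          by (rule ennreal_leI[OF potential_le_1[OF assms elim]])
        then show ?case by (simp add: indicator_def ennreal_neg split: if_splits)
      qed
    qed
    also have "\<dots> = emeasure paths (space paths - {\<omega>. crowded k n \<omega>})"
      using sets.compl_sets[OF cm, of n] by (subst nn_integral_indicator) (simp_all add: Compl_eq_Diff_UNIV)
    also have "\<dots> = ennreal (1 - measure paths {\<omega>. crowded k n \<omega>})"
      unfolding paths.emeasure_eq_measure by (subst paths.prob_compl) auto
    finally show ?thesis
      by (simp add: ennreal_le_iff)
  qed
  have "(\<lambda>n. measure paths {\<omega>. crowded k n \<omega>}) \<longlonglongrightarrow> measure paths (\<Union>n. {\<omega>. crowded k n \<omega>})"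
  proof (rule paths.finite_Lim_measure_incseq)
    show "incseq (\<lambda>n. {\<omega>. crowded k n \<omega>})"
      by (auto simp: incseq_def crowded_def intro: order_trans)
  qed (use cm in auto)
  then have "measure paths (\<Union>n. {\<omega>. crowded k n \<omega>}) \<le> 1 - ?c"
    using n by (intro LIMSEQ_le_const2) auto
  moreover have "(\<Union>n. {\<omega>. crowded k n \<omega>}) = {\<omega>. \<exists>n. crowded k n \<omega>}" by auto
  ultimately show ?thesis by simp
qed

section \<open>Leaving a state shortly after the lower time bound\<close>

definition jump_soon :: "real \<Rightarrow> nat \<Rightarrow> (nat \<Rightarrow> ('s, 'a) entry) set" where
  "jump_soon a n = {\<omega>. state_of (\<omega> n) \<in> markov_states M \<and> elapsed \<omega> n \<le> a
     \<and> a \<le> elapsed \<omega> n + time_of (\<omega> n) \<and> elapsed \<omega> n + time_of (\<omega> n) < a + \<delta>}"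

lemma sets_jump_soon [measurable]: "jump_soon a n \<in> sets path_space"
proof -
  have "{\<omega> \<in> space path_space. state_of (\<omega> n) \<in> markov_states M \<and> elapsed \<omega> n \<le> a
     \<and> a \<le> elapsed \<omega> n + time_of (\<omega> n) \<and> elapsed \<omega> n + time_of (\<omega> n) < a + \<delta>} \<in> sets path_space"
    by measurable
  then show ?thesis by (simp add: jump_soon_def)
qed

text \<open>Resampling the sojourn time bounds \<open>jump_soon a n\<close> by the event that entry \<open>n\<close> spans time \<open>a\<close>;
  the latter events are disjoint, so their probabilities sum up to at most \<open>1\<close>.\<close>

lemma measure_jump_soon_le:
  assumes "markov_states M \<noteq> {}"
  shows "measure paths (\<Union>n. jump_soon a n) \<le> 1 - exp (- max_rate M * \<delta>)"
proof -
  let ?c = "1 - exp (- max_rate M * \<delta>)"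
  have c0: "0 \<le> ?c" using max_rate_nonneg[OF assms] delta_pos by simp
  \<comment> \<open>Strict on the right, unlike \<open>jump_soon\<close>: a jump exactly at time
    \<open>a\<close> could otherwise put a path into \<open>B\<close> for two consecutive entries.
    The difference is null because sojourn times have no atoms.\<close>
  define B where "B n = {\<omega> :: nat \<Rightarrow> ('s, 'a) entry. state_of (\<omega> n) \<in> markov_states M \<and> elapsed \<omega> n \<le> a \<and> a < elapsed \<omega> n + time_of (\<omega> n)}" for n
  have B [measurable]: "B n \<in> sets path_space" for n
  proof -
    have "{\<omega> \<in> space path_space. state_of (\<omega> n) \<in> markov_states M \<and> elapsed \<omega> n \<le> a \<and> a < elapsed \<omega> n + time_of (\<omega> n)} \<in> sets path_space"
      by measurable
    then show ?thesis by (simp add: B_def)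
  qed
  have el: "elapsed (fun_upd \<omega> n x) n = elapsed \<omega> n" for \<omega> n x
    by (rule elapsed_cong) simp
  have step: "emeasure paths (jump_soon a n) \<le> ennreal ?c * emeasure paths (B n)" for n
  proof -
    let ?up = "\<lambda>\<omega> t. fun_upd \<omega> n (state_of (\<omega> n), act_of (\<omega> n), t)"
    have resample: "emeasure paths A = (\<integral>\<^sup>+\<omega>. (\<integral>\<^sup>+t. indicator A (?up \<omega> t) \<partial>sojourn M (state_of (\<omega> n))) \<partial>paths)"
      if A: "A \<in> sets path_space" and cong: "\<And>\<omega> \<omega>'. (\<And>i. i \<le> n \<Longrightarrow> \<omega> i = \<omega>' i) \<Longrightarrow> \<omega> \<in> A \<longleftrightarrow> \<omega>' \<in> A" for A
    proof -
      have "emeasure paths A = (\<integral>\<^sup>+\<omega>. indicator A \<omega> \<partial>paths)" using A by simp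
      also have "\<dots> = (\<integral>\<^sup>+\<omega>. (\<integral>\<^sup>+t. indicator A (?up \<omega> t) \<partial>sojourn M (state_of (\<omega> n))) \<partial>paths)"
      proof (rule nn_integral_resample)
        show "indicator A \<omega> = indicator A \<omega>'" if "\<And>i. i \<le> n \<Longrightarrow> \<omega> i = \<omega>' i" for \<omega> \<omega>'
          using cong[of \<omega> \<omega>'] that by (simp add: indicator_def)
      qed (use A in simp)
      finally show ?thesis .
    qed
    have "emeasure paths (jump_soon a n) = (\<integral>\<^sup>+\<omega>. (\<integral>\<^sup>+t. indicator (jump_soon a n) (?up \<omega> t) \<partial>sojourn M (state_of (\<omega> n))) \<partial>paths)"
    proof (rule resample[OF sets_jump_soon])
      show "\<omega> \<in> jump_soon a n \<longleftrightarrow> \<omega>' \<in> jump_soon a n" if "\<And>i. i \<le> n \<Longrightarrow> \<omega> i = \<omega>' i" for \<omega> \<omega>'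
      proof -
        have "elapsed \<omega> n = elapsed \<omega>' n" by (rule elapsed_cong) (simp add: that)
        moreover have "\<omega> n = \<omega>' n" by (rule that) simp
        ultimately show ?thesis by (simp only: jump_soon_def mem_Collect_eq)
      qed
    qed
    also have "\<dots> \<le> (\<integral>\<^sup>+\<omega>. ennreal ?c * (\<integral>\<^sup>+t. indicator (B n) (?up \<omega> t) \<partial>sojourn M (state_of (\<omega> n))) \<partial>paths)"
    proof (rule nn_integral_mono)
      fix \<omega> :: "nat \<Rightarrow> ('s, 'a) entry"
      let ?s = "state_of (\<omega> n)"
      show "(\<integral>\<^sup>+t. indicator (jump_soon a n) (?up \<omega> t) \<partial>sojourn M ?s) \<le> ennreal ?c * (\<integral>\<^sup>+t. indicator (B n) (?up \<omega> t) \<partial>sojourn M ?s)"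
      proof (cases "?s \<in> markov_states M \<and> elapsed \<omega> n \<le> a")
        case True
        let ?x = "a - elapsed \<omega> n" and ?E = "exit_rate M ?s"
        interpret so: prob_space "sojourn M ?s" by (rule prob_space_sojourn)
        have s: "?s \<in> markov_states M" and x: "0 \<le> ?x" using True by auto
        have "indicator (jump_soon a n) (?up \<omega> t) = (indicator ({?x..} - {?x + \<delta>..}) t :: ennreal)" for t
          using True by (auto simp: jump_soon_def el indicator_def)
        then have "(\<integral>\<^sup>+t. indicator (jump_soon a n) (?up \<omega> t) \<partial>sojourn M ?s) = emeasure (sojourn M ?s) ({?x..} - {?x + \<delta>..})"
          by simp
        also have "\<dots> = emeasure (sojourn M ?s) {?x..} - emeasure (sojourn M ?s) {?x + \<delta>..}"
          using delta_pos by (intro emeasure_Diff) auto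
        also have "\<dots> = ennreal (exp (- ?E * ?x) - exp (- ?E * (?x + \<delta>)))"
          using emeasure_sojourn_atLeast(1)[OF s x] emeasure_sojourn_atLeast(1)[OF s, of "?x + \<delta>"] x delta_pos
          by (simp add: ennreal_minus)
        \<comment> \<open>Memorylessness: given survival up to time \<open>a\<close>, the state is
          left within \<delta> with probability \<open>1 - exp (- ?E * \<delta>)\<close>, which is
          largest for the maximal rate.\<close>
        also have "\<dots> \<le> ennreal (?c * exp (- ?E * ?x))"
        proof (rule ennreal_leI)
          have "exp (- max_rate M * \<delta>) \<le> exp (- ?E * \<delta>)"
            using exit_rate_le_max_rate[OF s] delta_pos by simp
          then have "(1 - exp (- ?E * \<delta>)) * exp (- ?E * ?x) \<le> ?c * exp (- ?E * ?x)"
            by (intro mult_right_mono) auto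
          moreover have "exp (- ?E * ?x) - exp (- ?E * (?x + \<delta>)) = (1 - exp (- ?E * \<delta>)) * exp (- ?E * ?x)"
            by (simp add: left_diff_distrib distrib_left flip: exp_add)
          ultimately show "exp (- ?E * ?x) - exp (- ?E * (?x + \<delta>)) \<le> ?c * exp (- ?E * ?x)" by linarith
        qed
        also have "\<dots> = ennreal ?c * emeasure (sojourn M ?s) {?x<..}"
          unfolding emeasure_sojourn_atLeast(2)[OF s x] using c0 by (simp add: ennreal_mult)
        also have "emeasure (sojourn M ?s) {?x<..} = (\<integral>\<^sup>+t. indicator {?x<..} t \<partial>sojourn M ?s)" by simp
        also have "(\<lambda>t. indicator {?x<..} t :: ennreal) = (\<lambda>t. indicator (B n) (?up \<omega> t))"
          using True by (auto simp: B_def el indicator_def fun_eq_iff)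
        finally show ?thesis .
      next
        case False
        then have "indicator (jump_soon a n) (?up \<omega> t) = (0 :: ennreal)" for t
          by (auto simp: jump_soon_def el indicator_def)
        then show ?thesis by simp
      qed
    qed
    also have "\<dots> = ennreal ?c * (\<integral>\<^sup>+\<omega>. (\<integral>\<^sup>+t. indicator (B n) (?up \<omega> t) \<partial>sojourn M (state_of (\<omega> n))) \<partial>paths)"
      by (intro nn_integral_cmult measurable_paths borel_measurable_resample) (use B in simp)
    also have "(\<integral>\<^sup>+\<omega>. (\<integral>\<^sup>+t. indicator (B n) (?up \<omega> t) \<partial>sojourn M (state_of (\<omega> n))) \<partial>paths) = emeasure paths (B n)"
    proof (rule resample[OF B, symmetric])
      show "\<omega> \<in> B n \<longleftrightarrow> \<omega>' \<in> B n" if "\<And>i. i \<le> n \<Longrightarrow> \<omega> i = \<omega>' i" for \<omega> \<omega>'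
      proof -
        have "elapsed \<omega> n = elapsed \<omega>' n" by (rule elapsed_cong) (simp add: that)
        moreover have "\<omega> n = \<omega>' n" by (rule that) simp
        ultimately show ?thesis by (simp only: B_def mem_Collect_eq)
      qed
    qed
    finally show ?thesis .
  qed
  have "(\<Sum>n. emeasure paths (B n)) = (\<Sum>n. \<integral>\<^sup>+\<omega>. indicator (B n) \<omega> \<partial>paths)"
    using B by simp
  also have "\<dots> = (\<integral>\<^sup>+\<omega>. (\<Sum>n. indicator (B n) \<omega>) \<partial>paths)"
    by (rule nn_integral_suminf[symmetric]) (use B in simp)
  also have "\<dots> \<le> (\<integral>\<^sup>+\<omega>. 1 \<partial>paths)"
  proof (rule nn_integral_mono_AE)
    show "AE \<omega> in paths. (\<Sum>n. indicator (B n) \<omega>) \<le> (1 :: ennreal)"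
      using AE_regular
    proof eventually_elim
      case (elim \<omega>)
      show ?case
      proof (cases "\<exists>n. \<omega> \<in> B n")
        case True
        then obtain n where n: "\<omega> \<in> B n" ..
        have less: "\<not> m < m'" if "\<omega> \<in> B m" "\<omega> \<in> B m'" for m m'
        proof
          assume "m < m'"
          then have "elapsed \<omega> (Suc m) \<le> elapsed \<omega> m'" by (intro elapsed_mono[OF elim]) simp
          then show False using that by (simp add: B_def elapsed_Suc)
        qed
        then have "\<omega> \<notin> B m" if "m \<noteq> n" for m
          using n that linorder_neqE_nat by blast
        then have "(\<Sum>n. indicator (B n) \<omega> :: ennreal) = (\<Sum>m\<in>{n}. indicator (B m) \<omega>)"
          by (intro suminf_finite) (auto simp: indicator_def)
        then show ?thesis using n by simp
      qed simp
    qed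
  qed
  finally have sum_B: "(\<Sum>n. emeasure paths (B n)) \<le> 1"
    using paths.emeasure_space_1 by simp
  have "emeasure paths (\<Union>n. jump_soon a n) \<le> (\<Sum>n. emeasure paths (jump_soon a n))"
    by (rule emeasure_subadditive_countably) auto
  also have "\<dots> \<le> (\<Sum>n. ennreal ?c * emeasure paths (B n))"
    by (intro suminf_le step) auto
  also have "\<dots> = ennreal ?c * (\<Sum>n. emeasure paths (B n))"
    by (rule ennreal_suminf_cmult)
  also have "\<dots> \<le> ennreal ?c * 1"
    by (rule mult_left_mono[OF sum_B]) simp
  finally show ?thesis
    using c0 by (simp add: paths.emeasure_eq_measure)
qed

end

subsection \<open>Comparison of values\<close>

lemma num_steps_mult: "0 < \<delta> \<Longrightarrow> x / \<delta> \<in> \<nat> \<Longrightarrow> real (num_steps \<delta> x) * \<delta> = x"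
  by (auto simp: num_steps_def field_simps elim!: Nats_cases)

text \<open>Adding a finite number respects all four relations also for infinite values, which
  expected rewards may take.\<close>

lemma satisfies_shift: "satisfies v R p \<Longrightarrow> satisfies (v + ereal e) R (p + e)"
  by (cases R; cases v) auto

lemma satisfies_mono:
  "satisfies v R p \<Longrightarrow> (R \<in> {Less, LessEq} \<Longrightarrow> p \<le> q) \<Longrightarrow> (R \<in> {Greater, GreaterEq} \<Longrightarrow> q \<le> p) \<Longrightarrow> satisfies v R q"
  by (cases R; cases v) auto

section \<open>Pathwise comparison of the reachability events\<close>

context scheduled_markov_automaton
begin

text \<open>With at most \<open>k + 1\<close> steps up to its end, entry \<open>n\<close> ends
  before \<open>a + \<delta>\<close>. At most \<open>k\<close> steps precede it, so it begins before
  \<open>a\<close>, strictly because \<open>0 < k\<close>; hence it takes time and its state is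
  Markovian.\<close>

lemma few_steps_imp_jump_soon:
  assumes \<omega>: "regular \<omega>" and k: "0 < k" "a = real k * \<delta>"
    and few: "steps_before \<omega> n + copies (\<omega> n) \<le> Suc k" and late: "a \<le> elapsed \<omega> n + time_of (\<omega> n)"
  shows "\<omega> \<in> jump_soon a n"
proof -
  have d: "steps_before \<omega> n \<le> k" using few copies_pos[of "\<omega> n"] by linarith
  have before: "elapsed \<omega> n < a"
  proof (cases "steps_before \<omega> n = 0")
    case True
    then show ?thesis using elapsed_le_steps(1)[OF \<omega>, of n] k delta_pos by (simp add: le_less_trans)
  next
    case False
    then have "elapsed \<omega> n < real (steps_before \<omega> n) * \<delta>" using elapsed_le_steps(2)[OF \<omega>] by simp
    also have "\<dots> \<le> a" unfolding k(2) using d delta_pos by (intro mult_right_mono) auto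
    finally show ?thesis .
  qed
  have s: "state_of (\<omega> n) \<in> markov_states M"
    using \<omega> before late by (rule_tac ccontr) auto
  have "time_of (\<omega> n) < real (copies (\<omega> n)) * \<delta>"
    using time_less_copies[OF s, of "time_of (\<omega> n)" "act_of (\<omega> n)"] \<omega> by simp
  then have "elapsed \<omega> n + time_of (\<omega> n) < real (steps_before \<omega> n + copies (\<omega> n)) * \<delta>"
    using elapsed_le_steps(1)[OF \<omega>, of n] by (simp add: distrib_right)
  also have "\<dots> \<le> real (Suc k) * \<delta>"
    using few delta_pos by (intro mult_right_mono) auto
  finally show ?thesis
    using before late s k by (simp add: jump_soon_def distrib_right)
qed

text \<open>A Markovian entry contributes more than \<open>j\<close> steps by its end; a
  probabilistic one has \<open>j = 0\<close>, and the steps were made before it. Either way too many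
  steps end by time \<open>real k * \<delta>\<close>.\<close>

lemma many_steps_imp_crowded:
  assumes \<omega>: "regular \<omega>" and j: "j < copies (\<omega> n)" "k < steps_before \<omega> n + j"
    and early: "elapsed \<omega> n + time_of (\<omega> n) \<le> real k * \<delta>"
  shows "\<exists>n. crowded k n \<omega>"
proof -
  have "k < steps_before \<omega> (Suc n)"
    using j by (auto simp: steps_before_Suc copies_def split: if_splits)
  then have "crowded k (Suc n) \<omega>"
    using early unfolding crowded_def by (auto simp: elapsed_Suc)
  then show ?thesis ..
qed

lemma reach_within_Bounded_iff:
  "regular \<omega> \<Longrightarrow> a < b \<Longrightarrow> \<omega> \<in> reach_within (Bounded a b) G \<longleftrightarrow>
     (\<exists>n. state_of (\<omega> n) \<in> G \<and> elapsed \<omega> n \<le> b \<and> a \<le> elapsed \<omega> n + time_of (\<omega> n))"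
  unfolding reach_within_def mem_Collect_eq interval_meets_Bounded by auto

lemma reach_within_Unbounded_iff:
  "regular \<omega> \<Longrightarrow> \<omega> \<in> reach_within (Unbounded a) G \<longleftrightarrow>
     (\<exists>n. state_of (\<omega> n) \<in> G \<and> a \<le> elapsed \<omega> n + time_of (\<omega> n))"
  unfolding reach_within_def mem_Collect_eq interval_meets_Unbounded by auto

lemma steps_le_imp_elapsed_le:
  assumes "regular \<omega>" "steps_before \<omega> n \<le> k"
  shows "elapsed \<omega> n \<le> real k * \<delta>"
proof -
  have "real (steps_before \<omega> n) * \<delta> \<le> real k * \<delta>" using assms delta_pos by (intro mult_right_mono) auto
  then show ?thesis using elapsed_le_steps(1)[OF assms(1), of n] by linarith
qed

lemma digit_reach_stepsI:
  "state_of (\<omega> n) \<in> G \<Longrightarrow> j < copies (\<omega> n) \<Longrightarrow> steps_before \<omega> n + j \<in> J \<Longrightarrow> digit \<omega> \<in> reach_steps M J G"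
  unfolding digit_reach_steps_iff by blast

text \<open>The upper step bound fails only if the clock ran ahead of \<open>b\<close>, the lower
  one only if no copy of entry \<open>n\<close> has more than \<open>num_steps \<delta> a\<close>
  earlier steps, which forces a jump soon after \<open>a\<close>. Otherwise some copy is a
  witness.\<close>

lemma reach_within_Bounded_imp:
  assumes \<omega>: "regular \<omega>" and wf: "well_formed \<delta> (Bounded a b)" and r: "\<omega> \<in> reach_within (Bounded a b) G"
  shows "digit \<omega> \<in> reach_steps M (digit_bound \<delta> (Bounded a b)) G \<or> (\<exists>n. crowded (num_steps \<delta> b) n \<omega>)
    \<or> a \<noteq> 0 \<and> \<omega> \<in> (\<Union>n. jump_soon a n)"
proof -
  have ab: "0 \<le> a" "a < b" and a: "real (num_steps \<delta> a) * \<delta> = a" and b: "real (num_steps \<delta> b) * \<delta> = b"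
    using wf num_steps_mult[OF delta_pos] by auto
  obtain n where n: "state_of (\<omega> n) \<in> G" "elapsed \<omega> n \<le> b" "a \<le> elapsed \<omega> n + time_of (\<omega> n)"
    using r reach_within_Bounded_iff[OF \<omega> ab(2)] by auto
  consider "num_steps \<delta> b < steps_before \<omega> n" | "steps_before \<omega> n \<le> num_steps \<delta> b" "a = 0"
    | "steps_before \<omega> n \<le> num_steps \<delta> b" "a \<noteq> 0" "steps_before \<omega> n + copies (\<omega> n) \<le> Suc (num_steps \<delta> a)"
    | "steps_before \<omega> n \<le> num_steps \<delta> b" "a \<noteq> 0" "Suc (num_steps \<delta> a) < steps_before \<omega> n + copies (\<omega> n)"
    by linarith
  then show ?thesis
  proof cases
    case 1
    then have "crowded (num_steps \<delta> b) n \<omega>" using n b by (auto simp: crowded_def)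
    then show ?thesis by blast
  next
    case 2
    then have "digit \<omega> \<in> reach_steps M (digit_bound \<delta> (Bounded a b)) G"
      using n by (intro digit_reach_stepsI[of \<omega> n _ 0]) auto
    then show ?thesis by blast
  next
    case 3
    have "0 < num_steps \<delta> a" using a 3(2) by (rule_tac ccontr) auto
    then have "\<omega> \<in> jump_soon a n"
      using 3 n a by (intro few_steps_imp_jump_soon[OF \<omega>, of "num_steps \<delta> a"]) auto
    then show ?thesis using 3 by blast
  next
    case 4
    have "real (num_steps \<delta> a) * \<delta> < real (num_steps \<delta> b) * \<delta>" using a b ab by simp
    then have "num_steps \<delta> a < num_steps \<delta> b" using delta_pos by simp
    \<comment> \<open>The witness is the first copy whose step count exceeds
      \<open>num_steps \<delta> a\<close>. If the whole block lies beyond that count, the truncated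
      subtraction yields offset 0.\<close>
    then have "digit \<omega> \<in> reach_steps M (digit_bound \<delta> (Bounded a b)) G"
      using n 4 copies_pos[of "\<omega> n"]
      by (intro digit_reach_stepsI[of \<omega> n _ "Suc (num_steps \<delta> a) - steps_before \<omega> n"]) (auto simp del: copies_pos)
    then show ?thesis by blast
  qed
qed

text \<open>Real time never exceeds the digital clock, so the upper bound is inherited and only the
  lower one can fail. This is why \<open>err_minus\<close> has no term for \<open>b\<close>.\<close>

lemma reach_steps_Bounded_imp:
  assumes \<omega>: "regular \<omega>" and wf: "well_formed \<delta> (Bounded a b)"
    and r: "digit \<omega> \<in> reach_steps M (digit_bound \<delta> (Bounded a b)) G"
  shows "\<omega> \<in> reach_within (Bounded a b) G \<or> a \<noteq> 0 \<and> (\<exists>n. crowded (num_steps \<delta> a) n \<omega>)"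
proof -
  have ab: "0 \<le> a" "a < b" and a: "real (num_steps \<delta> a) * \<delta> = a" and b: "real (num_steps \<delta> b) * \<delta> = b"
    using wf num_steps_mult[OF delta_pos] by auto
  obtain n j where n: "state_of (\<omega> n) \<in> G" and j: "j < copies (\<omega> n)"
    and J: "steps_before \<omega> n + j \<in> digit_bound \<delta> (Bounded a b)"
    using r unfolding digit_reach_steps_iff by auto
  have "steps_before \<omega> n \<le> num_steps \<delta> b" using J by (auto split: if_splits)
  then have le_b: "elapsed \<omega> n \<le> b" using steps_le_imp_elapsed_le[OF \<omega>] b by metis
  show ?thesis
  proof (cases "a \<le> elapsed \<omega> n + time_of (\<omega> n)")
    case True
    then show ?thesis using n le_b reach_within_Bounded_iff[OF \<omega> ab(2)] by blast
  next
    case False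
    moreover have "0 \<le> elapsed \<omega> n + time_of (\<omega> n)" using elapsed_nonneg[OF \<omega>, of n] \<omega> by simp
    ultimately have "a \<noteq> 0" by auto
    moreover from this have "num_steps \<delta> a < steps_before \<omega> n + j" using J by auto
    ultimately show ?thesis
      using many_steps_imp_crowded[OF \<omega> j, of "num_steps \<delta> a"] False a by auto
  qed
qed

lemma reach_within_Unbounded_imp:
  assumes \<omega>: "regular \<omega>" and wf: "well_formed \<delta> (Unbounded a)" and r: "\<omega> \<in> reach_within (Unbounded a) G"
  shows "digit \<omega> \<in> reach_steps M (digit_bound \<delta> (Unbounded a)) G \<or> a \<noteq> 0 \<and> \<omega> \<in> (\<Union>n. jump_soon a n)"
proof -
  have a: "real (num_steps \<delta> a) * \<delta> = a"
    using wf num_steps_mult[OF delta_pos] by auto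
  obtain n where n: "state_of (\<omega> n) \<in> G" "a \<le> elapsed \<omega> n + time_of (\<omega> n)"
    using r reach_within_Unbounded_iff[OF \<omega>] by auto
  consider "a = 0" | "a \<noteq> 0" "steps_before \<omega> n + copies (\<omega> n) \<le> Suc (num_steps \<delta> a)"
    | "a \<noteq> 0" "Suc (num_steps \<delta> a) < steps_before \<omega> n + copies (\<omega> n)"
    by linarith
  then show ?thesis
  proof cases
    case 1
    then have "digit \<omega> \<in> reach_steps M (digit_bound \<delta> (Unbounded a)) G"
      using n by (intro digit_reach_stepsI[of \<omega> n _ 0]) auto
    then show ?thesis by blast
  next
    case 2
    have "0 < num_steps \<delta> a" using a 2(1) by (rule_tac ccontr) auto
    then have "\<omega> \<in> jump_soon a n"
      using 2 n a by (intro few_steps_imp_jump_soon[OF \<omega>, of "num_steps \<delta> a"]) auto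
    then show ?thesis using 2 by blast
  next
    case 3
    \<comment> \<open>Without an upper step bound the last copy, which has the largest step count in
      the block, can serve as witness.\<close>
    then have "digit \<omega> \<in> reach_steps M (digit_bound \<delta> (Unbounded a)) G"
      using n by (intro digit_reach_stepsI[of \<omega> n _ "copies (\<omega> n) - 1"]) auto
    then show ?thesis by blast
  qed
qed

lemma reach_steps_Unbounded_imp:
  assumes \<omega>: "regular \<omega>" and wf: "well_formed \<delta> (Unbounded a)"
    and r: "digit \<omega> \<in> reach_steps M (digit_bound \<delta> (Unbounded a)) G"
  shows "\<omega> \<in> reach_within (Unbounded a) G \<or> a \<noteq> 0 \<and> (\<exists>n. crowded (num_steps \<delta> a) n \<omega>)"
proof -
  have a: "real (num_steps \<delta> a) * \<delta> = a"
    using wf num_steps_mult[OF delta_pos] by auto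
  obtain n j where n: "state_of (\<omega> n) \<in> G" and j: "j < copies (\<omega> n)"
    and J: "steps_before \<omega> n + j \<in> digit_bound \<delta> (Unbounded a)"
    using r unfolding digit_reach_steps_iff by auto
  show ?thesis
  proof (cases "a \<le> elapsed \<omega> n + time_of (\<omega> n)")
    case True
    then show ?thesis using n reach_within_Unbounded_iff[OF \<omega>] by blast
  next
    case False
    moreover have "0 \<le> elapsed \<omega> n + time_of (\<omega> n)" using elapsed_nonneg[OF \<omega>, of n] \<omega> by simp
    ultimately have "a \<noteq> 0" using wf by auto
    moreover from this have "num_steps \<delta> a < steps_before \<omega> n + j" using J by auto
    ultimately show ?thesis
      using many_steps_imp_crowded[OF \<omega> j, of "num_steps \<delta> a"] False a by auto
  qed
qed

lemma measure_le_add: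
  assumes "A \<in> sets path_space" "B \<in> sets path_space" "AE \<omega> in paths. \<omega> \<in> A \<longrightarrow> \<omega> \<in> B \<or> \<omega> \<in> C"
    and "C \<in> sets path_space" "measure paths C \<le> e"
  shows "measure paths A \<le> measure paths B + e"
proof -
  have "measure paths A \<le> measure paths (B \<union> C)"
    using assms by (intro paths.finite_measure_mono_AE) auto
  also have "\<dots> \<le> measure paths B + measure paths C"
    using assms by (intro measure_Un_le) auto
  finally show ?thesis using assms(5) by linarith
qed

lemma sets_crowded: "{\<omega>. \<exists>n. crowded k n \<omega>} \<in> sets path_space"
proof -
  have "{\<omega> \<in> space path_space. \<exists>n. crowded k n \<omega>} \<in> sets path_space" by measurable
  then show ?thesis by simp
qed

lemma sets_jumps_soon: "(\<Union>n. jump_soon a n) \<in> sets path_space"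
  by measurable

text \<open>Union bounds over the exceptional events: running ahead of \<open>b\<close> and jumping
  soon after \<open>a\<close> for \<open>err_plus\<close>, running ahead of \<open>a\<close> for
  \<open>err_minus\<close>.\<close>

lemma measure_reach_bounds:
  assumes wf: "well_formed \<delta> I" and MS: "markov_states M \<noteq> {}"
  shows "measure paths (reach_within I G) \<le> measure paths {\<omega>. digit \<omega> \<in> reach_steps M (digit_bound \<delta> I) G} + err_plus (max_rate M) \<delta> I"
      (is "measure paths ?A \<le> measure paths ?B + _")
    and "measure paths {\<omega>. digit \<omega> \<in> reach_steps M (digit_bound \<delta> I) G} \<le> measure paths (reach_within I G) + err_minus (max_rate M) \<delta> I"
proof -
  note A = sets_reach_within[of I G] and B = sets_digit_reach[of "digit_bound \<delta> I" G]
  have crowded: "measure paths {\<omega>. \<exists>n. crowded (num_steps \<delta> x) n \<omega>} \<le> 1 - (1 + max_rate M * \<delta>) ^ num_steps \<delta> x * exp (- max_rate M * x)"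
    if "x / \<delta> \<in> \<nat>" for x
    using measure_crowded_le[OF MS, of "num_steps \<delta> x"] num_steps_mult[OF delta_pos that] by simp
  note jump = measure_jump_soon_le[OF MS]
  show "measure paths ?A \<le> measure paths ?B + err_plus (max_rate M) \<delta> I"
  proof (cases I)
    case (Bounded a b)
    let ?C = "{\<omega>. \<exists>n. crowded (num_steps \<delta> b) n \<omega>} \<union> (if a = 0 then {} else (\<Union>n. jump_soon a n))"
    have "measure paths ?C \<le> measure paths {\<omega>. \<exists>n. crowded (num_steps \<delta> b) n \<omega>} + measure paths (if a = 0 then {} else (\<Union>n. jump_soon a n))"
      using sets_crowded sets_jumps_soon by (intro measure_Un_le) auto
    also have "\<dots> \<le> err_plus (max_rate M) \<delta> I"
      using crowded[of b] jump[of a] wf by (auto simp: Bounded)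
    finally have "measure paths ?C \<le> err_plus (max_rate M) \<delta> I" .
    moreover have "AE \<omega> in paths. \<omega> \<in> ?A \<longrightarrow> \<omega> \<in> ?B \<or> \<omega> \<in> ?C"
      using AE_regular
    proof eventually_elim
      case (elim \<omega>)
      then show ?case using wf reach_within_Bounded_imp[OF elim, of a b G] by (auto simp: Bounded)
    qed
    ultimately show ?thesis
      using A B sets_crowded sets_jumps_soon by (intro measure_le_add[of _ _ ?C]) auto
  next
    case (Unbounded a)
    let ?C = "if a = 0 then {} else (\<Union>n. jump_soon a n)"
    have "measure paths ?C \<le> err_plus (max_rate M) \<delta> I"
      using jump[of a] by (simp add: Unbounded)
    moreover have "AE \<omega> in paths. \<omega> \<in> ?A \<longrightarrow> \<omega> \<in> ?B \<or> \<omega> \<in> ?C"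
      using AE_regular
    proof eventually_elim
      case (elim \<omega>)
      then show ?case using wf reach_within_Unbounded_imp[OF elim, of a G] by (auto simp: Unbounded)
    qed
    ultimately show ?thesis
      using A B sets_jumps_soon by (intro measure_le_add[of _ _ ?C]) auto
  qed
  show "measure paths ?B \<le> measure paths ?A + err_minus (max_rate M) \<delta> I"
  proof (cases I)
    case (Bounded a b)
    let ?C = "if a = 0 then {} else {\<omega>. \<exists>n. crowded (num_steps \<delta> a) n \<omega>}"
    have "measure paths ?C \<le> err_minus (max_rate M) \<delta> I"
      using crowded[of a] wf by (simp add: Bounded)
    moreover have "AE \<omega> in paths. \<omega> \<in> ?B \<longrightarrow> \<omega> \<in> ?A \<or> \<omega> \<in> ?C"
      using AE_regular
    proof eventually_elim
      case (elim \<omega>)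
      then show ?case using wf reach_steps_Bounded_imp[OF elim, of a b G] by (auto simp: Bounded)
    qed
    ultimately show ?thesis
      using A B sets_crowded by (intro measure_le_add[of _ _ ?C]) auto
  next
    case (Unbounded a)
    let ?C = "if a = 0 then {} else {\<omega>. \<exists>n. crowded (num_steps \<delta> a) n \<omega>}"
    have "measure paths ?C \<le> err_minus (max_rate M) \<delta> I"
      using crowded[of a] wf by (simp add: Unbounded)
    moreover have "AE \<omega> in paths. \<omega> \<in> ?B \<longrightarrow> \<omega> \<in> ?A \<or> \<omega> \<in> ?C"
      using AE_regular
    proof eventually_elim
      case (elim \<omega>)
      then show ?case using wf reach_steps_Unbounded_imp[OF elim, of a G] by (auto simp: Unbounded)
    qed
    ultimately show ?thesis
      using A B sets_crowded by (intro measure_le_add[of _ _ ?C]) auto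
  qed
qed

text \<open>A signed error \<open>e\<close> is stated because an expected reward may be infinite,
  where a difference of values makes no sense; rewards take \<open>e = 0\<close>.\<close>

lemma ma_value_eq:
  assumes eq: "distr paths (PiM UNIV (\<lambda>_. count_space UNIV)) digit = mdp_paths (digitization M \<delta>) \<sigma>'"
    and valid: "valid_objective M \<delta> ob" and MS: "markov_states M \<noteq> {}"
  shows "\<exists>e. - objective_err_minus M \<delta> ob \<le> e \<and> e \<le> objective_err_plus M \<delta> ob
    \<and> ma_value M \<sigma> ob = digit_value M \<delta> \<sigma>' ob + ereal e"
proof (cases ob)
  case (Reach I G)
  let ?v = "measure paths (reach_within I G)" and ?v' = "measure paths {\<omega>. digit \<omega> \<in> reach_steps M (digit_bound \<delta> I) G}"
  show ?thesis
    using measure_reach_bounds[of I G] valid MS measure_mdp_reach_steps[OF eq, of "digit_bound \<delta> I" G]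
    by (intro exI[of _ "?v - ?v'"]) (auto simp: Reach)
next
  case (ExpReward j G)
  then have j: "j < length (reward_funs M)" using valid by simp
  then show ?thesis
    using nn_integral_mdp_reward[OF eq nth_mem[OF j], of G]
    by (intro exI[of _ 0]) (simp add: ExpReward digitization_def)
qed

end

context digitized_markov_automaton
begin

text \<open>Measurability holds because the expansion takes values in the countable type of
  words.\<close>

lemma generic_scheduler_simulated:
  assumes "valid_mdp_scheduler (digitization M \<delta>) \<sigma>'"
  shows "generic_scheduler M (\<lambda>h. \<sigma>' (expand h))"
  unfolding generic_scheduler_def
proof (intro conjI allI)
  show "set_pmf (\<sigma>' (expand h) s) \<subseteq> enabled (trans_prob M) s" for h s
    using assms enabled_digit_prob[OF delta_pos] by (simp add: valid_mdp_scheduler_def digitization_def)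
  show "(\<lambda>\<omega>. pmf (\<sigma>' (expand (map \<omega> [0..<n])) s) \<alpha>) \<in> borel_measurable (PiM {0..<n} (\<lambda>_. entry_space))" for n s \<alpha>
    by (rule measurable_compose[OF measurable_expand, of n "{0..<n}" "\<lambda>h. pmf (\<sigma>' h s) \<alpha>"]) auto
qed

end

lemma (in nonzeno_markov_automaton) obtain_scheduler:
  obtains \<sigma> where "generic_scheduler M \<sigma>"
proof
  show "generic_scheduler M (\<lambda>_ s. return_pmf (SOME \<alpha>. \<alpha> \<in> enabled (trans_prob M) s))"
    using enabled_nonempty some_in_eq by (auto simp: generic_scheduler_def)
qed

text \<open>Without Markovian states no time ever passes, contrary to non-Zenoness. Hence
  \<open>max_rate M\<close> is the maximum of a nonempty set.\<close>

lemma (in nonzeno_markov_automaton) markov_states_nonempty: "markov_states M \<noteq> {}"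
proof
  assume MS: "markov_states M = {}"
  obtain \<sigma> where \<sigma>: "generic_scheduler M \<sigma>" by (rule obtain_scheduler)
  \<comment> \<open>The digitization constant 1 is an arbitrary positive number that gives access to
    \<open>AE_regular\<close>.\<close>
  interpret scheduled_markov_automaton M 1 \<sigma>
    by unfold_locales (use \<sigma> in auto)
  have "AE \<omega> in paths. False"
    using AE_regular nonzeno[OF \<sigma>]
  proof eventually_elim
    case (elim \<omega>)
    then have "elapsed \<omega> = (\<lambda>n. 0)" using MS by (simp add: elapsed_def fun_eq_iff)
    then show False using elim(2) by (auto simp: filterlim_at_top dest!: spec[of _ "1::real"])
  qed
  then show False by simp
qed

theorem theorem5:
  fixes M :: "('s::finite, 'a::finite) markov_automaton"
    and \<delta> :: real
    and \<O> :: "'d::finite \<Rightarrow> 's objective"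
    and R :: "'d \<Rightarrow> threshold"
  assumes "nonzeno_markov_automaton M"
    and "\<delta> > 0"
    and "\<And>i. valid_objective M \<delta> (\<O> i)"
  shows "{p' :: real ^ 'd. \<forall>p. p' \<in> err_box M \<delta> \<O> p \<longrightarrow> achieve_digit M \<delta> \<O> R p}
           \<subseteq> {p. achieve_ma M \<O> R p} \<and>
         {p. achieve_ma M \<O> R p}
           \<subseteq> {p' :: real ^ 'd. \<exists>p. p' \<in> err_box M \<delta> \<O> p \<and> achieve_digit M \<delta> \<O> R p}"
proof (intro conjI subsetI CollectI; elim CollectE)
  interpret nonzeno_markov_automaton M by fact
  interpret digitized_markov_automaton M \<delta> by unfold_locales fact
  note MS = markov_states_nonempty
  let ?em = "\<lambda>i. objective_err_minus M \<delta> (\<O> i)" and ?ep = "\<lambda>i. objective_err_plus M \<delta> (\<O> i)"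
  {
    fix p' :: "real ^ 'd" assume p': "\<forall>p. p' \<in> err_box M \<delta> \<O> p \<longrightarrow> achieve_digit M \<delta> \<O> R p"
    \<comment> \<open>The worst case over all admissible errors: an upper bound on the value is
      tightened by the largest possible increase \<open>?ep i\<close>, a lower bound is raised by
      the largest possible decrease \<open>?em i\<close>.\<close>
    define p :: "real ^ 'd" where
      "p = (\<chi> i. case R i of Less \<Rightarrow> p' $ i - ?ep i | LessEq \<Rightarrow> p' $ i - ?ep i
        | Greater \<Rightarrow> p' $ i + ?em i | GreaterEq \<Rightarrow> p' $ i + ?em i)"
    \<comment> \<open>The box around \<open>p\<close> has to be nonempty. Instead of estimating the
      error terms, this is read off from the actual error of an arbitrary scheduler, which lies
      between the two bounds.\<close>
    have err: "- ?em i \<le> ?ep i" for i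
    proof -
      obtain \<sigma> where \<sigma>: "generic_scheduler M \<sigma>" by (rule obtain_scheduler)
      interpret scheduled_markov_automaton M \<delta> \<sigma> by unfold_locales fact
      show ?thesis
        using ma_value_eq[OF distr_digit_scheduler assms(3)[of i] MS] by auto
    qed
    have "p' \<in> err_box M \<delta> \<O> p"
      unfolding err_box_def
    proof (intro CollectI allI)
      show "p' $ i \<in> {p $ i - ?em i..p $ i + ?ep i}" for i
        using err[of i] by (cases "R i") (auto simp: p_def)
    qed
    then obtain \<sigma>' where \<sigma>': "valid_mdp_scheduler (digitization M \<delta>) \<sigma>'"
      and sat: "\<And>i. satisfies (digit_value M \<delta> \<sigma>' (\<O> i)) (R i) (p $ i)"
      using p' unfolding achieve_digit_def by blast
    let ?\<sigma> = "\<lambda>h. \<sigma>' (expand h)"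
    interpret scheduled_markov_automaton M \<delta> ?\<sigma>
      by unfold_locales (rule generic_scheduler_simulated[OF \<sigma>'])
    have "satisfies (ma_value M ?\<sigma> (\<O> i)) (R i) (p' $ i)" for i
    proof -
      obtain e where e: "- ?em i \<le> e" "e \<le> ?ep i"
        and v: "ma_value M ?\<sigma> (\<O> i) = digit_value M \<delta> \<sigma>' (\<O> i) + ereal e"
        using ma_value_eq[OF distr_digit_simulated[OF refl \<sigma>'] assms(3)[of i] MS] by blast
      have "satisfies (ma_value M ?\<sigma> (\<O> i)) (R i) (p $ i + e)"
        unfolding v by (rule satisfies_shift[OF sat])
      then show ?thesis
      proof (rule satisfies_mono)
        show "p $ i + e \<le> p' $ i" if "R i \<in> {Less, LessEq}"
          using that e by (auto simp: p_def)
        show "p' $ i \<le> p $ i + e" if "R i \<in> {Greater, GreaterEq}"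
          using that e by (auto simp: p_def)
      qed
    qed
    then show "achieve_ma M \<O> R p'"
      unfolding achieve_ma_def using generic by blast
  next
    fix p' :: "real ^ 'd" assume "achieve_ma M \<O> R p'"
    then obtain \<sigma> where \<sigma>: "generic_scheduler M \<sigma>"
      and sat: "\<And>i. satisfies (ma_value M \<sigma> (\<O> i)) (R i) (p' $ i)"
      unfolding achieve_ma_def by blast
    interpret scheduled_markov_automaton M \<delta> \<sigma> by unfold_locales fact
    have "\<forall>i. \<exists>e. - ?em i \<le> e \<and> e \<le> ?ep i \<and> ma_value M \<sigma> (\<O> i) = digit_value M \<delta> digit_scheduler (\<O> i) + ereal e"
      using ma_value_eq[OF distr_digit_scheduler assms(3) MS] by blast
    then obtain e where e: "\<And>i. - ?em i \<le> e i" "\<And>i. e i \<le> ?ep i"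
      and v: "\<And>i. ma_value M \<sigma> (\<O> i) = digit_value M \<delta> digit_scheduler (\<O> i) + ereal (e i)"
      by metis
    \<comment> \<open>Shifting by the actual errors relates the MDP values to \<open>p\<close>
      exactly as the automaton values are related to \<open>p'\<close>.\<close>
    define p :: "real ^ 'd" where "p = (\<chi> i. p' $ i - e i)"
    have "p' \<in> err_box M \<delta> \<O> p"
      unfolding err_box_def
    proof (intro CollectI allI)
      show "p' $ i \<in> {p $ i - ?em i..p $ i + ?ep i}" for i
        using e(1)[of i] e(2)[of i] by (simp add: p_def)
    qed
    moreover have "satisfies (digit_value M \<delta> digit_scheduler (\<O> i)) (R i) (p $ i)" for i
    proof -
      have "digit_value M \<delta> digit_scheduler (\<O> i) = ma_value M \<sigma> (\<O> i) + ereal (- e i)"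
        unfolding v by (cases "digit_value M \<delta> digit_scheduler (\<O> i)") auto
      then show ?thesis
        using satisfies_shift[OF sat[of i], of "- e i"] by (simp add: p_def)
    qed
    ultimately show "\<exists>p. p' \<in> err_box M \<delta> \<O> p \<and> achieve_digit M \<delta> \<O> R p"
      unfolding achieve_digit_def using valid_digit_scheduler by blast
  }
qed

end
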